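(* Let $(\phi_t)_{t\ge 0}$ be a non-elliptic semigroup in the unit disc $\mathbb D$ with Denjoy-Wolff point $\tau\in\partial\mathbb D$ and Koenigs function $h$, and let $\Omega:=h(\mathbb D)$. Then the following are equivalent: (1) for some (and hence any) $z\in\mathbb D$, the orbit $[0,+\infty)\ni t\mapsto\phi_t(z)$ converges non-tangentially to $\tau$ as $t\to+\infty$; (2) for some (and hence any) $z\in\mathbb D$, the curve $[0,+\infty)\ni t\mapsto\phi_t(z)$ can be parametrized to be a quasi-geodesic (for the hyperbolic distance of $\mathbb D$); (3) for some (and hence any) $p\in\Omega$ there exist $0<c<C$ such that for all $t\ge0$, $$c\,\delta^+_{\Omega,p}(t)\le\delta^-_{\Omega,p}(t)\le C\,\delta^+_{\Omega,p}(t).$$ Here "for some (and hence any)" means that the "for some" version and the "for any" version of each condition are equivalent.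
   Context: A semigroup in $\mathbb D$ is a family $(\phi_t)_{t\ge0}$ of holomorphic self-maps of the unit disc $\mathbb D$ with $\phi_0=\mathrm{id}$, $\phi_{t+s}=\phi_t\circ\phi_s$, and $t\mapsto\phi_t$ continuous for the topology of uniform convergence on compacta. It is non-elliptic with Denjoy-Wolff point $\tau\in\partial\mathbb D$ if $\phi_t\to\tau$ uniformly on compacta of $\mathbb D$ as $t\to+\infty$. A Koenigs function of a non-elliptic semigroup is a univalent function $h:\mathbb D\to\mathbb C$ such that $h(\phi_t(z))=h(z)+it$ for all $t\ge0$, $z\in\mathbb D$ (it exists and is unique up to an additive constant). Its image $\Omega=h(\mathbb D)$ is starlike at infinity, i.e. it is a simply connected domain $\Omega\subsetneq\mathbb C$ with $\Omega+it\subseteq\Omega$ for all $t\ge0$. The orbit of $z$ converges non-tangentially to $\tau$ if the cluster set of $\mathrm{Arg}(1-\overline\tau\phi_t(z))$ as $t\to+\infty$ is contained in the open interval $(-\pi/2,\pi/2)$. For $p\in\mathbb C$ and $t\ge0$: $$\delta^+_{\Omega,p}(t):=\min\{t,\ \inf\{|z-(p+it)|: z\in\partial\Omega,\ \mathrm{Re}\,z\ge\mathrm{Re}\,p\}\},$$ $$\delta^-_{\Omega,p}(t):=\min\{t,\ \inf\{|z-(p+it)|: z\in\partial\Omega,\ \mathrm{Re}\,z\le\mathrm{Re}\,p\}\},$$ with $\inf\emptyset=+\infty$. For a simply connected domain $D\subsetneq\mathbb C$, the hyperbolic metric is $\kappa_D(z;v)=|v|/f'(0)$, where $f:\mathbb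 D\to D$ is the Riemann map with $f(0)=z$, $f'(0)>0$; the hyperbolic distance $k_D$ is the associated length distance. A curve $\gamma:[a,b)\to D$ ($-\infty<a<b\le+\infty$) is a quasi-geodesic if there are $A\ge1$, $B\ge0$ with $\frac1A(t-s)-B\le k_D(\gamma(s),\gamma(t))\le A(t-s)+B$ for all $a\le s\le t<b$. A curve $\gamma$ can be parametrized to be a quasi-geodesic if $\gamma\circ\psi$ is a quasi-geodesic for some increasing homeomorphism $\psi$ from an interval $[a',b')$ onto the domain of $\gamma$. *)

theory Defs
  imports "HOL-Complex_Analysis.Complex_Analysis"
begin

abbreviation unit_disc :: "complex set" where
  "unit_disc \<equiv> ball 0 1"

(* Only the values phi t z with t >= 0 and z in the disc are constrained. *)
definition disc_semigroup :: "(real \<Rightarrow> complex \<Rightarrow> complex) \<Rightarrow> bool" where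
  "disc_semigroup \<phi> \<longleftrightarrow>
     (\<forall>t\<ge>0. \<phi> t holomorphic_on unit_disc \<and> \<phi> t ` unit_disc \<subseteq> unit_disc) \<and>
     (\<forall>z\<in>unit_disc. \<phi> 0 z = z) \<and>
     (\<forall>s\<ge>0. \<forall>t\<ge>0. \<forall>z\<in>unit_disc. \<phi> (t + s) z = \<phi> t (\<phi> s z)) \<and>
     (\<forall>t\<ge>0. \<forall>K. compact K \<and> K \<subseteq> unit_disc \<longrightarrow>
        uniform_limit K \<phi> (\<phi> t) (at t within {0..}))"

definition nonelliptic_semigroup :: "(real \<Rightarrow> complex \<Rightarrow> complex) \<Rightarrow> complex \<Rightarrow> bool" where
  "nonelliptic_semigroup \<phi> \<tau> \<longleftrightarrow>
     disc_semigroup \<phi> \<and> \<tau> \<in> sphere 0 1 \<and>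
     (\<forall>K. compact K \<and> K \<subseteq> unit_disc \<longrightarrow> uniform_limit K \<phi> (\<lambda>_. \<tau>) at_top)"

definition koenigs_function ::
    "(real \<Rightarrow> complex \<Rightarrow> complex) \<Rightarrow> (complex \<Rightarrow> complex) \<Rightarrow> bool" where
  "koenigs_function \<phi> h \<longleftrightarrow>
     h holomorphic_on unit_disc \<and> inj_on h unit_disc \<and>
     (\<forall>t\<ge>0. \<forall>z\<in>unit_disc. h (\<phi> t z) = h z + \<i> * of_real t)"

definition cluster_set_at_top :: "(real \<Rightarrow> 'a::topological_space) \<Rightarrow> 'a set" where
  "cluster_set_at_top f =
     {l. \<exists>s :: nat \<Rightarrow> real. filterlim s at_top sequentially \<and> (\<lambda>n. f (s n)) \<longlonglongrightarrow> l}"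

definition orbit_converges_nontangentially ::
    "(real \<Rightarrow> complex \<Rightarrow> complex) \<Rightarrow> complex \<Rightarrow> complex \<Rightarrow> bool" where
  "orbit_converges_nontangentially \<phi> \<tau> z \<longleftrightarrow>
     cluster_set_at_top (\<lambda>t. Arg (1 - cnj \<tau> * \<phi> t z)) \<subseteq> {- pi / 2 <..< pi / 2}"

(* The infimum is taken in the extended reals, so it is \<infinity> over the empty set; the minimum
   with t is always finite for t \<ge> 0. *)
definition delta_plus :: "complex set \<Rightarrow> complex \<Rightarrow> real \<Rightarrow> real" where
  "delta_plus \<Omega> p t = real_of_ereal (min (ereal t)
     (INF z \<in> {z \<in> frontier \<Omega>. Re z \<ge> Re p}. ereal (cmod (z - (p + \<i> * of_real t)))))"

definition delta_minus :: "complex set \<Rightarrow> complex \<Rightarrow> real \<Rightarrow> real" where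
  "delta_minus \<Omega> p t = real_of_ereal (min (ereal t)
     (INF z \<in> {z \<in> frontier \<Omega>. Re z \<le> Re p}. ereal (cmod (z - (p + \<i> * of_real t)))))"

definition is_riemann_map :: "complex set \<Rightarrow> complex \<Rightarrow> (complex \<Rightarrow> complex) \<Rightarrow> bool" where
  "is_riemann_map D z f \<longleftrightarrow>
     f holomorphic_on unit_disc \<and> bij_betw f unit_disc D \<and>
     f 0 = z \<and> deriv f 0 \<in> \<real> \<and> Re (deriv f 0) > 0"

(* The Riemann map is unique only on the unit disc, as values outside it are arbitrary;
   hence SOME instead of THE. The derivative at 0 does not depend on the choice. *)
definition hyperbolic_metric :: "complex set \<Rightarrow> complex \<Rightarrow> complex \<Rightarrow> real" where
  "hyperbolic_metric D z v = cmod v / Re (deriv (SOME f. is_riemann_map D z f) 0)"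

(* Integrability is part of the condition on \<gamma>: the derivative of a valid_path may be unbounded
   near its break points, so that the path may have infinite length (where the total function
   integral would return 0). *)
definition hyperbolic_dist :: "complex set \<Rightarrow> complex \<Rightarrow> complex \<Rightarrow> real" where
  "hyperbolic_dist D z w = Inf {l. \<exists>\<gamma>. valid_path \<gamma> \<and> path_image \<gamma> \<subseteq> D \<and>
     pathstart \<gamma> = z \<and> pathfinish \<gamma> = w \<and>
     ((\<lambda>t. hyperbolic_metric D (\<gamma> t) (vector_derivative \<gamma> (at t))) has_integral l) {0..1}}"

definition half_open :: "real \<Rightarrow> ereal \<Rightarrow> real set" where
  "half_open a b = {t. a \<le> t \<and> ereal t < b}"

definition quasi_geodesic ::
    "complex set \<Rightarrow> real \<Rightarrow> ereal \<Rightarrow> (real \<Rightarrow> complex) \<Rightarrow> bool" where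
  "quasi_geodesic D a b \<gamma> \<longleftrightarrow>
     ereal a < b \<and> continuous_on (half_open a b) \<gamma> \<and> \<gamma> ` half_open a b \<subseteq> D \<and>
     (\<exists>A\<ge>1. \<exists>B\<ge>0. \<forall>s\<in>half_open a b. \<forall>t\<in>half_open a b. s \<le> t \<longrightarrow>
        (1 / A) * (t - s) - B \<le> hyperbolic_dist D (\<gamma> s) (\<gamma> t) \<and>
        hyperbolic_dist D (\<gamma> s) (\<gamma> t) \<le> A * (t - s) + B)"

definition parametrizable_as_quasi_geodesic ::
    "complex set \<Rightarrow> real \<Rightarrow> ereal \<Rightarrow> (real \<Rightarrow> complex) \<Rightarrow> bool" where
  "parametrizable_as_quasi_geodesic D a b \<gamma> \<longleftrightarrow>
     (\<exists>a' b' \<psi> \<psi>'. ereal a' < b' \<and>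
        homeomorphism (half_open a' b') (half_open a b) \<psi> \<psi>' \<and>
        strict_mono_on (half_open a' b') \<psi> \<and>
        quasi_geodesic D a' b' (\<gamma> \<circ> \<psi>))"

end

theory Submission
  imports Defs "HOL-Real_Asymp.Real_Asymp"
begin

text \<open>
  Move everything to the right half plane by a Cayley map sending the Denjoy-Wolff point to
  infinity; let \<open>W t\<close> be the image of the orbit. All three conditions are equivalent to
  \<open>|W t| \<le> K Re (W t)\<close>. The key fact, a form of Julia's lemma, is that \<open>Re (W t)\<close> is nondecreasing.

  Non-tangential orbits are then quasi-geodesics when parametrized by \<open>ln (Re (W t))\<close>. Conversely,
  if hyperbolically bounded steps backwards along the orbit move it away linearly, then
  monotonicity makes \<open>Re W\<close> decay geometrically along these steps, and summing the steps bounds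
  \<open>|W|\<close> by \<open>Re W\<close>; no Morse lemma is needed.

  If the two one-sided distances are comparable, backward steps proportional to them have bounded
  length, and they move away linearly because a geodesic of the domain has to pass through the
  channel between the vertical slits below the nearest boundary points on the two sides.
  If one of them is much smaller than the other, a detour through the large empty half disc
  joins two orbit points by a path of logarithmic length, whereas a non-tangential orbit needs
  linear length along the nearby slit.
\<close>

section \<open>Schwarz-Pick estimates in the right half plane\<close>

text \<open>The only geometry of \<open>\<Omega>\<close> that enters is that an omitted point forces
  the whole vertical ray below it to be omitted. This is used in two ways: the square root on the
  slit complement gives explicit distortion bounds, and the slit is a wall that a curve below its
  tip cannot cross. The sector condition is tractable because \<open>Re (W t)\<close> never
  decreases: for \<open>s \<le> t\<close> the half-plane distance of \<open>W s\<close> and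
  \<open>W t\<close> is, up to a bounded error, the logarithm of
  \<open>(Re (W t) + |W t - W s|)^2 / (Re (W t) * Re (W s))\<close>. A linear lower bound for the
  distance along backward steps and a polynomial upper bound for the numerator therefore already
  force decay of the real part, and this decay in turn improves the bound on
  \<open>|W t - W s|\<close>. Half-plane distances belong to the metric \<open>|dw| / Re w\<close>,
  which is twice the metric of the disc; this is where the divisions by 2 in the later distance
  estimates come from.\<close>

abbreviation rhp :: "complex set" where
  "rhp \<equiv> {w. 0 < Re w}"

text \<open>If \<open>d\<close> is the distance for the metric \<open>|dw| / Re w\<close> (twice the one of the disc), then \<open>hsep a b = 4 sinh\<^sup>2 (d / 2)\<close>.\<close>

definition hsep :: "complex \<Rightarrow> complex \<Rightarrow> real" where
  "hsep a b = (cmod (a - b))\<^sup>2 / (Re a * Re b)"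

lemma hsep_commute: "hsep a b = hsep b a"
  by (simp add: hsep_def norm_minus_commute mult.commute)

lemma hsep_nonneg: "a \<in> rhp \<Longrightarrow> b \<in> rhp \<Longrightarrow> 0 \<le> hsep a b"
  by (simp add: hsep_def)

text \<open>As \<open>- cnj b\<close> is the mirror image of \<open>b\<close> in the imaginary axis,
  \<open>|a - b| / |a + cnj b|\<close> is the pseudo-hyperbolic distance. The identity converts
  between that quotient and \<open>hsep\<close>.\<close>

lemma norm_add_cnj_sq: "(cmod (a + cnj b))\<^sup>2 = (cmod (a - b))\<^sup>2 + 4 * (Re a * Re b)"
  unfolding cmod_power2 by (simp add: algebra_simps power2_eq_square)

lemma norm_add_cnj_le: "b \<in> rhp \<Longrightarrow> cmod (a + cnj b) \<le> cmod (a - b) + 2 * Re b"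
proof -
  assume b: "b \<in> rhp"
  have "a + cnj b = (a - b) + of_real (2 * Re b)"
    by (simp add: complex_eq_iff)
  then have "cmod (a + cnj b) \<le> cmod (a - b) + cmod (of_real (2 * Re b))"
    by (metis norm_triangle_ineq)
  then show ?thesis using b by (simp add: norm_mult)
qed

text \<open>The Schwarz lemma for \<open>G\<close> followed by the Moebius map of the half plane
  onto the disc that takes \<open>G 0\<close> to 0.\<close>

lemma schwarz_disc_rhp:
  assumes "G holomorphic_on ball 0 1" "G ` ball 0 1 \<subseteq> rhp" "cmod z < 1"
  shows "cmod (G z - G 0) \<le> cmod z * cmod (G z + cnj (G 0))"
proof -
  define k where "k = (\<lambda>z. (G z - G 0) / (G z + cnj (G 0)))"
  have R: "Re (G u) > 0" if "cmod u < 1" for u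
    using assms(2) that by (auto simp: image_subset_iff)
  have nz: "G u + cnj (G 0) \<noteq> 0" if "cmod u < 1" for u
    using R[OF that] R[of 0] by (auto simp: complex_eq_iff)
  have "k holomorphic_on ball 0 1"
    unfolding k_def using nz by (intro holomorphic_intros assms) auto
  moreover have "k 0 = 0" by (simp add: k_def)
  moreover have "cmod (k u) < 1" if "cmod u < 1" for u
  proof -
    have "(cmod (G u - G 0))\<^sup>2 < (cmod (G u + cnj (G 0)))\<^sup>2"
      using R[OF that] R[of 0] by (simp add: norm_add_cnj_sq)
    then have "cmod (G u - G 0) < cmod (G u + cnj (G 0))"
      by (rule power2_less_imp_less) simp
    then show ?thesis using nz[OF that] by (simp add: k_def norm_divide)
  qed
  ultimately have "cmod (k z) \<le> cmod z"
    using Schwarz_Lemma(1)[of k z] assms(3) by auto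
  then show ?thesis
    using nz[OF assms(3)] by (simp add: k_def norm_divide divide_le_eq)
qed

text \<open>On the half-size ball the pseudo-hyperbolic quotient of \<open>G u\<close> and
  \<open>G v\<close> is at most 1/2, while its denominator exceeds its numerator by at most
  \<open>2 * Re (G v)\<close>. Solving for the numerator gives the constant 2. The quotient is
  symmetric, so \<open>G u\<close> and \<open>G v\<close> may change roles.\<close>

lemma schwarz_ball_rhp:
  assumes "G holomorphic_on ball v r" "G ` ball v r \<subseteq> rhp" "cmod (u - v) \<le> r / 2" "0 < r"
  shows "cmod (G u - G v) \<le> 2 * Re (G v)" "cmod (G u - G v) \<le> 2 * Re (G u)"
proof -
  define K where "K = (\<lambda>z. G (v + of_real r * z))"
  have *: "v + of_real r * z \<in> ball v r" if "cmod z < 1" for z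
    using that assms(4) by (simp add: dist_norm norm_mult)
  have "G \<circ> (\<lambda>z. v + of_real r * z) holomorphic_on ball 0 1"
    by (rule holomorphic_on_compose_gen[OF _ assms(1)]) (use * in \<open>auto intro!: holomorphic_intros\<close>)
  then have K: "K holomorphic_on ball 0 1" by (simp add: K_def o_def)
  define z where "z = (u - v) / of_real r"
  have z: "cmod z \<le> 1 / 2" using assms(3,4) by (simp add: z_def norm_divide divide_le_eq)
  have Kz: "K z = G u" "K 0 = G v" using assms(4) by (auto simp: K_def z_def)
  have KH: "K ` ball 0 1 \<subseteq> rhp" unfolding K_def using assms(2) * by (auto simp: image_subset_iff)
  have "cmod (G u - G v) \<le> cmod z * cmod (G u + cnj (G v))"
    using schwarz_disc_rhp[OF K, of z] z Kz KH by simp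
  also have "\<dots> \<le> 1/2 * cmod (G u + cnj (G v))" using z by (intro mult_right_mono) auto
  finally have 1: "cmod (G u - G v) \<le> 1/2 * cmod (G u + cnj (G v))" .
  have "K z \<in> rhp" "K 0 \<in> rhp"
    using KH z by (auto simp: image_subset_iff)
  then have Gv: "G v \<in> rhp" and Gu: "G u \<in> rhp"
    by (simp_all only: Kz)
  show "cmod (G u - G v) \<le> 2 * Re (G v)"
    using 1 norm_add_cnj_le[OF Gv, of "G u"] by simp
  have "cmod (G u + cnj (G v)) = cmod (G v + cnj (G u))"
    by (metis add.commute complex_cnj_add complex_cnj_cnj complex_mod_cnj)
  then show "cmod (G u - G v) \<le> 2 * Re (G u)"
    using 1 norm_add_cnj_le[OF Gu, of "G v"] by (simp add: norm_minus_commute)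
qed

text \<open>The inverse of \<open>w \<mapsto> (w - b) / (w + cnj b)\<close>: the Moebius map of the
  disc onto the half plane (for \<open>b\<close> in it) that takes 0 to \<open>b\<close> and 1 to
  infinity.\<close>

definition to_rhp :: "complex \<Rightarrow> complex \<Rightarrow> complex" where
  "to_rhp b z = (b + cnj b * z) / (1 - z)"

lemma to_rhp_add_cnj: "z \<noteq> 1 \<Longrightarrow> to_rhp b z + cnj b = of_real (2 * Re b) / (1 - z)"
  unfolding complex_add_cnj[symmetric] by (simp add: to_rhp_def field_simps)

lemma Re_to_rhp:
  assumes "z \<noteq> 1"
  shows "Re (to_rhp b z) = Re b * (1 - (cmod z)\<^sup>2) / (cmod (1 - z))\<^sup>2"
proof -
  have "to_rhp b z = (b + cnj b * z) * cnj (1 - z) / of_real ((cmod (1 - z))\<^sup>2)"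
    unfolding to_rhp_def by (subst complex_div_cnj) simp
  then have "Re (to_rhp b z) = Re ((b + cnj b * z) * cnj (1 - z)) / (cmod (1 - z))\<^sup>2"
    by (simp only: Re_divide_of_real)
  also have "Re ((b + cnj b * z) * cnj (1 - z)) = Re b * (1 - (cmod z)\<^sup>2)"
    unfolding cmod_power2 by (simp add: algebra_simps power2_eq_square)
  finally show ?thesis .
qed

lemma to_rhp_in: "b \<in> rhp \<Longrightarrow> cmod z < 1 \<Longrightarrow> to_rhp b z \<in> rhp"
  by (cases "z = 1") (auto simp: Re_to_rhp power_less_one_iff abs_square_less_1)

lemma to_rhp_holomorphic: "to_rhp b holomorphic_on ball 0 1"
  unfolding to_rhp_def by (intro holomorphic_intros) auto

lemma hsep_to_rhp:
  assumes "b \<in> rhp" "cmod z < 1" "cmod u < 1"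
  shows "hsep (to_rhp b z) (to_rhp b u) =
    4 * (cmod (z - u))\<^sup>2 / ((1 - (cmod z)\<^sup>2) * (1 - (cmod u)\<^sup>2))"
proof -
  have nz: "z \<noteq> 1" "u \<noteq> 1" using assms by auto
  have "to_rhp b z - to_rhp b u = of_real (2 * Re b) / (1 - z) - of_real (2 * Re b) / (1 - u)"
    using to_rhp_add_cnj[OF nz(1), of b] to_rhp_add_cnj[OF nz(2), of b]
    by (metis add_diff_cancel_right)
  also have "\<dots> = of_real (2 * Re b) * (z - u) / ((1 - z) * (1 - u))"
    using nz by (simp add: field_simps)
  finally have "cmod (to_rhp b z - to_rhp b u) =
      2 * Re b * cmod (z - u) / (cmod (1 - z) * cmod (1 - u))"
    using assms(1) by (simp add: norm_mult norm_divide)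
  moreover have "(cmod z)\<^sup>2 < 1" "(cmod u)\<^sup>2 < 1" using assms by (auto simp: power_less_one_iff abs_square_less_1)
  moreover have "cmod (1 - z) > 0" "cmod (1 - u) > 0" using nz by auto
  moreover have "(2 * x * d / (p * q))\<^sup>2 / (x * y / p\<^sup>2 * (x * y' / q\<^sup>2)) = 4 * d\<^sup>2 / (y * y')"
    if "x > 0" "y > 0" "y' > 0" "p > 0" "q > 0" for x y y' p q d :: real
    using that by (simp add: divide_simps power2_eq_square)
  ultimately show ?thesis
    unfolding hsep_def Re_to_rhp[OF nz(1)] Re_to_rhp[OF nz(2)] using assms(1)
    by simp
qed

lemma to_rhp_surj:
  assumes "a \<in> rhp" "b \<in> rhp"
  defines "z \<equiv> (a - b) / (a + cnj b)"
  shows "cmod z < 1" "to_rhp b z = a"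
proof -
  have nz: "a + cnj b \<noteq> 0" using assms(1,2) by (auto simp: complex_eq_iff)
  have "(cmod (a - b))\<^sup>2 < (cmod (a + cnj b))\<^sup>2"
    using assms(1,2) by (simp add: norm_add_cnj_sq)
  then have "cmod (a - b) < cmod (a + cnj b)"
    by (rule power2_less_imp_less) simp
  then show z: "cmod z < 1" using nz by (simp add: z_def norm_divide)
  then have nz1: "1 - z \<noteq> 0" by auto
  have zz: "z * (a + cnj b) = a - b" using nz by (simp add: z_def)
  have "b + cnj b * z = a * (1 - z)" using zz by (simp add: algebra_simps)
  then show "to_rhp b z = a" using nz1 by (simp add: to_rhp_def)
qed

lemma schwarz_pick_rhp:
  assumes "F holomorphic_on rhp" "F ` rhp \<subseteq> rhp" "a \<in> rhp" "b \<in> rhp"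
  shows "hsep (F a) (F b) \<le> hsep a b"
proof -
  define z where "z = (a - b) / (a + cnj b)"
  have z: "cmod z < 1" "to_rhp b z = a" using to_rhp_surj[OF assms(3,4)] by (auto simp: z_def)
  have nz: "a + cnj b \<noteq> 0" using assms(3,4) by (auto simp: complex_eq_iff)
  have im: "to_rhp b ` ball 0 1 \<subseteq> rhp" using to_rhp_in[OF assms(4)] by auto
  have hol: "F \<circ> to_rhp b holomorphic_on ball 0 1"
    by (rule holomorphic_on_compose_gen[OF to_rhp_holomorphic assms(1) im])
  have 0: "to_rhp b 0 = b" by (simp add: to_rhp_def)
  have Fa: "F a \<in> rhp" and Fb: "F b \<in> rhp" using assms by auto
  have "cmod (F a - F b) \<le> cmod z * cmod (F a + cnj (F b))"
    using schwarz_disc_rhp[OF hol, of z] im assms(2) z 0 by (auto simp: image_subset_iff)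
  then have "cmod (F a - F b) * cmod (a + cnj b) \<le> cmod (a - b) * cmod (F a + cnj (F b))"
    using nz by (simp add: z_def norm_divide field_simps)
  then have "(cmod (F a - F b) * cmod (a + cnj b))\<^sup>2 \<le> (cmod (a - b) * cmod (F a + cnj (F b)))\<^sup>2"
    by (intro power_mono) auto
  \<comment> \<open>Both sides are expanded by \<open>norm_add_cnj_sq\<close>; the product of the
    two squared differences occurs on both sides and cancels.\<close>
  then have "(cmod (F a - F b))\<^sup>2 * (Re a * Re b) \<le> (cmod (a - b))\<^sup>2 * (Re (F a) * Re (F b))"
    by (simp add: power_mult_distrib norm_add_cnj_sq algebra_simps)
  then show ?thesis using Fa Fb assms(3,4) by (simp add: hsep_def divide_simps mult_ac)
qed

lemma tanh_artanh_real:
  fixes x :: real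
  assumes "\<bar>x\<bar> < 1"
  shows "tanh (artanh x) = x"
proof -
  have p: "1 + x > 0" "1 - x > 0" using assms by auto
  have "- 2 * artanh x = ln ((1 - x) / (1 + x))"
    using p by (simp add: artanh_def ln_div)
  then have e: "exp (- 2 * artanh x) = (1 - x) / (1 + x)"
    using p by simp
  show ?thesis unfolding tanh_real_altdef e using p by (simp add: divide_simps)
qed

text \<open>The image of a radius of the disc, where \<open>tanh (s / 2)\<close> is the unit-speed
  parameter for \<open>2 |dz| / (1 - |z|^2)\<close>. The bound on \<open>exp L\<close> is the
  identity \<open>hsep a b = exp L - 2 + exp (- L)\<close> without its last term.\<close>

lemma rhp_geodesic:
  assumes "a \<in> rhp" "b \<in> rhp"
  obtains P L where "0 \<le> L" "exp L \<le> hsep a b + 2" "continuous_on {0..L} P"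
    "P ` {0..L} \<subseteq> rhp" "P 0 = a" "P L = b"
    "\<And>s t. s \<in> {0..L} \<Longrightarrow> t \<in> {0..L} \<Longrightarrow> hsep (P s) (P t) = (2 * sinh ((s - t) / 2))\<^sup>2"
proof -
  define z where "z = (b - a) / (b + cnj a)"
  have z: "cmod z < 1" "to_rhp a z = b" using to_rhp_surj[OF assms(2,1)] by (auto simp: z_def)
  define e where "e = (if z = 0 then 1 else sgn z)"
  have e: "cmod e = 1" "z = e * of_real (cmod z)"
    by (auto simp: e_def norm_sgn) (simp add: sgn_eq)
  define L where "L = 2 * artanh (cmod z)"
  have L0: "0 \<le> L" unfolding L_def using z
    by (simp add: artanh_def)
  define c where "c = (\<lambda>s::real. e * of_real (tanh (s / 2)))"
  define P where "P = (\<lambda>s. to_rhp a (c s))"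
  have nc: "cmod (c s) < 1" for s
    using e tanh_real_bounds[of "s/2"] by (auto simp: c_def norm_mult abs_less_iff)
  have nP: "P s \<in> rhp" for s unfolding P_def by (rule to_rhp_in[OF assms(1) nc])
  have cont: "continuous_on {0..L} P"
  proof -
    have "continuous_on {0..L} c" unfolding c_def by (intro continuous_intros) auto
    moreover have "continuous_on (ball 0 1) (to_rhp a)"
      using to_rhp_holomorphic holomorphic_on_imp_continuous_on by blast
    ultimately show ?thesis unfolding P_def
      by (intro continuous_on_compose2[of "ball 0 1" "to_rhp a" _ c]) (use nc in auto)
  qed
  have hs: "hsep (P s) (P t) = (2 * sinh ((s - t) / 2))\<^sup>2" for s t
  proof -
    have ch: "1 - (tanh y)\<^sup>2 = 1 / (cosh y)\<^sup>2" for y :: real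
    proof -
      have "1 - (tanh y)\<^sup>2 = ((cosh y)\<^sup>2 - (sinh y)\<^sup>2) / (cosh y)\<^sup>2"
        using cosh_real_pos[of y] by (simp add: tanh_def power_divide diff_divide_distrib)
      then show ?thesis by (simp add: cosh_square_eq)
    qed
    have n: "cmod (c s) = \<bar>tanh (s/2)\<bar>" for s using e by (simp add: c_def norm_mult)
    have d: "cmod (c s - c t) = \<bar>tanh (s/2) - tanh (t/2)\<bar>"
      using e by (simp add: c_def flip: right_diff_distrib of_real_diff add: norm_mult)
    have "hsep (P s) (P t) = 4 * (tanh (s/2) - tanh (t/2))\<^sup>2 * ((cosh (s/2))\<^sup>2 * (cosh (t/2))\<^sup>2)"
      unfolding P_def hsep_to_rhp[OF assms(1) nc nc] n d by (simp add: ch)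
    also have "\<dots> = (2 * ((tanh (s/2) - tanh (t/2)) * (cosh (s/2) * cosh (t/2))))\<^sup>2"
      by (simp add: power_mult_distrib)
    also have "(tanh (s/2) - tanh (t/2)) * (cosh (s/2) * cosh (t/2)) = sinh ((s - t) / 2)"
      using cosh_real_pos[of "s/2"] cosh_real_pos[of "t/2"]
      unfolding tanh_def diff_divide_distrib sinh_diff by (simp add: field_simps)
    finally show ?thesis .
  qed
  have P0: "P 0 = a" by (simp add: P_def c_def to_rhp_def)
  have "tanh (L/2) = cmod z"
    unfolding L_def using z tanh_artanh_real by auto
  then have PL: "P L = b" unfolding P_def c_def using e z by simp
  have "hsep a b = (2 * sinh (L/2))\<^sup>2"
    using hs[of L 0] PL P0 by (simp add: hsep_commute)
  also have "\<dots> = exp L - 2 + exp (- L)"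
    unfolding sinh_def by (simp add: power2_eq_square algebra_simps flip: exp_add)
  finally have "exp L \<le> hsep a b + 2" by simp
  show ?thesis
    by (rule that[OF L0 \<open>exp L \<le> hsep a b + 2\<close> cont _ P0 PL]) (use nP hs in auto)
qed

text \<open>A substitute for the Koebe quarter theorem: the square root maps the complement of a vertical
  slit into the half plane, where Schwarz-Pick applies.\<close>

lemma slit_distortion:
  assumes "f holomorphic_on rhp" "\<And>w s. w \<in> rhp \<Longrightarrow> 0 \<le> s \<Longrightarrow> f w \<noteq> \<zeta> - \<i> * of_real s"
    and ab: "a \<in> rhp" "b \<in> rhp"
  shows "cmod (f b - \<zeta>) \<le> (hsep a b + 2)\<^sup>2 * cmod (f a - \<zeta>)" (is ?A)
    and "cmod (f a - \<zeta>) \<le> M \<Longrightarrow> cmod (f b - \<zeta>) \<le> M \<Longrightarrow>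
      cmod (f a - f b) \<le> 2 * M * sqrt (hsep a b)" (is "_ \<Longrightarrow> _ \<Longrightarrow> ?B")
proof -
  define Q where "Q = (\<lambda>w. csqrt ((f w - \<zeta>) / \<i>))"
  have npos: "(f w - \<zeta>) / \<i> \<notin> \<real>\<^sub>\<le>\<^sub>0" if "w \<in> rhp" for w
  proof
    assume "(f w - \<zeta>) / \<i> \<in> \<real>\<^sub>\<le>\<^sub>0"
    then obtain r where r: "(f w - \<zeta>) / \<i> = of_real r" "r \<le> 0"
      by (auto simp: nonpos_Reals_def)
    then have "f w - \<zeta> = \<i> * of_real r" by (metis complex_i_not_zero mult.commute nonzero_divide_eq_eq)
    then have "f w = \<zeta> - \<i> * of_real (- r)" by (simp add: algebra_simps)
    then show False using assms(2)[OF that, of "- r"] r by auto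
  qed
  have hol: "Q holomorphic_on rhp"
    unfolding Q_def by (intro holomorphic_intros assms(1)) (use npos in auto)
  have Q2: "(Q w)\<^sup>2 = (f w - \<zeta>) / \<i>" for w by (simp add: Q_def)
  have Qpos: "Q ` rhp \<subseteq> rhp"
  proof clarify
    fix w assume w: "0 < Re w"
    have "Re (Q w) \<noteq> 0"
    proof
      assume "Re (Q w) = 0"
      then have "(f w - \<zeta>) / \<i> = of_real (- (Im (Q w))\<^sup>2)"
        unfolding Q2[symmetric] by (simp add: complex_eq_iff power2_eq_square)
      also have "\<dots> \<in> \<real>\<^sub>\<le>\<^sub>0" by (simp only: nonpos_Reals_of_real_iff) simp
      finally show False using npos[of w] w by simp
    qed
    then show "0 < Re (Q w)" using Re_csqrt[of "(f w - \<zeta>) / \<i>"] by (simp add: Q_def)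
  qed
  have nQ: "(cmod (Q w))\<^sup>2 = cmod (f w - \<zeta>)" for w
  proof -
    have "cmod (f w - \<zeta>) = cmod ((f w - \<zeta>) / \<i>)" by (simp only: norm_divide) simp
    also have "\<dots> = (cmod (Q w))\<^sup>2" by (simp only: Q2[symmetric] norm_power)
    finally show ?thesis by simp
  qed
  define E where "E = hsep a b"
  have E0: "E \<ge> 0" using ab by (simp add: E_def hsep_nonneg)
  have Qa: "Re (Q a) > 0" "Re (Q b) > 0" using Qpos ab by auto
  have "hsep (Q a) (Q b) \<le> E" unfolding E_def
    by (rule schwarz_pick_rhp[OF hol Qpos ab])
  then have "(cmod (Q a - Q b))\<^sup>2 \<le> E * (Re (Q a) * Re (Q b))"
    using Qa by (simp add: hsep_def divide_le_eq)
  also have "\<dots> \<le> E * (cmod (Q a) * cmod (Q b))"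
    using E0 Qa by (intro mult_left_mono mult_mono complex_Re_le_cmod) auto
  finally have S: "(cmod (Q a - Q b))\<^sup>2 \<le> E * (cmod (Q a) * cmod (Q b))" .
  have pa: "cmod (Q a) > 0" "cmod (Q b) > 0" using Qa by auto
  \<comment> \<open>For the ratio \<open>x = |Q b| / |Q a|\<close>, the bound \<open>S\<close> gives
    \<open>x^2 + 1 \<le> (E + 2) * x\<close> and so \<open>x \<le> E + 2\<close>. Since
    \<open>|f w - \<zeta>| = |Q w|^2\<close>, the first claim carries the square of this
    factor.\<close>
  have "cmod (Q b) \<le> (E + 2) * cmod (Q a)"
  proof (rule ccontr)
    assume c: "\<not> ?thesis"
    have "(cmod (Q b) - cmod (Q a))\<^sup>2 \<le> (cmod (Q a - Q b))\<^sup>2"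
      by (metis abs_norm_cancel norm_minus_commute norm_triangle_ineq3 power2_abs power_mono abs_ge_zero)
    then have "(cmod (Q b) - cmod (Q a))\<^sup>2 \<le> E * (cmod (Q a) * cmod (Q b))" using S by linarith
    then have "cmod (Q b) * cmod (Q b) + cmod (Q a) * cmod (Q a) \<le> (E + 2) * cmod (Q a) * cmod (Q b)"
      by (simp add: power2_eq_square algebra_simps)
    moreover have "(E + 2) * cmod (Q a) * cmod (Q b) < cmod (Q b) * cmod (Q b)"
      using c pa by (intro mult_strict_right_mono) auto
    moreover have "0 \<le> cmod (Q a) * cmod (Q a)" by simp
    ultimately show False by linarith
  qed
  then have "(cmod (Q b))\<^sup>2 \<le> ((E + 2) * cmod (Q a))\<^sup>2"
    by (intro power_mono) auto
  then show ?A by (simp add: nQ power_mult_distrib E_def)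
  assume M: "cmod (f a - \<zeta>) \<le> M" "cmod (f b - \<zeta>) \<le> M"
  have M0: "M \<ge> 0" using M(1) norm_ge_zero[of "f a - \<zeta>"] by linarith
  have qa: "cmod (Q a) \<le> sqrt M" "cmod (Q b) \<le> sqrt M"
    using M by (auto intro!: real_le_rsqrt simp: nQ)
  have "cmod (f a - f b) = cmod ((Q a)\<^sup>2 - (Q b)\<^sup>2)"
  proof -
    have "f a - f b = \<i> * ((Q a)\<^sup>2 - (Q b)\<^sup>2)" by (simp add: Q2 field_simps)
    then show ?thesis by (simp add: norm_mult)
  qed
  also have "\<dots> = cmod (Q a - Q b) * cmod (Q a + Q b)"
    by (simp add: power2_eq_square algebra_simps flip: norm_mult)
  also have "\<dots> \<le> sqrt (E * M) * (2 * sqrt M)"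
  proof (rule mult_mono)
    have "E * (cmod (Q a) * cmod (Q b)) \<le> E * (sqrt M * sqrt M)"
      using qa E0 M0 by (intro mult_left_mono mult_mono) auto
    then show "cmod (Q a - Q b) \<le> sqrt (E * M)"
      using S M0 by (intro real_le_rsqrt) auto
    show "cmod (Q a + Q b) \<le> 2 * sqrt M" using qa norm_triangle_ineq[of "Q a" "Q b"] by linarith
  qed (use E0 M0 in auto)
  also have "\<dots> = 2 * M * sqrt E" using M0 by (simp add: real_sqrt_mult)
  finally show ?B by (simp add: E_def)
qed

section \<open>Summation along chains of backward steps\<close>

lemma summable_poly_exp:
  fixes c M C :: real
  assumes "c > 0"
  shows "summable (\<lambda>k. (1 + M * real k)\<^sup>2 * exp (C - c * real k))"
proof -
  have s: "summable (\<lambda>k. real k * real k * exp (- c) ^ k)"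
       "summable (\<lambda>k. real k * exp (- c) ^ k)"
       "summable (\<lambda>k. exp (- c) ^ k)"
  proof -
    have n: "norm (exp (- c)) < 1" using assms by simp
    have p0: "summable (\<lambda>k. exp (-c) ^ k)" using n by (rule summable_geometric)
    have 1: "(\<lambda>k. real k * exp (- c) ^ k) \<in> O(\<lambda>k. exp (- c / 2) ^ k)"
      "(\<lambda>k. real k * real k * exp (- c) ^ k) \<in> O(\<lambda>k. exp (- c / 2) ^ k)"
      using assms unfolding exp_of_nat_mult[symmetric] by real_asymp+
    have n2: "norm (exp (- c / 2)) < 1" using assms by simp
    have p2: "summable (\<lambda>k. norm (exp (- c / 2) ^ k))"
      using summable_geometric[OF n2] by simp
    show "summable (\<lambda>k. real k * real k * exp (- c) ^ k)"
       "summable (\<lambda>k. real k * exp (- c) ^ k)"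
       "summable (\<lambda>k. exp (- c) ^ k)"
      using summable_comparison_test_bigo[OF p2 1(1)] summable_comparison_test_bigo[OF p2 1(2)] p0
      by auto
  qed
  have "(\<lambda>k. (1 + M * real k)\<^sup>2 * exp (C - c * real k)) =
     (\<lambda>k. exp C * (M\<^sup>2 * (real k * real k * exp (- c) ^ k) + 2 * M * (real k * exp (- c) ^ k) + exp (- c) ^ k))"
    by (auto simp: exp_diff exp_minus algebra_simps power2_eq_square field_simps simp flip: exp_of_nat_mult)
  then show ?thesis using s by (auto intro!: summable_mult summable_add)
qed

text \<open>The chain lists points met when an orbit is followed backwards from \<open>w 0\<close>.
  Given \<open>Re (w k) \<le> Re (w 0)\<close>, the logarithm equals the distance of
  \<open>w 0\<close> and \<open>w k\<close> for \<open>|dw| / Re w\<close> up to an additive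
  constant. So the chain recedes at linear speed, with steps that are bounded on the scale of the
  metric.\<close>

definition receding_chain :: "real \<Rightarrow> real \<Rightarrow> real \<Rightarrow> (nat \<Rightarrow> complex) \<Rightarrow> nat \<Rightarrow> bool" where
  "receding_chain c C M w N \<longleftrightarrow>
     (\<forall>k\<le>N. 0 < Re (w k) \<and> Re (w k) \<le> Re (w 0) \<and>
        c * real k - C \<le> ln ((Re (w 0) + cmod (w 0 - w k))\<^sup>2 / (Re (w 0) * Re (w k)))) \<and>
     (\<forall>k<N. cmod (w (Suc k) - w k) \<le> M * Re (w k))"

text \<open>A bootstrap. No real part exceeds the first one, so \<open>j\<close> steps add up to at
  most \<open>M * j * Re (w 0)\<close>. Inserted into the logarithmic lower bound, this polynomial
  growth loses against the exponential, whence \<open>Re (w j) \<le> a j * Re (w 0)\<close> with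
  summable \<open>a\<close>. Adding up the steps once more, now with this decay, gives a bound
  independent of the length \<open>N\<close> of the chain.\<close>

lemma chain_decay:
  fixes c C M :: real
  assumes "c > 0" "M \<ge> 0"
  obtains K where "K \<ge> 0"
    "\<And>w N. receding_chain c C M w N \<Longrightarrow> cmod (w 0 - w N) \<le> K * Re (w 0)"
proof -
  define a where "a = (\<lambda>k. (1 + M * real k)\<^sup>2 * exp (C - c * real k))"
  have sa: "summable a" unfolding a_def by (rule summable_poly_exp[OF assms(1)])
  have a0: "a k \<ge> 0" for k by (simp add: a_def)
  define K where "K = M * suminf a"
  have K0: "K \<ge> 0" unfolding K_def using assms suminf_nonneg[OF sa a0] by simp
  show ?thesis
  proof (rule that[OF K0])
    fix w N assume "receding_chain c C M w N"
    then have pos: "\<And>k. k \<le> N \<Longrightarrow> 0 < Re (w k)"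
      and mono: "\<And>k. k \<le> N \<Longrightarrow> Re (w k) \<le> Re (w 0)"
      and step: "\<And>k. k < N \<Longrightarrow> cmod (w (Suc k) - w k) \<le> M * Re (w k)"
      and low: "\<And>k. k \<le> N \<Longrightarrow> c * real k - C \<le>
          ln ((Re (w 0) + cmod (w 0 - w k))\<^sup>2 / (Re (w 0) * Re (w k)))"
      by (auto simp: receding_chain_def)
    have tel: "cmod (w 0 - w k) \<le> (\<Sum>j<k. M * Re (w j))" if "k \<le> N" for k
      using that
    proof (induction k)
      case (Suc k)
      have "cmod (w 0 - w (Suc k)) \<le> cmod (w 0 - w k) + cmod (w (Suc k) - w k)"
        using norm_triangle_ineq4[of "w 0 - w k" "w (Suc k) - w k"] by (simp add: algebra_simps)
      then show ?case using Suc step[of k] by simp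
    qed simp
    have dec: "Re (w j) \<le> a j * Re (w 0)" if j: "j \<le> N" for j
    proof -
      define x0 where "x0 = Re (w 0)"
      define xj where "xj = Re (w j)"
      have p: "x0 > 0" "xj > 0" using pos[of 0] pos[OF j] by (auto simp: x0_def xj_def)
      have "cmod (w 0 - w j) \<le> (\<Sum>i<j. M * Re (w i))" by (rule tel[OF j])
      also have "\<dots> \<le> (\<Sum>i<j. M * x0)"
        using mono assms j by (intro sum_mono mult_left_mono) (auto simp: x0_def)
      finally have "cmod (w 0 - w j) \<le> M * j * x0" by (simp add: mult_ac)
      then have "x0 + cmod (w 0 - w j) \<le> (1 + M * j) * x0" by (simp add: algebra_simps)
      then have "(x0 + cmod (w 0 - w j))\<^sup>2 \<le> ((1 + M * j) * x0)\<^sup>2"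
        using p by (intro power_mono) auto
      then have 1: "(x0 + cmod (w 0 - w j))\<^sup>2 / (x0 * xj) \<le> (1 + M * j)\<^sup>2 * x0 / xj"
        using p by (simp add: power_mult_distrib power2_eq_square[of x0] divide_simps mult_ac)
      have 2: "(x0 + cmod (w 0 - w j))\<^sup>2 / (x0 * xj) > 0"
        using p by (intro divide_pos_pos zero_less_power mult_pos_pos add_pos_nonneg) auto
      have "exp (c * real j - C) \<le> (x0 + cmod (w 0 - w j))\<^sup>2 / (x0 * xj)"
        using low[OF j] 2 unfolding x0_def xj_def by (simp add: ln_ge_iff)
      then have "exp (c * real j - C) \<le> (1 + M * j)\<^sup>2 * x0 / xj"
        using 1 by linarith
      then have "exp (c * real j - C) * xj \<le> (1 + M * j)\<^sup>2 * x0"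
        using p by (simp add: pos_le_divide_eq)
      then have "exp (C - c * real j) * (exp (c * real j - C) * xj) \<le> exp (C - c * real j) * ((1 + M * j)\<^sup>2 * x0)"
        by (intro mult_left_mono) auto
      moreover have "exp (C - c * real j) * (exp (c * real j - C) * xj) = xj"
        by (simp flip: exp_add mult.assoc)
      ultimately have "xj \<le> exp (C - c * real j) * ((1 + M * j)\<^sup>2 * x0)" by simp
      then show ?thesis
        by (simp add: x0_def xj_def a_def mult_ac)
    qed
    have "cmod (w 0 - w N) \<le> (\<Sum>j<N. M * Re (w j))" by (rule tel[OF order_refl])
    also have "\<dots> \<le> (\<Sum>j<N. M * (a j * Re (w 0)))"
      using dec assms by (intro sum_mono mult_left_mono) auto
    also have "\<dots> = M * sum a {..<N} * Re (w 0)"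
      by (simp add: sum_distrib_left sum_distrib_right mult_ac)
    also have "\<dots> \<le> M * suminf a * Re (w 0)"
      using assms pos[of 0] sum_le_suminf[OF sa, of "{..<N}"] a0
      by (intro mult_right_mono mult_left_mono) auto
    finally show "cmod (w 0 - w N) \<le> K * Re (w 0)" by (simp add: K_def)
  qed
qed

section \<open>Domains starlike at infinity\<close>

text \<open>The values \<open>\<sigma> = 1\<close> and \<open>\<sigma> = - 1\<close> give
  \<open>delta_plus\<close> and \<open>delta_minus\<close>; with the sign as a parameter each
  estimate is proved once for both sides.\<close>

definition side_dist :: "real \<Rightarrow> complex set \<Rightarrow> complex \<Rightarrow> real \<Rightarrow> real" where
  "side_dist \<sigma> \<Omega> p t = real_of_ereal (min (ereal t)
     (INF z \<in> {z \<in> frontier \<Omega>. 0 \<le> \<sigma> * Re (z - p)}. ereal (cmod (z - (p + \<i> * of_real t)))))"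

lemma delta_plus_eq: "delta_plus = side_dist 1"
  and delta_minus_eq: "delta_minus = side_dist (- 1)"
  by (simp_all add: fun_eq_iff delta_plus_def delta_minus_def side_dist_def)

lemma side_dist_cases:
  assumes "0 \<le> t"
  obtains "side_dist \<sigma> \<Omega> p t = t" "\<And>z. z \<in> frontier \<Omega> \<Longrightarrow> \<not> 0 \<le> \<sigma> * Re (z - p)"
  | q where "q \<in> frontier \<Omega>" "0 \<le> \<sigma> * Re (q - p)"
    "side_dist \<sigma> \<Omega> p t = min t (cmod (q - (p + \<i> * of_real t)))"
    "\<And>z. z \<in> frontier \<Omega> \<Longrightarrow> 0 \<le> \<sigma> * Re (z - p) \<Longrightarrow>
      cmod (q - (p + \<i> * of_real t)) \<le> cmod (z - (p + \<i> * of_real t))"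
proof -
  define S where "S = {z \<in> frontier \<Omega>. 0 \<le> \<sigma> * Re (z - p)}"
  define c where "c = p + \<i> * of_real t"
  have sd: "side_dist \<sigma> \<Omega> p t = real_of_ereal (min (ereal t) (INF z \<in> S. ereal (cmod (z - c))))"
    by (simp add: side_dist_def S_def c_def)
  have "closed S"
  proof -
    have "S = frontier \<Omega> \<inter> {z. 0 \<le> \<sigma> * Re (z - p)}" by (auto simp: S_def)
    moreover have "closed {z. 0 \<le> \<sigma> * Re (z - p)}"
      by (intro closed_Collect_le continuous_intros)
    ultimately show ?thesis by (simp add: closed_Int)
  qed
  show ?thesis
  proof (cases "S = {}")
    case True
    then have "side_dist \<sigma> \<Omega> p t = t" by (simp add: sd top_ereal_def)
    moreover have "\<not> 0 \<le> \<sigma> * Re (z - p)" if "z \<in> frontier \<Omega>" for z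
      using True that by (auto simp: S_def)
    ultimately show ?thesis by (rule that(1))
  next
    case False
    obtain q where q: "q \<in> S" "\<And>z. z \<in> S \<Longrightarrow> dist c q \<le> dist c z"
      using distance_attains_inf[OF \<open>closed S\<close> False] by metis
    then have q': "\<And>z. z \<in> S \<Longrightarrow> cmod (q - c) \<le> cmod (z - c)"
      by (simp add: dist_norm norm_minus_commute)
    have "(INF z \<in> S. ereal (cmod (z - c))) = ereal (cmod (q - c))"
      by (rule antisym) (use q q' in \<open>auto intro: INF_lower INF_greatest\<close>)
    then have "side_dist \<sigma> \<Omega> p t = min t (cmod (q - c))" by (simp add: sd min_def)
    then show ?thesis using that(2)[of q] q q' by (auto simp: S_def c_def)
  qed
qed

lemma side_dist_nonneg: "0 \<le> t \<Longrightarrow> 0 \<le> side_dist \<sigma> \<Omega> p t"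
  and side_dist_le_self: "0 \<le> t \<Longrightarrow> side_dist \<sigma> \<Omega> p t \<le> t"
  by (rule side_dist_cases[of t \<sigma> \<Omega> p]; simp)+

text \<open>\<open>f\<close> and \<open>g\<close> are mutually inverse conformal maps between the
  half plane and the domain. \<open>shift\<close> is starlikeness at infinity, and
  \<open>escape\<close> is what remains of the convergence of the orbits to the Denjoy-Wolff
  point.\<close>

locale starlike_domain =
  fixes \<Omega> :: "complex set" and f g :: "complex \<Rightarrow> complex"
  assumes open_dom: "open \<Omega>"
    and f_hol: "f holomorphic_on rhp"
    and g_hol: "g holomorphic_on \<Omega>"
    and f_in: "w \<in> rhp \<Longrightarrow> f w \<in> \<Omega>"
    and g_in: "v \<in> \<Omega> \<Longrightarrow> g v \<in> rhp"
    and f_g: "v \<in> \<Omega> \<Longrightarrow> f (g v) = v"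
    and g_f: "w \<in> rhp \<Longrightarrow> g (f w) = w"
    and shift: "v \<in> \<Omega> \<Longrightarrow> 0 \<le> t \<Longrightarrow> v + \<i> * of_real t \<in> \<Omega>"
    and escape: "v \<in> \<Omega> \<Longrightarrow> filterlim (\<lambda>t. g (v + \<i> * of_real t)) at_infinity at_top"
begin

lemma Re_g_pos: "v \<in> \<Omega> \<Longrightarrow> 0 < Re (g v)"
  using g_in by blast

lemma shift_down_notin: "q \<notin> \<Omega> \<Longrightarrow> 0 \<le> s \<Longrightarrow> q - \<i> * of_real s \<notin> \<Omega>"
  using shift[of "q - \<i> * of_real s" s] by auto

text \<open>Schwarz-Pick between the start and a far point \<open>X n\<close> of the orbit: if \<open>Re W\<close> decreased, then
  \<open>Re (X n) / |X n|\<^sup>2\<close> would eventually increase, although it tends to 0.\<close>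

lemma Re_g_mono_step:
  assumes "v \<in> \<Omega>" "0 < t"
  shows "Re (g v) \<le> Re (g (v + \<i> * of_real t))"
proof (rule ccontr)
  define X where "X = (\<lambda>n::nat. g (v + \<i> * of_real (real n * t)))"
  assume "\<not> ?thesis"
  then have lt: "Re (X 1) < Re (X 0)" by (simp add: X_def)
  have vn: "v + \<i> * of_real (real n * t) \<in> \<Omega>" for n
    using shift[OF assms(1), of "real n * t"] assms(2) by simp
  have pos: "Re (X n) > 0" for n unfolding X_def by (rule Re_g_pos[OF vn])
  then have Xn0: "X n \<noteq> 0" for n by (metis less_irrefl zero_complex.simps(1))
  define F where "F = (\<lambda>w. g (f w + \<i> * of_real t))"
  have F: "F holomorphic_on rhp"
  proof -
    have "g \<circ> (\<lambda>w. f w + \<i> * of_real t) holomorphic_on rhp"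
      by (rule holomorphic_on_compose_gen[OF _ g_hol])
        (use f_in shift assms(2) in \<open>auto intro!: holomorphic_intros f_hol\<close>)
    then show ?thesis by (simp add: F_def o_def)
  qed
  have Fr: "F ` rhp \<subseteq> rhp" unfolding F_def using g_in f_in shift assms(2) by fastforce
  have FX: "F (X n) = X (Suc n)" for n
    unfolding F_def X_def f_g[OF vn] by (simp add: algebra_simps)
  have lim: "filterlim X at_infinity sequentially"
  proof -
    have "filterlim (\<lambda>n::nat. real n * t) at_top sequentially"
      using assms(2) by real_asymp
    then show ?thesis unfolding X_def
      by (rule filterlim_compose[OF escape[OF assms(1)]])
  qed
  have lim': "filterlim (\<lambda>n. X (Suc n)) at_infinity sequentially"
    using lim by (rule filterlim_compose) (rule filterlim_Suc)
  \<comment> \<open>As \<open>X n\<close> tends to infinity, \<open>A n\<close> and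
    \<open>B n\<close> both tend to 1, so the strict inequality \<open>Re (X 1) < Re (X 0)\<close>
    survives multiplication by them for large \<open>n\<close>.\<close>
  define A where "A = (\<lambda>n. (cmod (X 1 / X (Suc n) - 1))\<^sup>2)"
  define B where "B = (\<lambda>n. (cmod (X 0 / X n - 1))\<^sup>2)"
  define G where "G = (\<lambda>n. Re (X n) / (cmod (X n))\<^sup>2)"
  have lims: "(\<lambda>n. X 1 / X (Suc n)) \<longlonglongrightarrow> 0" "(\<lambda>n. X 0 / X n) \<longlonglongrightarrow> 0"
    using lim lim' by (auto intro!: tendsto_divide_0 tendsto_const)
  have "A \<longlonglongrightarrow> (cmod (0 - 1))\<^sup>2" "B \<longlonglongrightarrow> (cmod (0 - 1))\<^sup>2"
    unfolding A_def B_def by (intro tendsto_intros lims)+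
  then have "(\<lambda>n. A n * Re (X 0) - B n * Re (X 1)) \<longlonglongrightarrow> 1 * Re (X 0) - 1 * Re (X 1)"
    by (intro tendsto_intros) auto
  then have "\<forall>\<^sub>F n in sequentially. 0 < A n * Re (X 0) - B n * Re (X 1)"
    using lt by (intro order_tendstoD(1)) auto
  then obtain N where N: "\<And>n. n \<ge> N \<Longrightarrow> B n * Re (X 1) < A n * Re (X 0)"
    by (auto simp: eventually_sequentially)
  have Gpos: "G n > 0" for n using pos[of n] Xn0[of n] by (simp add: G_def)
  have G: "G n \<le> G (Suc n)" if "n \<ge> N" for n
  proof -
    have "hsep (F (X 0)) (F (X n)) \<le> hsep (X 0) (X n)"
      using pos by (intro schwarz_pick_rhp[OF F Fr]) auto
    then have "(cmod (X 1 - X (Suc n)))\<^sup>2 * (Re (X 0) * Re (X n)) \<le>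
        (cmod (X 0 - X n))\<^sup>2 * (Re (X 1) * Re (X (Suc n)))"
      unfolding FX hsep_def using pos by (simp add: divide_simps mult_ac)
    moreover have "cmod (X 1 - X (Suc n)) = cmod (X 1 / X (Suc n) - 1) * cmod (X (Suc n))"
      "cmod (X 0 - X n) = cmod (X 0 / X n - 1) * cmod (X n)"
      using Xn0 by (auto simp: algebra_simps simp flip: norm_mult)
    ultimately have "A n * (cmod (X (Suc n)))\<^sup>2 * (Re (X 0) * Re (X n)) \<le>
        B n * (cmod (X n))\<^sup>2 * (Re (X 1) * Re (X (Suc n)))"
      by (simp add: A_def B_def power_mult_distrib)
    then have "A n * Re (X 0) * G n \<le> B n * Re (X 1) * G (Suc n)"
      unfolding G_def using Xn0[of n] Xn0[of "Suc n"] by (simp add: divide_simps mult_ac)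
    also have "\<dots> \<le> A n * Re (X 0) * G (Suc n)"
      using N[OF that] Gpos[of "Suc n"] by (intro mult_right_mono) auto
    finally have "A n * Re (X 0) * G n \<le> A n * Re (X 0) * G (Suc n)" .
    moreover have "A n * Re (X 0) > 0"
    proof -
      have "0 \<le> B n * Re (X 1)" using pos[of 1] by (simp add: B_def)
      then show ?thesis using N[OF that] by linarith
    qed
    ultimately show ?thesis by (simp only: mult_le_cancel_left_pos)
  qed
  have low: "G N \<le> G n" if "n \<ge> N" for n
    using that by (induction n rule: dec_induct) (use G in \<open>auto intro: order_trans\<close>)
  have "(\<lambda>n. 1 / cmod (X n)) \<longlonglongrightarrow> 0"
    using lim by (intro tendsto_divide_0[OF tendsto_const] filterlim_at_top_imp_at_infinity)
      (simp add: filterlim_norm_at_top[THEN filterlim_compose])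
  then have "\<forall>\<^sub>F n in sequentially. 1 / cmod (X n) < G N"
    using Gpos by (intro order_tendstoD(2)) auto
  then obtain M where M: "\<And>n. n \<ge> M \<Longrightarrow> 1 / cmod (X n) < G N"
    by (auto simp: eventually_sequentially)
  define n where "n = max M N"
  have "G n \<le> cmod (X n) / (cmod (X n))\<^sup>2"
    unfolding G_def by (intro divide_right_mono complex_Re_le_cmod) auto
  also have "\<dots> = 1 / cmod (X n)" by (simp add: power2_eq_square)
  also have "\<dots> < G N" by (rule M) (simp add: n_def)
  finally have "G n < G N" .
  moreover have "G N \<le> G n" by (rule low) (simp add: n_def)
  ultimately show False by simp
qed

lemma Re_g_mono:
  assumes "p \<in> \<Omega>" "0 \<le> s" "s \<le> t"
  shows "Re (g (p + \<i> * of_real s)) \<le> Re (g (p + \<i> * of_real t))"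
proof (cases "s = t")
  case False
  then show ?thesis
    using Re_g_mono_step[OF shift[OF assms(1,2)], of "t - s"] assms by (simp add: algebra_simps)
qed simp

text \<open>If the domain were the whole plane, \<open>1 / (g + 1)\<close> would be a bounded entire
  function, hence constant, although \<open>g\<close> is injective.\<close>

lemma ex_notin: "\<exists>q. q \<notin> \<Omega>"
proof (rule ccontr)
  assume "\<not> ?thesis"
  then have [simp]: "\<Omega> = UNIV" by auto
  have R: "Re (g v) > 0" for v using Re_g_pos by simp
  have nz: "g v + 1 \<noteq> 0" for v using R[of v] by (auto simp: complex_eq_iff)
  have "(\<lambda>v. 1 / (g v + 1)) holomorphic_on UNIV"
    using nz g_hol by (intro holomorphic_intros) auto
  moreover have "bounded (range (\<lambda>v. 1 / (g v + 1)))"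
  proof (rule boundedI[of _ 1])
    fix y assume "y \<in> range (\<lambda>v. 1 / (g v + 1))"
    then obtain v where y: "y = 1 / (g v + 1)" by auto
    have "1 \<le> Re (g v + 1)" using R[of v] by simp
    also have "\<dots> \<le> cmod (g v + 1)" by (rule complex_Re_le_cmod)
    finally show "norm y \<le> 1" by (simp add: y norm_divide divide_le_eq)
  qed
  ultimately have "(\<lambda>v. 1 / (g v + 1)) constant_on UNIV" by (rule Liouville_theorem)
  then obtain c where c: "\<And>v. 1 / (g v + 1) = c" by (auto simp: constant_on_def)
  then have "1 / (g 0 + 1) = 1 / (g 1 + 1)" by metis
  then have "g 0 = g 1" using nz[of 0] nz[of 1] by (simp add: field_simps)
  then show False using f_g[of 0] f_g[of 1] by simp
qed

lemma frontier_notin: "q \<in> frontier \<Omega> \<Longrightarrow> q \<notin> \<Omega>"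
  using open_dom by (simp add: frontier_def interior_open)

text \<open>The infimum runs over frontier points, but any omitted point will do: the segment from
  the orbit point to \<open>q\<close> meets the frontier, and because it starts on the line
  \<open>Re z = Re p\<close> it stays on the side of \<open>q\<close>.\<close>

lemma side_dist_le:
  assumes "p \<in> \<Omega>" "0 \<le> t" "q \<notin> \<Omega>" "0 \<le> \<sigma> * Re (q - p)"
  shows "side_dist \<sigma> \<Omega> p t \<le> cmod (q - (p + \<i> * of_real t))"
proof -
  define c where "c = p + \<i> * of_real t"
  have "closed_segment c q \<inter> frontier \<Omega> \<noteq> {}"
    using assms shift[OF assms(1,2)]
    by (intro connected_Int_frontier) (auto simp: c_def disjoint_iff)
  then obtain z where z: "z \<in> closed_segment c q" "z \<in> frontier \<Omega>" by auto
  then obtain u where u: "0 \<le> u" "u \<le> 1" "z = (1 - u) *\<^sub>R c + u *\<^sub>R q"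
    by (auto simp: in_segment)
  have zc: "z - c = u *\<^sub>R (q - c)" unfolding u(3) by (simp add: algebra_simps)
  then have "cmod (z - c) = u * cmod (q - c)" using u by simp
  then have 1: "cmod (z - c) \<le> cmod (q - c)" using u by (simp add: mult_left_le_one_le)
  have "Re (z - p) = Re (z - c)" by (simp add: c_def)
  also have "\<dots> = u * Re (q - p)" unfolding zc by (simp add: c_def)
  finally have 2: "0 \<le> \<sigma> * Re (z - p)" using mult_nonneg_nonneg[OF u(1) assms(4)] by (simp only: mult.left_commute)
  show ?thesis
    by (rule side_dist_cases[OF assms(2), where \<sigma> = \<sigma> and \<Omega> = \<Omega> and p = p])
      (use 1 2 z in \<open>force simp: c_def\<close>)+
qed

lemma side_dist_attained:
  assumes "0 \<le> t" "side_dist \<sigma> \<Omega> p t < t"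
  obtains q where "q \<notin> \<Omega>" "0 \<le> \<sigma> * Re (q - p)" "cmod (q - (p + \<i> * of_real t)) = side_dist \<sigma> \<Omega> p t"
  by (rule side_dist_cases[OF assms(1), where \<sigma> = \<sigma> and \<Omega> = \<Omega> and p = p])
    (use assms(2) frontier_notin in \<open>auto simp: min_def split: if_splits\<close>)

lemma side_dist_lipschitz:
  assumes "p \<in> \<Omega>" "0 \<le> s" "0 \<le> t"
  shows "side_dist \<sigma> \<Omega> p t \<le> side_dist \<sigma> \<Omega> p s + \<bar>t - s\<bar>"
proof (cases "side_dist \<sigma> \<Omega> p s < s")
  case True
  obtain q where q: "q \<notin> \<Omega>" "0 \<le> \<sigma> * Re (q - p)"
    "cmod (q - (p + \<i> * of_real s)) = side_dist \<sigma> \<Omega> p s"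
    using side_dist_attained[OF assms(2) True] .
  have "side_dist \<sigma> \<Omega> p t \<le> cmod (q - (p + \<i> * of_real t))"
    using side_dist_le[OF assms(1,3) q(1,2)] .
  also have "q - (p + \<i> * of_real t) = (q - (p + \<i> * of_real s)) - \<i> * of_real (t - s)"
    by (simp add: algebra_simps)
  also have "cmod \<dots> \<le> cmod (q - (p + \<i> * of_real s)) + cmod (\<i> * of_real (t - s))"
    by (rule norm_triangle_ineq4)
  finally show ?thesis using q by (simp only: norm_mult norm_of_real) simp
next
  case False
  then show ?thesis using side_dist_le_self[OF assms(3), of \<sigma> \<Omega> p] by linarith
qed

text \<open>An omitted point near the orbit at time \<open>t\<close>, moved down by
  \<open>t - s\<close>, is again omitted and equally near at time \<open>s\<close>.\<close>

lemma side_dist_mono: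
  assumes "p \<in> \<Omega>" "0 \<le> s" "s \<le> t"
  shows "side_dist \<sigma> \<Omega> p s \<le> side_dist \<sigma> \<Omega> p t"
proof (cases "side_dist \<sigma> \<Omega> p t < t")
  case True
  have t: "0 \<le> t" using assms by simp
  obtain q where q: "q \<notin> \<Omega>" "0 \<le> \<sigma> * Re (q - p)"
    "cmod (q - (p + \<i> * of_real t)) = side_dist \<sigma> \<Omega> p t"
    using side_dist_attained[OF t True] .
  have "side_dist \<sigma> \<Omega> p s \<le> cmod (q - \<i> * of_real (t - s) - (p + \<i> * of_real s))"
    by (rule side_dist_le[OF assms(1,2)])
      (use shift_down_notin[OF q(1), of "t - s"] assms q in auto)
  then show ?thesis using q(3) by (simp add: algebra_simps)
next
  case False
  then show ?thesis using side_dist_le_self[OF assms(2), of \<sigma> \<Omega> p] assms by linarith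
qed

lemma side_dist_half_disc:
  assumes "p \<in> \<Omega>" "0 \<le> t" "0 \<le> \<sigma> * Re (v - p)" "cmod (v - (p + \<i> * of_real t)) < side_dist \<sigma> \<Omega> p t"
  shows "v \<in> \<Omega>"
  using side_dist_le[OF assms(1,2) _ assms(3)] assms(4) by force

lemma side_dist_ball:
  assumes "p \<in> \<Omega>" "0 \<le> t" "r \<le> side_dist 1 \<Omega> p t" "r \<le> side_dist (-1) \<Omega> p t"
  shows "ball (p + \<i> * of_real t) r \<subseteq> \<Omega>"
proof
  fix v assume "v \<in> ball (p + \<i> * of_real t) r"
  then have "cmod (v - (p + \<i> * of_real t)) < r" by (simp add: dist_norm norm_minus_commute)
  then show "v \<in> \<Omega>"
    using side_dist_half_disc[OF assms(1,2), of 1 v] side_dist_half_disc[OF assms(1,2), of "-1" v] assms(3,4)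
    by (cases "0 \<le> Re (v - p)") auto
qed

text \<open>A ball around \<open>p\<close> in the domain is carried up along the orbit by
  \<open>shift\<close>, so omitted points never come closer than its radius.\<close>

lemma side_dist_lower:
  assumes "p \<in> \<Omega>"
  obtains e where "0 < e" "\<And>\<sigma> t. 0 \<le> t \<Longrightarrow> min t e \<le> side_dist \<sigma> \<Omega> p t"
proof -
  obtain e where e: "e > 0" "ball p e \<subseteq> \<Omega>"
    using open_dom assms open_contains_ball by metis
  have "min t e \<le> side_dist \<sigma> \<Omega> p t" if t: "0 \<le> t" for \<sigma> t
  proof (cases "side_dist \<sigma> \<Omega> p t < t")
    case True
    obtain q where q: "q \<notin> \<Omega>" "cmod (q - (p + \<i> * of_real t)) = side_dist \<sigma> \<Omega> p t"
      using side_dist_attained[OF t True] by metis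
    have "q - \<i> * of_real t \<notin> ball p e" using shift_down_notin[OF q(1) t] e by auto
    then have "e \<le> cmod (q - \<i> * of_real t - p)" by (simp add: dist_norm norm_minus_commute)
    then show ?thesis using q(2) by (simp add: algebra_simps)
  qed auto
  then show ?thesis using that e by blast
qed

end

section \<open>Geodesics of the domain between vertical slits\<close>

lemma first_hit:
  fixes y :: "real \<Rightarrow> real"
  assumes "continuous_on {a..b} y" "a \<le> b" "y a \<le> c" "c \<le> y b"
  obtains x where "x \<in> {a..b}" "y x = c" "\<And>x'. x' \<in> {a..x} \<Longrightarrow> y x' \<le> c"
proof -
  define S where "S = {x \<in> {a..b}. y x = c}"
  have "compact S"
    unfolding S_def using continuous_closed_preimage_constant[OF assms(1)]
    by (auto simp: compact_eq_bounded_closed intro: bounded_subset[OF bounded_closed_interval])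
  moreover have "S \<noteq> {}"
    using IVT'[of y a c b] assms by (auto simp: S_def)
  ultimately obtain x where x: "x \<in> S" "\<And>z. z \<in> S \<Longrightarrow> x \<le> z"
    by (metis compact_attains_inf)
  show ?thesis
  proof (rule that)
    show "x \<in> {a..b}" "y x = c" using x by (auto simp: S_def)
    fix x' assume x': "x' \<in> {a..x}"
    show "y x' \<le> c"
    proof (rule ccontr)
      assume "\<not> y x' \<le> c"
      moreover have "continuous_on {a..x'} y"
        using x x' by (intro continuous_on_subset[OF assms(1)]) (auto simp: S_def)
      ultimately obtain z where "a \<le> z" "z \<le> x'" "y z = c"
        using IVT'[of y a c x'] assms(3) x' by auto
      then have "z \<in> S" using x x' by (auto simp: S_def)
      then have "x \<le> z" by (rule x)
      then have "z = x'" using \<open>z \<le> x'\<close> x' by auto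
      then show False using \<open>y z = c\<close> \<open>\<not> y x' \<le> c\<close> by simp
    qed
  qed
qed

lemma sinh_le_double: "0 \<le> x \<Longrightarrow> x \<le> 1 / 2 \<Longrightarrow> sinh x \<le> 2 * (x::real)"
proof -
  assume x: "0 \<le> x" "x \<le> 1 / 2"
  have "exp x \<le> 1 + x + x\<^sup>2" using x by (intro exp_bound) auto
  moreover have "1 - x \<le> exp (- x)" using exp_ge_add_one_self[of "- x"] by simp
  moreover have "x\<^sup>2 \<le> x" using x by (simp add: power2_eq_square mult_left_le_one_le)
  ultimately show ?thesis using x by (simp add: sinh_def)
qed

context starlike_domain
begin

lemma g_chain_step:
  assumes "v \<in> \<Omega>" "ball v r \<subseteq> \<Omega>" "0 < r" "cmod (u - v) \<le> r / 2"
  shows "cmod (g u - g v) \<le> 2 * Re (g v)" "Re (g u) \<le> 3 * Re (g v)" "Re (g v) \<le> 3 * Re (g u)"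
proof -
  have 1: "g holomorphic_on ball v r" "g ` ball v r \<subseteq> rhp"
    using assms(2) g_hol g_in by (auto intro: holomorphic_on_subset)
  note 2 = schwarz_ball_rhp[OF 1 assms(4,3)]
  show "cmod (g u - g v) \<le> 2 * Re (g v)" by (rule 2)
  have "\<bar>Re (g u) - Re (g v)\<bar> \<le> cmod (g u - g v)"
    using abs_Re_le_cmod[of "g u - g v"] by simp
  then show "Re (g u) \<le> 3 * Re (g v)" "Re (g v) \<le> 3 * Re (g u)"
    using 2 by linarith+
qed

lemma distortion:
  assumes "q \<notin> \<Omega>" "a \<in> rhp" "b \<in> rhp"
  shows "cmod (f b - q) \<le> (hsep a b + 2)\<^sup>2 * cmod (f a - q)"
    and "cmod (f a - q) \<le> M \<Longrightarrow> cmod (f b - q) \<le> M \<Longrightarrow>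
      cmod (f a - f b) \<le> 2 * M * sqrt (hsep a b)"
  using shift_down_notin[OF assms(1)] f_in
  by (intro slit_distortion[OF f_hol _ assms(2,3)]; fastforce)+

text \<open>The slit below \<open>q\<close> is a wall: a crossing of the line
  \<open>Re z = Re q\<close> at height at most \<open>Im q\<close> would be an omitted point. The
  sign of \<open>\<sigma>\<close> selects the side on which the curve starts.\<close>

lemma confined:
  fixes l \<sigma> :: real
  assumes "continuous_on {0..l} V" "V ` {0..l} \<subseteq> \<Omega>" "q \<notin> \<Omega>"
    and "\<And>x. x \<in> {0..l} \<Longrightarrow> Im (V x) \<le> Im q"
    and "\<sigma> * Re (V 0) \<le> \<sigma> * Re q" "0 \<le> l" "\<sigma> \<noteq> 0"
  shows "\<sigma> * Re (V l) \<le> \<sigma> * Re q"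
proof (rule ccontr)
  assume "\<not> ?thesis"
  then have "\<exists>x\<ge>0::real. x \<le> l \<and> \<sigma> * Re (V x) = \<sigma> * Re q"
    using assms by (intro IVT'[of "\<lambda>x. \<sigma> * Re (V x)" 0 "\<sigma> * Re q" l]) (auto intro!: continuous_intros)
  then obtain x where x: "x \<in> {0..l}" "Re (V x) = Re q" using assms(7) by auto
  then have "V x = q - \<i> * of_real (Im q - Im (V x))" by (simp add: complex_eq_iff)
  then have "V x \<notin> \<Omega>" using shift_down_notin[OF assms(3), of "Im q - Im (V x)"] assms(4)[OF x(1)] by simp
  then show False using assms(2) x(1) by blast
qed

definition max_dist :: "complex \<Rightarrow> real \<Rightarrow> real" where
  "max_dist p t = max (side_dist 1 \<Omega> p t) (side_dist (- 1) \<Omega> p t)"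

lemma max_dist_lipschitz:
  assumes "p \<in> \<Omega>" "0 \<le> s" "0 \<le> t"
  shows "max_dist p t \<le> max_dist p s + \<bar>t - s\<bar>"
  using side_dist_lipschitz[OF assms, of 1] side_dist_lipschitz[OF assms, of "-1"]
  by (auto simp: max_dist_def)

lemma max_dist_mono:
  assumes "p \<in> \<Omega>" "0 \<le> s" "s \<le> t"
  shows "max_dist p s \<le> max_dist p t"
  using side_dist_mono[OF assms, of 1] side_dist_mono[OF assms, of "-1"]
  by (auto simp: max_dist_def)

lemma max_dist_le_self: "0 \<le> t \<Longrightarrow> max_dist p t \<le> t"
  by (simp add: max_dist_def side_dist_le_self)

lemma max_dist_lower:
  assumes "p \<in> \<Omega>"
  obtains e where "0 < e" "\<And>t. 0 \<le> t \<Longrightarrow> min t e \<le> max_dist p t"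
  using side_dist_lower[OF assms] by (metis max_dist_def max.coboundedI1)

text \<open>As long as the geodesic \<open>f \<circ> P\<close> is below height \<open>s j - max_dist p (s j)\<close>, it stays between two
  slits at mutual distance at most \<open>2 max_dist p (s j)\<close>.\<close>

lemma channel_bound:
  fixes s :: "nat \<Rightarrow> real"
  assumes p: "p \<in> \<Omega>" and a: "0 < a" "a \<le> 1"
    and s: "\<And>j. j < k \<Longrightarrow> s (Suc j) = s j - a * max_dist p (s j)" "\<And>j. j \<le> k \<Longrightarrow> 0 < s j"
    and L: "0 \<le> L" "continuous_on {0..L} P" "P ` {0..L} \<subseteq> rhp"
    and ends: "f (P 0) = p + \<i> * of_real (s k)" "f (P L) = p + \<i> * of_real (s 0)"
    and geo: "\<And>x y. x \<in> {0..L} \<Longrightarrow> y \<in> {0..L} \<Longrightarrow> hsep (P x) (P y) = (2 * sinh ((x - y) / 2))\<^sup>2"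
  shows "(\<Sum>j<k. ((s j - max_dist p (s j)) - (s (Suc j) - max_dist p (s (Suc j)))) / max_dist p (s j))
     \<le> 12 * L + 1"
proof -
  define D where "D = (\<lambda>j. max_dist p (s j))"
  define h where "h = (\<lambda>j. s j - D j)"
  \<comment> \<open>The height \<open>h j\<close> is cut at the starting height \<open>s k\<close>
    of the geodesic, \<open>h j = G j + B j - s k\<close>. The part \<open>G\<close> above it has to
    be climbed, which costs length. The part \<open>B\<close> below it drops by at most
    \<open>D k\<close> altogether and accounts for the summand 1.\<close>
  define G where "G = (\<lambda>j. max (h j) (s k))"
  define B where "B = (\<lambda>j. min (h j) (s k))"
  define V where "V = f \<circ> P"
  define y where "y = (\<lambda>x. Im (V x) - Im p)"
  have Dpos: "D j > 0" if "j \<le> k" for j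
    using max_dist_lower[OF p] s(2)[OF that] unfolding D_def
    by (metis less_le_trans less_imp_le min_less_iff_conj)
  have s_dec: "s (Suc j) \<le> s j" if "j < k" for j
    using s(1)[OF that] Dpos[of j] a that by (simp add: D_def)
  have D_dec: "D (Suc j) \<le> D j" if "j < k" for j
    unfolding D_def using s(2)[of "Suc j"] that s_dec by (intro max_dist_mono[OF p]) auto
  have h_step: "0 \<le> h j - h (Suc j)" "h j - h (Suc j) \<le> D j" if "j < k" for j
  proof -
    have "D j \<le> D (Suc j) + \<bar>s j - s (Suc j)\<bar>"
      unfolding D_def using s(2)[of j] s(2)[of "Suc j"] that by (intro max_dist_lipschitz[OF p]) auto
    then show "0 \<le> h j - h (Suc j)" using s_dec[OF that] by (simp add: h_def)
    have "s j - s (Suc j) \<le> D j"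
      using s(1)[OF that] Dpos[of j] a that by (simp add: D_def mult_left_le_one_le)
    then show "h j - h (Suc j) \<le> D j" using D_dec[OF that] by (simp add: h_def)
  qed
  have dec: "F j' \<le> F j" if "j \<le> j'" "j' \<le> k" "\<And>j. j < k \<Longrightarrow> F (Suc j) \<le> F j" for F :: "nat \<Rightarrow> real" and j j'
    using that(1,2)
  proof (induction j' rule: dec_induct)
    case (step n)
    then show ?case using that(3)[of n] by simp
  qed simp
  have G0: "G j \<le> s 0" if "j \<le> k" for j
  proof -
    have "h j \<le> h 0" using h_step(1) that by (intro dec[of 0 j h]) force+
    moreover have "s k \<le> s 0" using s_dec by (intro dec[of 0 k s]) auto
    ultimately show ?thesis using Dpos[of 0] by (auto simp: G_def h_def)
  qed
  have Vcont: "continuous_on {0..L} V"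
    unfolding V_def using L(3) holomorphic_on_imp_continuous_on[OF f_hol]
    by (intro continuous_on_compose L) (auto intro: continuous_on_subset)
  have VO: "V ` {0..L} \<subseteq> \<Omega>" using L f_in by (force simp: V_def)
  have ycont: "continuous_on {0..L} y" unfolding y_def by (intro continuous_intros Vcont)
  \<comment> \<open>Induction from \<open>j = k\<close> down to 0. The time \<open>l\<close> is such
    that the curve has not exceeded \<open>G j\<close> before: confinement needs all of the curve
    from \<open>P 0\<close> on to lie below the tips of the slits.\<close>
  have "\<exists>l\<in>{0..L}. y l = G j \<and> (\<forall>x\<in>{0..l}. y x \<le> G j) \<and>
      (\<Sum>i\<in>{j..<k}. (G i - G (Suc i)) / D i) \<le> 12 * l" if "j \<le> k" for j
    using that
  proof (induction j rule: inc_induct)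
    case base
    show ?case using ends Dpos[of k] L by (intro bexI[of _ 0]) (auto simp: y_def G_def h_def V_def)
  next
    case (step j)
    then obtain l where l: "l \<in> {0..L}" "y l = G (Suc j)" "\<And>x. x \<in> {0..l} \<Longrightarrow> y x \<le> G (Suc j)"
      "(\<Sum>i\<in>{Suc j..<k}. (G i - G (Suc i)) / D i) \<le> 12 * l" by blast
    have split: "(\<Sum>i\<in>{j..<k}. (G i - G (Suc i)) / D i) =
        (G j - G (Suc j)) / D j + (\<Sum>i\<in>{Suc j..<k}. (G i - G (Suc i)) / D i)"
      using step by (simp add: sum.atLeast_Suc_lessThan)
    have Gj: "G (Suc j) \<le> G j" "G j - G (Suc j) \<le> D j"
      using h_step[of j] Dpos[of j] step by (auto simp: G_def)
    show ?case
    proof (cases "G j = G (Suc j)")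
      case True
      then show ?thesis using l split by (intro bexI[of _ l]) auto
    next
      case False
      then have hj: "h j > s k" "G j = h j" using Gj by (auto simp: G_def max_def split: if_splits)
      then have Ds: "D j < s j" using s(2)[of k] by (simp add: h_def)
      have sj: "0 \<le> s j" using s(2)[of j] step by simp
      have "continuous_on {l..L} y" using l by (intro continuous_on_subset[OF ycont]) auto
      moreover have "G j \<le> y L" using G0[of j] step ends by (simp add: y_def V_def)
      ultimately obtain l2 where l2: "l2 \<in> {l..L}" "y l2 = G j" "\<And>x. x \<in> {l..l2} \<Longrightarrow> y x \<le> G j"
        using first_hit[of l L y "G j"] l Gj by auto
      have below: "y x \<le> G j" if "x \<in> {0..l2}" for x
        using l(3)[of x] l2(3)[of x] that Gj by (cases "x \<le> l") auto
      obtain q1 where q1: "q1 \<notin> \<Omega>" "0 \<le> 1 * Re (q1 - p)"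
        "cmod (q1 - (p + \<i> * of_real (s j))) = side_dist 1 \<Omega> p (s j)"
        using side_dist_attained[OF sj] Ds by (metis D_def max_dist_def max_less_iff_conj)
      obtain q2 where q2: "q2 \<notin> \<Omega>" "0 \<le> (-1) * Re (q2 - p)"
        "cmod (q2 - (p + \<i> * of_real (s j))) = side_dist (-1) \<Omega> p (s j)"
        using side_dist_attained[OF sj] Ds by (metis D_def max_dist_def max_less_iff_conj)
      have n: "cmod (q1 - (p + \<i> * of_real (s j))) \<le> D j" "cmod (q2 - (p + \<i> * of_real (s j))) \<le> D j"
        using q1 q2 by (auto simp: D_def max_dist_def)
      have im: "Im p + h j \<le> Im q1" "Im p + h j \<le> Im q2"
        using n abs_Im_le_cmod[of "q1 - (p + \<i> * of_real (s j))"]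
          abs_Im_le_cmod[of "q2 - (p + \<i> * of_real (s j))"] by (auto simp: h_def)
      have re: "\<bar>Re q1 - Re p\<bar> \<le> D j" "\<bar>Re q2 - Re p\<bar> \<le> D j"
        using n abs_Re_le_cmod[of "q1 - (p + \<i> * of_real (s j))"]
          abs_Re_le_cmod[of "q2 - (p + \<i> * of_real (s j))"] by auto
      have V0: "Re (V 0) = Re p" using ends by (simp add: V_def)
      have conf: "Re (V x) \<le> Re q1 \<and> Re q2 \<le> Re (V x)" if x: "x \<in> {0..l2}" for x
      proof -
        have c: "continuous_on {0..x} V" "V ` {0..x} \<subseteq> \<Omega>" "0 \<le> x"
          using x l2 VO by (auto intro: continuous_on_subset[OF Vcont])
        have b: "Im (V z) \<le> Im q1" "Im (V z) \<le> Im q2" if "z \<in> {0..x}" for z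
          using below[of z] that x im hj by (auto simp: y_def)
        have "1 * Re (V x) \<le> 1 * Re q1"
          by (rule confined[OF c(1,2) q1(1) b(1)]) (use c V0 q1 in auto)
        moreover have "(-1) * Re (V x) \<le> (-1) * Re q2"
          by (rule confined[OF c(1,2) q2(1) b(2)]) (use c V0 q2 in auto)
        ultimately show ?thesis by simp
      qed
      \<comment> \<open>The point of the slit below \<open>q1\<close> at the height where this piece
        of the climb ends. Both ends of the piece differ from it by at most \<open>2 * D j\<close>
        horizontally, the width of the channel, and \<open>D j\<close> vertically; hence the radius
        \<open>3 * D j\<close>.\<close>
      define \<zeta> where "\<zeta> = q1 - \<i> * of_real (Im q1 - (Im p + h j))"
      have \<zeta>: "\<zeta> \<notin> \<Omega>" unfolding \<zeta>_def using im by (intro shift_down_notin[OF q1(1)]) auto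
      have zre: "Re \<zeta> = Re q1" "Im \<zeta> = Im p + h j" by (simp_all add: \<zeta>_def)
      have V3: "cmod (V x - \<zeta>) \<le> 3 * D j" if "x \<in> {0..l2}" "\<bar>y x - G j\<bar> \<le> D j" for x
      proof -
        have "\<bar>Re (V x - \<zeta>)\<bar> \<le> 2 * D j" using conf[OF that(1)] re zre by auto
        moreover have "\<bar>Im (V x - \<zeta>)\<bar> \<le> D j" using that(2) zre hj by (simp add: y_def)
        ultimately show ?thesis using cmod_le[of "V x - \<zeta>"] by linarith
      qed
      have PP: "P l2 \<in> rhp" "P l \<in> rhp" using L l l2 by (auto simp: image_subset_iff)
      have "cmod (f (P l2) - f (P l)) \<le> 2 * (3 * D j) * sqrt (hsep (P l2) (P l))"
      proof (rule distortion(2)[OF \<zeta> PP])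
        show "cmod (f (P l2) - \<zeta>) \<le> 3 * D j"
          using V3[of l2] l2 l Dpos[of j] step by (simp add: V_def)
        show "cmod (f (P l) - \<zeta>) \<le> 3 * D j"
          using V3[of l] l2 l Gj by (simp add: V_def)
      qed
      also have "hsep (P l2) (P l) = (2 * sinh ((l2 - l) / 2))\<^sup>2"
        using l l2 by (intro geo) auto
      also have "sqrt ((2 * sinh ((l2 - l) / 2))\<^sup>2) = 2 * sinh ((l2 - l) / 2)"
        unfolding real_sqrt_abs using l2 by simp
      finally have d: "cmod (V l2 - V l) \<le> 6 * D j * (2 * sinh ((l2 - l) / 2))"
        by (simp add: V_def)
      have "G j - G (Suc j) = y l2 - y l" using l l2 by simp
      also have "\<dots> \<le> cmod (V l2 - V l)"
        using abs_Im_le_cmod[of "V l2 - V l"] by (simp add: y_def)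
      finally have d2: "G j - G (Suc j) \<le> cmod (V l2 - V l)" .
      have Dj: "D j > 0" using Dpos step by simp
      have "G j - G (Suc j) \<le> D j * (12 * (l2 - l))"
      \<comment> \<open>The linear bound on \<open>sinh\<close> holds for small arguments only; a
        longer piece of the geodesic is covered by \<open>G j - G (Suc j) \<le> D j\<close>.\<close>
      proof (cases "l2 - l \<le> 1")
        case True
        have "2 * sinh ((l2 - l) / 2) \<le> 2 * (2 * ((l2 - l) / 2))"
          using True l2 by (intro mult_left_mono sinh_le_double) auto
        then have "6 * D j * (2 * sinh ((l2 - l) / 2)) \<le> 6 * D j * (2 * (l2 - l))"
          using Dj by (intro mult_left_mono) auto
        then show ?thesis using d d2 by (simp add: mult_ac)
      next
        case False
        then have "D j * 1 \<le> D j * (12 * (l2 - l))" using Dj by (intro mult_left_mono) auto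
        then show ?thesis using Gj by simp
      qed
      then have "(G j - G (Suc j)) / D j \<le> 12 * (l2 - l)"
        using Dj by (simp add: divide_le_eq mult.commute)
      then show ?thesis using split l l2 below by (intro bexI[of _ l2]) auto
    qed
  qed
  from this[of 0] obtain l where "l \<in> {0..L}" "(\<Sum>i\<in>{0..<k}. (G i - G (Suc i)) / D i) \<le> 12 * l" by auto
  then have SG: "(\<Sum>i<k. (G i - G (Suc i)) / D i) \<le> 12 * L" by (auto simp: atLeast0LessThan)
  have "(\<Sum>i<k. (B i - B (Suc i)) / D i) \<le> (\<Sum>i<k. (B i - B (Suc i)) / D k)"
  proof (rule sum_mono)
    fix i assume i: "i \<in> {..<k}"
    have "D k \<le> D i" using D_dec i by (intro dec[of i k D]) auto
    moreover have "0 \<le> B i - B (Suc i)" using h_step[of i] i by (auto simp: B_def)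
    ultimately show "(B i - B (Suc i)) / D i \<le> (B i - B (Suc i)) / D k"
      using Dpos[of k] by (intro divide_left_mono) auto
  qed
  also have "\<dots> = (B 0 - B k) / D k"
    by (simp add: sum_divide_distrib[symmetric] sum_lessThan_telescope')
  also have "\<dots> \<le> 1" using Dpos[of k] by (simp add: divide_le_eq B_def h_def)
  finally have SB: "(\<Sum>i<k. (B i - B (Suc i)) / D i) \<le> 1" .
  have "(h j - h (Suc j)) / D j = (G j - G (Suc j)) / D j + (B j - B (Suc j)) / D j" for j
    by (simp add: G_def B_def max_def min_def flip: add_divide_distrib)
  then have "(\<Sum>j<k. (h j - h (Suc j)) / D j) \<le> 12 * L + 1"
    using SG SB by (simp add: sum.distrib)
  then show ?thesis by (simp add: h_def D_def)
qed

end

section \<open>Comparable side distances keep orbits in a sector\<close>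

context starlike_domain
begin

abbreviation orbit :: "complex \<Rightarrow> real \<Rightarrow> complex" where
  "orbit p t \<equiv> g (p + \<i> * of_real t)"

definition comparable_sides :: "complex \<Rightarrow> bool" where
  "comparable_sides p \<longleftrightarrow> (\<exists>C>0. \<forall>t\<ge>0.
     side_dist 1 \<Omega> p t \<le> C * side_dist (- 1) \<Omega> p t \<and>
     side_dist (- 1) \<Omega> p t \<le> C * side_dist 1 \<Omega> p t)"

definition sectorial :: "complex \<Rightarrow> bool" where
  "sectorial p \<longleftrightarrow> (\<exists>K. \<forall>t\<ge>0. cmod (orbit p t) \<le> K * Re (orbit p t))"

lemma orbit_in: "p \<in> \<Omega> \<Longrightarrow> 0 \<le> t \<Longrightarrow> orbit p t \<in> rhp"
  by (intro g_in shift)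

lemma orbit_continuous: "p \<in> \<Omega> \<Longrightarrow> continuous_on {0..} (orbit p)"
proof -
  assume p: "p \<in> \<Omega>"
  have "continuous_on {0..} (g \<circ> (\<lambda>t. p + \<i> * of_real t))"
    using shift[OF p]
    by (intro continuous_on_compose continuous_intros
        continuous_on_subset[OF holomorphic_on_imp_continuous_on[OF g_hol]]) auto
  then show ?thesis by (simp add: o_def)
qed

lemma orbit_bounded:
  assumes "p \<in> \<Omega>"
  obtains B where "0 \<le> B" "\<And>t. 0 \<le> t \<Longrightarrow> t \<le> T \<Longrightarrow> cmod (orbit p t) \<le> B"
proof -
  have "continuous_on {0..T} (orbit p)"
    by (rule continuous_on_subset[OF orbit_continuous[OF assms]]) auto
  then have "compact (orbit p ` {0..T})" by (rule compact_continuous_image) simp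
  then obtain B where "0 < B" "\<forall>z\<in>orbit p ` {0..T}. norm z \<le> B"
    using compact_imp_bounded bounded_pos by metis
  then show ?thesis using that[of B] by auto
qed

lemma sectorial_if_comparable_sides:
  assumes p: "p \<in> \<Omega>" and "comparable_sides p"
  shows "sectorial p"
proof -
  obtain C0 where C0: "C0 > 0" "\<And>t. 0 \<le> t \<Longrightarrow> side_dist 1 \<Omega> p t \<le> C0 * side_dist (- 1) \<Omega> p t"
      "\<And>t. 0 \<le> t \<Longrightarrow> side_dist (- 1) \<Omega> p t \<le> C0 * side_dist 1 \<Omega> p t"
    using assms(2) by (auto simp: comparable_sides_def)
  define C where "C = max C0 1"
  have C1: "C \<ge> 1" by (simp add: C_def)
  define D where "D = max_dist p"
  define m where "m = (\<lambda>t. min (side_dist 1 \<Omega> p t) (side_dist (- 1) \<Omega> p t))"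
  have Dm: "D t \<le> C * m t" if t: "0 \<le> t" for t
  proof -
    have le: "C0 * x \<le> C * x" "x \<le> C * x" if "0 \<le> x" for x
      using that C1 by (auto simp: C_def mult_right_mono mult_le_cancel_right1)
    show ?thesis
      using C0(2,3)[OF t] le[OF side_dist_nonneg[OF t, of 1 \<Omega> p]]
        le[OF side_dist_nonneg[OF t, of "-1" \<Omega> p]]
      by (auto simp: D_def m_def max_dist_def min_def)
  qed
  obtain e where e: "e > 0" "\<And>t. 0 \<le> t \<Longrightarrow> min t e \<le> D t"
    using max_dist_lower[OF p] unfolding D_def by metis
  have Dpos: "D t > 0" if "t > 0" for t using e(2)[of t] e(1) that by auto
  have mpos: "m t > 0" if "t > 0" for t
    using Dm[of t] Dpos[OF that] C1 that by (smt (verit) mult_nonneg_nonpos)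
  have mball: "ball (p + \<i> * of_real t) (m t) \<subseteq> \<Omega>" if "0 \<le> t" for t
    by (rule side_dist_ball[OF p that]) (auto simp: m_def)
  \<comment> \<open>This makes \<open>a * D t \<le> m t / 2\<close>: a backward step stays in the
    half-size copy of the inscribed ball, and \<open>g_chain_step\<close> applies.\<close>
  define a where "a = 1 / (2 * C)"
  have a: "0 < a" "a \<le> 1 / 2" "a \<le> 1" using C1 by (auto simp: a_def divide_le_eq)
  obtain q0 where q0: "q0 \<notin> \<Omega>" using ex_notin by auto
  \<comment> \<open>If the minimum in the side distance is \<open>t\<close> itself, it provides no
    nearby omitted point and the fixed \<open>q0\<close> takes over. \<open>C2\<close> is chosen so
    that \<open>|p - q0| + t \<le> C2 * t\<close> for \<open>t \<ge> 1 / 2\<close>.\<close>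
  define C2 where "C2 = 1 + 2 * cmod (p - q0)"
  have C2: "C2 \<ge> 1" by (simp add: C2_def)
  have near: "\<exists>q. q \<notin> \<Omega> \<and> cmod (p + \<i> * of_real t - q) \<le> C2 * D t" if t: "1 / 2 \<le> t" for t
  proof (cases "side_dist 1 \<Omega> p t < t")
    case True
    obtain q where q: "q \<notin> \<Omega>" "cmod (q - (p + \<i> * of_real t)) = side_dist 1 \<Omega> p t"
      using side_dist_attained[OF _ True] t by auto
    have "side_dist 1 \<Omega> p t \<le> D t" by (simp add: D_def max_dist_def)
    also have "\<dots> \<le> C2 * D t" using C2 Dpos[of t] t by simp
    finally show ?thesis using q by (auto simp: norm_minus_commute)
  next
    case False
    then have Dt: "t \<le> D t" by (simp add: D_def max_dist_def)
    have "cmod (p + \<i> * of_real t - q0) \<le> cmod (p - q0) + cmod (\<i> * of_real t)"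
      using norm_triangle_ineq[of "p - q0" "\<i> * of_real t"] by (simp add: algebra_simps)
    also have "\<dots> = cmod (p - q0) + t" using t by (simp add: norm_mult)
    also have "\<dots> \<le> C2 * t"
      using mult_left_mono[of "1/2" t "2 * cmod (p - q0)"] t by (simp add: C2_def algebra_simps)
    also have "\<dots> \<le> C2 * D t" using Dt C2 by simp
    finally show ?thesis using q0 by blast
  qed
  \<comment> \<open>The 14 is the 12 of \<open>channel_bound\<close> plus 2 for the square in the
    first distortion bound. The term \<open>ln 2\<close> comes from
    \<open>E + 2 \<le> 2 * (X^2 / (Re (w 0) * Re (w k)))\<close>.\<close>
  define C3 where "C3 = (1 + ln (C * C2)) / 14 + ln 2"
  obtain K where K: "K \<ge> 0"
    "\<And>w N. receding_chain (a / 14) C3 2 w N \<Longrightarrow> cmod (w 0 - w N) \<le> K * Re (w 0)"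
    using chain_decay[where c = "a / 14" and M = 2 and C = C3] a by (metis divide_pos_pos zero_less_numeral zero_le_numeral)
  obtain B where B: "B \<ge> 0" "\<And>t. 0 \<le> t \<Longrightarrow> t \<le> 1 \<Longrightarrow> cmod (orbit p t) \<le> B"
    using orbit_bounded[OF p] by metis
  define x0 where "x0 = Re (orbit p 0)"
  have x0: "x0 > 0" using Re_g_pos[OF p] by (simp add: x0_def)
  have B': "B \<le> B / x0 * Re (orbit p t)" if "0 \<le> t" for t
    using mult_left_mono[OF Re_g_mono[OF p order_refl that], of "B / x0"] B x0 that by (simp add: x0_def)
  have "cmod (orbit p t) \<le> (K + B / x0) * Re (orbit p t)" if t: "0 \<le> t" for t
  proof -
    \<comment> \<open>The walk is stopped at its first time below 1, where the bound
      \<open>B\<close> for the initial piece of the orbit applies. A step loses at most half of the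
      time, so a walk that starts at or above 1 never gets below 1/2, as \<open>near\<close>
      requires.\<close>
    define s where "s = (\<lambda>k. ((\<lambda>x. x - a * D x) ^^ k) t)"
    have s0: "s 0 = t" and sS: "s (Suc k) = s k - a * D (s k)" for k
      by (simp_all add: s_def)
    have half: "s k / 2 \<le> s (Suc k)" if "0 \<le> s k" for k
    proof -
      have "a * D (s k) \<le> 1 / 2 * s k"
        using a max_dist_le_self[OF that, of p] side_dist_nonneg[OF that] that
        by (intro mult_mono) (auto simp: D_def max_dist_def le_max_iff_disj)
      then show ?thesis by (simp add: sS)
    qed
    have s_nn: "0 \<le> s k" for k by (induction k) (use t half in \<open>force simp: s0\<close>)+
    have "\<exists>N. s N < 1"
    proof (rule ccontr)
      assume "\<not> ?thesis"
      then have ge: "s k \<ge> 1" for k by (simp add: not_less)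
      define e' where "e' = a * min 1 e"
      have e': "e' > 0" using a e by (simp add: e'_def)
      have "s k \<le> t - k * e'" for k
      proof (induction k)
        case (Suc k)
        have "min 1 e \<le> D (s k)" using e(2)[OF s_nn[of k]] ge[of k] by linarith
        then have "e' \<le> a * D (s k)" using a by (simp add: e'_def)
        then show ?case using Suc by (simp add: sS algebra_simps)
      qed (simp add: s0)
      moreover obtain n :: nat where "t / e' < n" using reals_Archimedean2 by blast
      ultimately show False using ge[of n] e'
        by (smt (verit) divide_less_eq)
    qed
    define N where "N = (LEAST n. s n < 1)"
    have sN: "s N < 1" using LeastI_ex[OF \<open>\<exists>N. s N < 1\<close>] by (simp add: N_def)
    have s_ge1: "s k \<ge> 1" if "k < N" for k
      using not_less_Least[of k "\<lambda>n. s n < 1"] that by (simp add: N_def)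
    show ?thesis
    proof (cases "N = 0")
      case True
      then have "t < 1" using sN s0 by simp
      then have "cmod (orbit p t) \<le> B / x0 * Re (orbit p t)" using B(2)[of t] B'[of t] t by simp
      moreover have "0 \<le> K * Re (orbit p t)" using K(1) orbit_in[OF p t] by simp
      ultimately show ?thesis by (simp only: distrib_right)
    next
      case False
      have s_ge: "s k \<ge> 1 / 2" if "k \<le> N" for k
      proof (cases k)
        case 0
        then show ?thesis using s_ge1[of 0] False by simp
      next
        case (Suc i)
        then show ?thesis using half[of i] s_ge1[of i] s_nn that by simp
      qed
      have s_dec: "s j \<le> s i" if "i \<le> j" "j \<le> N" for i j
        using that
      proof (induction j rule: dec_induct)
        case (step n)
        have "0 < a * D (s n)" using a Dpos[of "s n"] s_ge[of n] step by simp
        then show ?case using step by (simp add: sS)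
      qed simp
      define w where "w = (\<lambda>k. orbit p (s k))"
      have wpos: "w k \<in> rhp" for k unfolding w_def by (rule orbit_in[OF p s_nn])
      have "cmod (w 0 - w N) \<le> K * Re (w 0)"
      proof (rule K(2), unfold receding_chain_def, intro conjI allI impI)
        fix k assume "k \<le> N"
        show "0 < Re (w k)" using wpos[of k] by simp
        show "Re (w k) \<le> Re (w 0)"
          unfolding w_def by (rule Re_g_mono[OF p s_nn s_dec]) (use \<open>k \<le> N\<close> in auto)
      next
        fix k assume k: "k < N"
        have sk: "0 < s k" using s_ge[of k] k by simp
        have "a * D (s k) \<le> a * (C * m (s k))" using Dm[OF s_nn] a by simp
        also have "\<dots> = m (s k) / 2" using C1 by (simp add: a_def)
        finally have "a * D (s k) \<le> m (s k) / 2" .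
        moreover have "(p + \<i> * of_real (s (Suc k))) - (p + \<i> * of_real (s k)) = - (\<i> * of_real (a * D (s k)))"
          by (simp add: sS algebra_simps)
        then have "cmod ((p + \<i> * of_real (s (Suc k))) - (p + \<i> * of_real (s k))) = a * D (s k)"
          using a Dpos[OF sk] by (simp only: norm_minus_cancel norm_mult norm_of_real) simp
        ultimately show "cmod (w (Suc k) - w k) \<le> 2 * Re (w k)"
          unfolding w_def by (intro g_chain_step(1)[OF shift[OF p s_nn] mball[OF s_nn] mpos[OF sk]]) simp
      next
        fix k assume k: "k \<le> N"
        define E where "E = hsep (w k) (w 0)"
        have E0: "E \<ge> 0" unfolding E_def by (rule hsep_nonneg[OF wpos wpos])
        obtain P L where P: "0 \<le> L" "exp L \<le> E + 2" "continuous_on {0..L} P"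
          "P ` {0..L} \<subseteq> rhp" "P 0 = w k" "P L = w 0"
          "\<And>s t. s \<in> {0..L} \<Longrightarrow> t \<in> {0..L} \<Longrightarrow> hsep (P s) (P t) = (2 * sinh ((s - t) / 2))\<^sup>2"
          using rhp_geodesic[OF wpos[of k] wpos[of 0]] unfolding E_def by metis
        have fw: "f (w i) = p + \<i> * of_real (s i)" for i
          unfolding w_def by (rule f_g[OF shift[OF p s_nn]])
        have "(\<Sum>j<k. ((s j - D (s j)) - (s (Suc j) - D (s (Suc j)))) / D (s j)) \<le> 12 * L + 1"
          unfolding D_def
        proof (rule channel_bound[OF p a(1,3) _ _ P(1,3,4) _ _ P(7)])
          show "f (P 0) = p + \<i> * of_real (s k)" "f (P L) = p + \<i> * of_real (s 0)"
            by (simp_all add: P fw)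
          show "0 < s j" if "j \<le> k" for j using s_ge[of j] that k by simp
        qed (auto simp: sS D_def)
        \<comment> \<open>Each summand equals \<open>a - 1 + x\<close>, where \<open>x\<close> is
          the ratio of the next width to the current one, and \<open>x - 1 \<ge> ln x\<close>. The
          loss through shrinking widths is thus a telescoping sum of logarithms.\<close>
        moreover have "a * k \<le> (\<Sum>j<k. ((s j - D (s j)) - (s (Suc j) - D (s (Suc j)))) / D (s j)) + (ln (D (s 0)) - ln (D (s k)))"
        proof -
          have st: "a \<le> ((s j - D (s j)) - (s (Suc j) - D (s (Suc j)))) / D (s j) + (ln (D (s j)) - ln (D (s (Suc j))))"
            if "j < k" for j
          proof -
            have d: "D (s j) > 0" "D (s (Suc j)) > 0" using s_ge[of j] s_ge[of "Suc j"] that k by (auto intro!: Dpos)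
            have "ln (D (s (Suc j)) / D (s j)) \<le> D (s (Suc j)) / D (s j) - 1"
              using d by (intro ln_le_minus_one) auto
            moreover have "((s j - D (s j)) - (s (Suc j) - D (s (Suc j)))) / D (s j) = a - 1 + D (s (Suc j)) / D (s j)"
              using d by (simp add: sS field_simps)
            ultimately show ?thesis using d by (simp add: ln_div)
          qed
          have "a * k = (\<Sum>j<k. a)" by simp
          also have "\<dots> \<le> (\<Sum>j<k. ((s j - D (s j)) - (s (Suc j) - D (s (Suc j)))) / D (s j) + (ln (D (s j)) - ln (D (s (Suc j)))))"
            by (intro sum_mono st) auto
          finally show ?thesis
            by (simp only: sum.distrib sum_lessThan_telescope'[of "\<lambda>j. ln (D (s j))"])
        qed
        \<comment> \<open>An omitted point near the earlier orbit point lies outside the inscribed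
          ball at the later one, and by distortion its distance has grown at most by the factor
          \<open>(E + 2)^2\<close>. So the widths cannot differ by more than the hyperbolic distance
          allows.\<close>
        moreover have "ln (D (s 0)) - ln (D (s k)) \<le> ln (C * C2) + 2 * ln (E + 2)"
        proof -
          have d: "D (s 0) > 0" "D (s k) > 0" using s_ge[of 0] s_ge[of k] k by (auto intro!: Dpos)
          obtain q where q: "q \<notin> \<Omega>" "cmod (p + \<i> * of_real (s k) - q) \<le> C2 * D (s k)"
            using near[OF s_ge[OF k]] by auto
          have "q \<notin> ball (p + \<i> * of_real (s 0)) (m (s 0))"
            using mball[OF s_nn[of 0]] q(1) by blast
          then have "m (s 0) \<le> cmod (p + \<i> * of_real (s 0) - q)"
            by (simp add: dist_norm)
          also have "\<dots> \<le> (E + 2)\<^sup>2 * cmod (p + \<i> * of_real (s k) - q)"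
            using distortion(1)[OF q(1) wpos[of k] wpos[of 0]] unfolding fw E_def .
          also have "\<dots> \<le> (E + 2)\<^sup>2 * (C2 * D (s k))" using q by (intro mult_left_mono) auto
          finally have "C * m (s 0) \<le> C * ((E + 2)\<^sup>2 * (C2 * D (s k)))" using C1 by simp
          then have "D (s 0) \<le> C * ((E + 2)\<^sup>2 * (C2 * D (s k)))"
            using Dm[OF s_nn[of 0]] by simp
          then have "ln (D (s 0)) \<le> ln ((C * C2) * (E + 2)\<^sup>2 * D (s k))"
            using d by (intro ln_mono) (auto simp: mult_ac)
          also have "\<dots> = ln (C * C2) + 2 * ln (E + 2) + ln (D (s k))"
            using d C1 C2 E0 by (simp add: ln_mult ln_realpow)
          finally show ?thesis by simp
        qed
        moreover have "L \<le> ln (E + 2)" using P(2) E0 by (simp add: ln_ge_iff)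
        ultimately have 1: "a * k \<le> 14 * ln (E + 2) + 1 + ln (C * C2)" by linarith
        define X where "X = Re (w 0) + cmod (w 0 - w k)"
        have pos: "0 < Re (w 0)" "0 < Re (w k)" using wpos by auto
        have le: "Re (w k) \<le> Re (w 0)"
          unfolding w_def by (rule Re_g_mono[OF p s_nn s_dec]) (use k in auto)
        have "E + 2 \<le> 2 * (X\<^sup>2 / (Re (w 0) * Re (w k)))"
        proof -
          have "Re (w 0) * Re (w k) \<le> (Re (w 0))\<^sup>2"
            using le pos by (simp add: power2_eq_square)
          moreover have "(cmod (w 0 - w k))\<^sup>2 + (Re (w 0))\<^sup>2 \<le> X\<^sup>2"
            using pos by (simp add: X_def power2_sum)
          moreover have "0 \<le> (cmod (w 0 - w k))\<^sup>2" by simp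
          ultimately have "(cmod (w k - w 0))\<^sup>2 + 2 * (Re (w 0) * Re (w k)) \<le> 2 * X\<^sup>2"
            unfolding norm_minus_commute[of "w k"] by linarith
          moreover have "E + 2 = ((cmod (w k - w 0))\<^sup>2 + 2 * (Re (w 0) * Re (w k))) / (Re (w 0) * Re (w k))"
            using pos by (simp add: E_def hsep_def field_simps)
          ultimately show ?thesis
            using pos by (simp add: divide_right_mono)
        qed
        moreover have Xp: "X\<^sup>2 / (Re (w 0) * Re (w k)) > 0"
          using pos by (intro divide_pos_pos zero_less_power mult_pos_pos) (auto simp: X_def add_pos_nonneg)
        ultimately have "ln (E + 2) \<le> ln 2 + ln (X\<^sup>2 / (Re (w 0) * Re (w k)))"
          using E0 by (subst ln_mult_pos[symmetric]) (auto intro!: ln_mono)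
        then have "a / 14 * k - C3 \<le> ln (X\<^sup>2 / (Re (w 0) * Re (w k)))"
          using 1 by (simp add: C3_def field_simps)
        then show "a / 14 * k - C3 \<le> ln ((Re (w 0) + cmod (w 0 - w k))\<^sup>2 / (Re (w 0) * Re (w k)))"
          by (simp add: X_def)
      qed
      moreover have "cmod (w N) \<le> B" unfolding w_def using sN s_nn by (intro B) auto
      moreover have "cmod (w 0) \<le> cmod (w 0 - w N) + cmod (w N)"
        using norm_triangle_ineq[of "w 0 - w N" "w N"] by simp
      moreover have w0: "w 0 = orbit p t" by (simp add: w_def s0)
      ultimately show ?thesis using B'[OF t] unfolding w0 by (simp add: distrib_right)
    qed
  qed
  then show ?thesis unfolding sectorial_def by blast
qed

end

section \<open>Orbits in a sector have comparable side distances\<close>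

lemma exp_vs_quartic:
  fixes c :: real
  assumes "0 < c"
  obtains M where "\<And>R. exp (c * R - 1) \<le> 768 * R ^ 4 \<Longrightarrow> R \<le> M"
proof -
  have "\<forall>\<^sub>F R in at_top. exp (c * R - 1) > 768 * R ^ 4"
    using assms by real_asymp
  then obtain M where "\<And>R. R \<ge> M \<Longrightarrow> exp (c * R - 1) > 768 * R ^ 4"
    by (auto simp: eventually_at_top_linorder)
  then show ?thesis using that[of M] by (meson linorder_le_cases not_le)
qed

lemma ex_power_two_between:
  fixes R :: real
  assumes "1 \<le> R"
  obtains k :: nat where "R \<le> 2 ^ k" "2 ^ k \<le> 2 * R"
proof -
  define k where "k = (LEAST k. R \<le> 2 ^ k)"
  have "\<exists>k::nat. R \<le> 2 ^ k" using real_arch_pow[of 2 R] by (auto intro: less_imp_le)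
  then have 1: "R \<le> 2 ^ k" unfolding k_def by (rule LeastI_ex)
  have "2 ^ k \<le> 2 * R"
  proof (cases k)
    case (Suc j)
    then have "\<not> R \<le> 2 ^ j" using not_less_Least[of j "\<lambda>k. R \<le> 2 ^ k"] by (simp add: k_def)
    then show ?thesis using Suc by simp
  qed (use assms in simp)
  then show ?thesis using that 1 by blast
qed

context starlike_domain
begin

text \<open>A Harnack chain from the orbit into the half disc. The point at distance
  \<open>\<rho> / 2 ^ j\<close> from the orbit carries a ball of that radius which touches the
  vertical line and so lies in the half disc. Each halving costs a factor 3, and after
  \<open>k\<close> of them the ball of radius \<open>d\<close> around the orbit point takes over for
  the last factor.\<close>

lemma half_disc_chain:
  assumes p: "p \<in> \<Omega>" and t: "0 \<le> t" and \<sigma>: "\<sigma> \<in> {1, -1}"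
    and \<rho>: "0 < \<rho>" "2 * \<rho> \<le> side_dist \<sigma> \<Omega> p t"
    and d: "0 < d" "ball (p + \<i> * of_real t) d \<subseteq> \<Omega>" "\<rho> \<le> d / 2 * 2 ^ k"
  defines "a \<equiv> p + \<i> * of_real t + of_real (\<sigma> * \<rho>)"
  shows "ball a \<rho> \<subseteq> \<Omega>" "Re (orbit p t) \<le> 3 ^ Suc k * Re (g a)" "Re (g a) \<le> 3 ^ Suc k * Re (orbit p t)"
proof -
  define v where "v = p + \<i> * of_real t"
  have \<sigma>2: "\<sigma> * \<sigma> = 1" "\<bar>\<sigma>\<bar> = 1" using \<sigma> by auto
  have b: "ball (v + of_real (\<sigma> * s)) s \<subseteq> \<Omega>" if s: "0 < s" "s \<le> \<rho>" for s
  proof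
    fix z assume "z \<in> ball (v + of_real (\<sigma> * s)) s"
    then have z: "cmod (z - (v + of_real (\<sigma> * s))) < s" by (simp add: dist_norm norm_minus_commute)
    have "cmod (z - v) \<le> cmod (z - (v + of_real (\<sigma> * s))) + cmod (of_real (\<sigma> * s))"
      using norm_triangle_ineq[of "z - (v + of_real (\<sigma> * s))" "of_real (\<sigma> * s)"] by simp
    also have "\<dots> < s + s" using z s \<sigma>2 by (simp add: norm_mult abs_mult del: of_real_mult)
    finally have 1: "cmod (z - (p + \<i> * of_real t)) < side_dist \<sigma> \<Omega> p t" using \<rho> s by (simp add: v_def)
    have "\<sigma> * Re (z - p) = \<sigma> * Re (z - (v + of_real (\<sigma> * s))) + s"
      using \<sigma>2 by (simp add: v_def algebra_simps)
    moreover have "\<bar>\<sigma> * Re (z - (v + of_real (\<sigma> * s)))\<bar> < s"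
      using abs_Re_le_cmod[of "z - (v + of_real (\<sigma> * s))"] z \<sigma>2 by (simp only: abs_mult)
    ultimately have "0 \<le> \<sigma> * Re (z - p)" by linarith
    then show "z \<in> \<Omega>" using side_dist_half_disc[OF p t _ 1] by simp
  qed
  define A where "A = (\<lambda>j::nat. v + of_real (\<sigma> * (\<rho> / 2 ^ j)))"
  have Ab: "ball (A j) (\<rho> / 2 ^ j) \<subseteq> \<Omega>" for j
    unfolding A_def using \<rho> by (intro b) (auto simp: divide_le_eq mult_le_cancel_left1)
  have AO: "A j \<in> \<Omega>" for j using Ab[of j] \<rho> by (auto simp: subset_iff)
  have A0: "A 0 = a" by (simp add: A_def a_def v_def)
  show "ball a \<rho> \<subseteq> \<Omega>" using Ab[of 0] by (simp add: A0)
  have st: "Re (g (A (Suc j))) \<le> 3 * Re (g (A j)) \<and> Re (g (A j)) \<le> 3 * Re (g (A (Suc j)))" for j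
  proof -
    have "A (Suc j) - A j = of_real (- (\<sigma> * (\<rho> / 2 ^ Suc j)))"
      by (simp add: A_def field_simps)
    then have "cmod (A (Suc j) - A j) = \<bar>\<sigma>\<bar> * (\<rho> / 2 ^ Suc j)"
      using \<rho> by (simp only: norm_of_real abs_minus abs_mult) simp
    then have "cmod (A (Suc j) - A j) \<le> \<rho> / 2 ^ j / 2" using \<sigma>2 by simp
    then show ?thesis using g_chain_step(2,3)[OF AO Ab] \<rho> by auto
  qed
  have ch: "Re (g (A k)) \<le> 3 ^ k * Re (g a) \<and> Re (g a) \<le> 3 ^ k * Re (g (A k))" for k
  proof (induction k)
    case (Suc k)
    have "Re (g a) \<le> 3 ^ k * Re (g (A k))" using Suc by blast
    also have "\<dots> \<le> 3 ^ k * (3 * Re (g (A (Suc k))))" using st[of k] by (intro mult_left_mono) auto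
    finally have "Re (g a) \<le> 3 ^ Suc k * Re (g (A (Suc k)))" by simp
    moreover have "Re (g (A (Suc k))) \<le> 3 ^ Suc k * Re (g a)" using Suc st[of k] by auto
    ultimately show ?case by simp
  qed (simp add: A0)
  have vO: "v \<in> \<Omega>" unfolding v_def by (rule shift[OF p t])
  have "cmod (A k - v) = \<rho> / 2 ^ k" using \<rho> \<sigma>2 by (simp add: A_def norm_mult norm_divide norm_power)
  also have "\<dots> \<le> d / 2" using d by (simp add: divide_le_eq)
  finally have e: "Re (g (A k)) \<le> 3 * Re (g v)" "Re (g v) \<le> 3 * Re (g (A k))"
    using g_chain_step(2,3)[OF vO d(2)[folded v_def] d(1)] by auto
  have "Re (g a) \<le> 3 ^ k * Re (g (A k))" using ch by blast
  also have "\<dots> \<le> 3 ^ k * (3 * Re (g v))" using e by (intro mult_left_mono) auto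
  finally show "Re (g a) \<le> 3 ^ Suc k * Re (orbit p t)" by (simp add: v_def)
  show "Re (orbit p t) \<le> 3 ^ Suc k * Re (g a)" using e ch[of k] by (auto simp: v_def)
qed

text \<open>The assumption that the ratio \<open>R t\<close> is almost maximal on \<open>(0, t]\<close> prevents the small side distance
  from collapsing between \<open>t\<close> and \<open>t - r / 16\<close>.\<close>

lemma side_dist_ratio_bound:
  assumes p: "p \<in> \<Omega>" and \<sigma>: "\<sigma> \<in> {1, -1}"
    and K: "\<And>t. 0 \<le> t \<Longrightarrow> cmod (orbit p t) \<le> K * Re (orbit p t)"
  defines "R \<equiv> \<lambda>t. side_dist \<sigma> \<Omega> p t / side_dist (- \<sigma>) \<Omega> p t"
  obtains M where "\<And>t. 0 < t \<Longrightarrow> (\<And>u. 0 < u \<Longrightarrow> u \<le> t \<Longrightarrow> R u \<le> 2 * R t) \<Longrightarrow> R t \<le> M"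
proof -
  define x where "x = (\<lambda>t. Re (orbit p t))"
  have xpos: "x t > 0" if "0 \<le> t" for t unfolding x_def using orbit_in[OF p that] by simp
  have xmono: "x s \<le> x t" if "0 \<le> s" "s \<le> t" for s t
    unfolding x_def by (rule Re_g_mono[OF p that])
  have K0: "K \<ge> 0"
    using K[of 0] xpos[of 0] unfolding x_def by (smt (verit) mult_neg_pos norm_ge_zero)
  \<comment> \<open>If the real part grows at most by the factor \<open>exp 1\<close> between two
    times, then \<open>hsep\<close> of the orbit points is at most
    \<open>4 * K\<^sup>2 * exp 1\<close>, and distances to an omitted point change at most by the
    factor \<open>c1\<close>. With \<open>c2\<close> one has
    \<open>c1 * d + d < c2 * d\<close>.\<close>
  define c1 where "c1 = (4 * K\<^sup>2 * exp 1 + 2)\<^sup>2"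
  define c2 where "c2 = c1 + 2"
  have c2: "c2 > 0" "c1 \<ge> 0" by (auto simp: c1_def c2_def add_nonneg_pos)
  obtain M where M: "\<And>R. exp (1 / (16 * c2) * R - 1) \<le> 768 * R ^ 4 \<Longrightarrow> R \<le> M"
    using exp_vs_quartic[of "1 / (16 * c2)"] c2 by auto
  obtain e where e: "e > 0" "\<And>\<sigma> t. 0 \<le> t \<Longrightarrow> min t e \<le> side_dist \<sigma> \<Omega> p t"
    using side_dist_lower[OF p] by metis
  have "R t \<le> max 1 M" if t: "0 < t" and sup: "\<And>u. 0 < u \<Longrightarrow> u \<le> t \<Longrightarrow> R u \<le> 2 * R t" for t
  proof (cases "R t \<le> 1")
    case False
    define r where "r = side_dist \<sigma> \<Omega> p t"
    define d where "d = side_dist (- \<sigma>) \<Omega> p t"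
    have sdpos: "0 < side_dist \<sigma>' \<Omega> p u" if "0 < u" for \<sigma>' u
      using e(2)[of u \<sigma>'] e(1) that by auto
    have d0: "d > 0" and r0: "r > 0" using sdpos[OF t] by (auto simp: d_def r_def)
    have Rt: "R t = r / d" by (simp add: R_def r_def d_def)
    have dr: "d < r" using False d0 unfolding Rt by (simp add: less_divide_eq)
    have rt: "r \<le> t" unfolding r_def using t by (intro side_dist_le_self) simp
    obtain q where q: "q \<notin> \<Omega>" "cmod (q - (p + \<i> * of_real t)) = d"
      using side_dist_attained[of t "- \<sigma>" p] t dr rt unfolding d_def by (metis less_le_trans less_imp_le)
    define t' where "t' = t - r / 16"
    have t': "0 < t'" "t' < t" using r0 rt by (auto simp: t'_def)
    define rB where "rB = side_dist \<sigma> \<Omega> p t'"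
    define dB where "dB = side_dist (- \<sigma>) \<Omega> p t'"
    have rB: "15 / 16 * r \<le> rB"
      using side_dist_lipschitz[OF p, of t' t \<sigma>] t t' by (simp add: rB_def r_def t'_def)
    have dB0: "dB > 0" unfolding dB_def by (rule sdpos[OF t'(1)])
    have dB: "d / 4 \<le> dB"
    proof -
      have "rB / dB \<le> 2 * (r / d)" using sup[of t'] t' unfolding Rt by (simp add: R_def rB_def dB_def)
      then have "rB * d \<le> 2 * r * dB" using dB0 d0 by (simp add: field_simps)
      moreover have "15 / 16 * r * d \<le> rB * d" using rB d0 by (intro mult_right_mono) auto
      ultimately have "r * (15 / 16 * d) \<le> r * (2 * dB)" by (simp add: mult_ac)
      then have "15 / 16 * d \<le> 2 * dB" using r0 by (simp only: mult_le_cancel_left_pos)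
      then show ?thesis using d0 by simp
    qed
    have sides: "min (side_dist \<sigma> \<Omega> p u) (side_dist (- \<sigma>) \<Omega> p u) = min (side_dist 1 \<Omega> p u) (side_dist (- 1) \<Omega> p u)" for u
      using \<sigma> by (auto simp: min.commute)
    have ballA: "ball (p + \<i> * of_real t) (d / 4) \<subseteq> \<Omega>"
    proof (rule side_dist_ball[OF p])
      have "d / 4 \<le> min (side_dist \<sigma> \<Omega> p t) (side_dist (- \<sigma>) \<Omega> p t)"
        using dr d0 by (simp add: r_def d_def)
      then show "d / 4 \<le> side_dist 1 \<Omega> p t" "d / 4 \<le> side_dist (- 1) \<Omega> p t" unfolding sides by auto
    qed (use t in simp)
    have ballB: "ball (p + \<i> * of_real t') (d / 4) \<subseteq> \<Omega>"
    proof (rule side_dist_ball[OF p])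
      have "d / 4 \<le> rB" using rB dr r0 by simp
      then have "d / 4 \<le> min (side_dist \<sigma> \<Omega> p t') (side_dist (- \<sigma>) \<Omega> p t')"
        using dB by (simp add: rB_def dB_def)
      then show "d / 4 \<le> side_dist 1 \<Omega> p t'" "d / 4 \<le> side_dist (- 1) \<Omega> p t'" unfolding sides by auto
    qed (use t' in simp)
    \<comment> \<open>Now \<open>2 * \<rho>\<close> is below both \<open>r\<close> and
      \<open>rB\<close>, so that both half discs contain their chains, and the vertical offset
      \<open>r / 16\<close> between \<open>a\<close> and \<open>b\<close> is
      \<open>\<rho> / 2\<close>, a single Harnack step.\<close>
    define \<rho> where "\<rho> = r / 8"
    obtain k where k: "r / d \<le> 2 ^ k" "2 ^ k \<le> 2 * (r / d)"
      using ex_power_two_between[of "r / d"] False Rt by auto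
    have dk: "\<rho> \<le> d / 4 / 2 * 2 ^ k" using k(1) d0 by (simp add: \<rho>_def field_simps)
    have \<rho>0: "0 < \<rho>" using r0 by (simp add: \<rho>_def)
    define a where "a = p + \<i> * of_real t + of_real (\<sigma> * \<rho>)"
    define b where "b = p + \<i> * of_real t' + of_real (\<sigma> * \<rho>)"
    have chA: "ball a \<rho> \<subseteq> \<Omega>" "x t \<le> 3 ^ Suc k * Re (g a)"
      using half_disc_chain[OF p _ \<sigma> \<rho>0 _ _ ballA dk] t r0 d0 by (auto simp: a_def x_def \<rho>_def r_def)
    have chB: "Re (g b) \<le> 3 ^ Suc k * x t'"
      using half_disc_chain(3)[OF p _ \<sigma> \<rho>0 _ _ ballB dk] t' r0 d0 rB by (auto simp: b_def x_def \<rho>_def rB_def)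
    have "b - a = - (\<i> * of_real (r / 16))" by (simp add: a_def b_def t'_def algebra_simps)
    then have "cmod (b - a) \<le> \<rho> / 2" using r0 by (simp add: \<rho>_def norm_mult norm_divide)
    then have ab: "Re (g a) \<le> 3 * Re (g b)"
      using g_chain_step(3)[OF _ chA(1) \<rho>0] chA(1) \<rho>0 by (auto simp: subset_iff)
    have pow: "(3::real) ^ Suc k \<le> 16 * (r / d)\<^sup>2"
    proof -
      have "(3::real) ^ Suc k \<le> 4 ^ Suc k" by (intro power_mono) auto
      also have "\<dots> = 4 * (2 ^ k)\<^sup>2" by (simp add: power_mult_distrib power2_eq_square flip: power_mult_distrib)
      also have "\<dots> \<le> 4 * (2 * (r / d))\<^sup>2" using k by (intro mult_left_mono power_mono) auto
      also have "\<dots> = 16 * (r / d)\<^sup>2" by (simp only: power_mult_distrib) simp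
      finally show ?thesis .
    qed
    \<comment> \<open>The detour runs from the orbit at \<open>t\<close> through \<open>a\<close>
      and \<open>b\<close> to the orbit at \<open>t'\<close>. As \<open>2 ^ k\<close> is comparable
      to \<open>r / d\<close> and \<open>3 < 2^2\<close>, each chain costs at most
      \<open>16 * (r / d)\<^sup>2\<close>; with the factor 3 between \<open>a\<close> and
      \<open>b\<close> this gives \<open>768 = 3 * 16 * 16\<close>.\<close>
    have "x t \<le> 3 ^ Suc k * Re (g a)" by (rule chA)
    also have "\<dots> \<le> 3 ^ Suc k * (3 * Re (g b))" using ab by (intro mult_left_mono) auto
    also have "\<dots> \<le> 3 ^ Suc k * (3 * (3 ^ Suc k * x t'))" using chB by (intro mult_left_mono) auto
    also have "\<dots> = 3 * (3 ^ Suc k * 3 ^ Suc k) * x t'" by simp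
    also have "\<dots> \<le> 3 * ((16 * (r / d)\<^sup>2) * (16 * (r / d)\<^sup>2)) * x t'"
      using pow xpos[of t'] t' by (intro mult_right_mono mult_left_mono mult_mono) auto
    also have "\<dots> = 768 * (r / d) ^ 4 * x t'" by (simp add: power4_eq_xxxx power2_eq_square)
    finally have upper: "x t \<le> 768 * (r / d) ^ 4 * x t'" .
    \<comment> \<open>The point \<open>q\<close>, moved down along with the orbit, stays omitted at
      distance exactly \<open>d\<close>. Were the growth smaller, distortion would keep the orbit at
      time \<open>u\<close> within \<open>c1 * d\<close> of the point \<open>q'\<close> for time
      \<open>s\<close>, too close for a rise by \<open>c2 * d\<close>.\<close>
    have grow: "exp 1 * x s < x u" if su: "t' \<le> s" "s + c2 * d = u" "u \<le> t" for s u
    proof (rule ccontr)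
      assume c: "\<not> ?thesis"
      have s0: "0 \<le> s" "0 \<le> u" "s \<le> u" using su t' c2 d0 by auto
      define E where "E = hsep (orbit p s) (orbit p u)"
      have "cmod (orbit p s - orbit p u) \<le> cmod (orbit p s) + cmod (orbit p u)" by (rule norm_triangle_ineq4)
      also have "\<dots> \<le> K * x s + K * x u" using K s0 by (intro add_mono) (auto simp: x_def)
      also have "\<dots> \<le> 2 * K * x u" using mult_left_mono[OF xmono[OF s0(1,3)] K0] by simp
      finally have "(cmod (orbit p s - orbit p u))\<^sup>2 \<le> (2 * K * x u)\<^sup>2" by (intro power_mono) auto
      then have "E \<le> (2 * K * x u)\<^sup>2 / (x s * x u)"
        unfolding E_def hsep_def x_def using xpos s0 by (intro divide_right_mono) (auto simp: x_def less_imp_le)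
      also have "\<dots> = 4 * K\<^sup>2 * (x u / x s)" using xpos[of u] xpos[of s] s0 by (simp add: field_simps power2_eq_square)
      also have "\<dots> \<le> 4 * K\<^sup>2 * exp 1" using c xpos[of s] s0 by (intro mult_left_mono) (auto simp: divide_le_eq)
      finally have E: "E \<le> 4 * K\<^sup>2 * exp 1" .
      have E0: "E \<ge> 0" unfolding E_def by (rule hsep_nonneg) (use orbit_in[OF p] s0 in auto)
      define q' where "q' = q - \<i> * of_real (t - s)"
      have q': "q' \<notin> \<Omega>" unfolding q'_def using su s0 by (intro shift_down_notin[OF q(1)]) auto
      have ds: "cmod (p + \<i> * of_real s - q') = d"
        using q(2) by (simp add: q'_def norm_minus_commute algebra_simps)
      have "cmod (f (orbit p u) - q') \<le> (E + 2)\<^sup>2 * cmod (f (orbit p s) - q')"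
        unfolding E_def by (rule distortion(1)[OF q' orbit_in[OF p s0(1)] orbit_in[OF p s0(2)]])
      then have "cmod (p + \<i> * of_real u - q') \<le> (E + 2)\<^sup>2 * d"
        using ds by (simp add: f_g[OF shift[OF p s0(1)]] f_g[OF shift[OF p s0(2)]])
      also have "\<dots> \<le> c1 * d" unfolding c1_def using E E0 d0 by (intro mult_right_mono power_mono) auto
      finally have du: "cmod (p + \<i> * of_real u - q') \<le> c1 * d" .
      have "u - s = cmod ((p + \<i> * of_real u - q') - (p + \<i> * of_real s - q'))"
      proof -
        have "(p + \<i> * of_real u - q') - (p + \<i> * of_real s - q') = \<i> * of_real (u - s)" by (simp add: algebra_simps)
        then show ?thesis using s0 by (simp only: norm_mult norm_of_real) simp
      qed
      also have "\<dots> \<le> c1 * d + d" using norm_triangle_ineq4 du ds by (smt (verit))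
      also have "\<dots> < c2 * d" using d0 by (simp add: c2_def algebra_simps)
      finally show False using su by simp
    qed
    \<comment> \<open>The number of rises by \<open>c2 * d\<close> that fit between
      \<open>t'\<close> and \<open>t\<close>. They force a growth by \<open>exp n\<close>,
      exponential in \<open>r / d\<close>, against the quartic bound of the detour.\<close>
    define n where "n = nat \<lfloor>r / (16 * c2 * d)\<rfloor>"
    have n: "real n \<le> r / (16 * c2 * d)" "r / (16 * c2 * d) \<le> real n + 1"
      unfolding n_def using r0 c2 d0 by (auto simp: le_floor_iff)
    have nd: "real n * (c2 * d) \<le> r / 16" using n(1) c2 d0 by (simp add: field_simps)
    have "exp (real j) * x t' \<le> x (t' + real j * (c2 * d))" if "j \<le> n" for j
      using that
    proof (induction j)
      case (Suc j)
      have "real (Suc j) * (c2 * d) \<le> real n * (c2 * d)"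
        using Suc.prems c2 d0 by (intro mult_right_mono) auto
      then have j: "real (Suc j) * (c2 * d) \<le> r / 16" using nd by linarith
      have "exp (real (Suc j)) * x t' = exp 1 * (exp (real j) * x t')" by (simp add: exp_add)
      also have "\<dots> \<le> exp 1 * x (t' + real j * (c2 * d))" using Suc by (intro mult_left_mono) auto
      also have "\<dots> < x (t' + real (Suc j) * (c2 * d))"
        by (rule grow) (use j c2 d0 in \<open>auto simp: t'_def algebra_simps\<close>)
      finally show ?case by simp
    qed simp
    then have "exp (real n) * x t' \<le> x (t' + real n * (c2 * d))" by simp
    also have "\<dots> \<le> x t" using nd t' c2 d0 by (intro xmono) (auto simp: t'_def)
    also note upper
    finally have "exp (real n) \<le> 768 * (r / d) ^ 4" using xpos[of t'] t' by simp
    moreover have "exp (1 / (16 * c2) * (r / d) - 1) \<le> exp (real n)" using n(2) by simp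
    ultimately have "r / d \<le> M" by (intro M) linarith
    then show ?thesis by (simp add: Rt)
  qed simp
  then show ?thesis using that by blast
qed

text \<open>On \<open>(0, T]\<close> the ratio is bounded, since \<open>u / min u e\<close> bounds
  it at \<open>u\<close>. A time at which it exceeds half of its supremum is almost maximal in the
  sense of the preceding lemma, so the supremum is at most \<open>2 * M\<close>, a bound free of
  \<open>T\<close>.\<close>

lemma one_sided_bound:
  assumes p: "p \<in> \<Omega>" and \<sigma>: "\<sigma> \<in> {1, -1}" and "sectorial p"
  obtains C where "0 < C" "\<And>t. 0 \<le> t \<Longrightarrow> side_dist \<sigma> \<Omega> p t \<le> C * side_dist (- \<sigma>) \<Omega> p t"
proof -
  obtain K where K: "\<And>t. 0 \<le> t \<Longrightarrow> cmod (orbit p t) \<le> K * Re (orbit p t)"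
    using assms(3) by (auto simp: sectorial_def)
  define R where "R = (\<lambda>t. side_dist \<sigma> \<Omega> p t / side_dist (- \<sigma>) \<Omega> p t)"
  obtain M where M: "\<And>t. 0 < t \<Longrightarrow> (\<And>u. 0 < u \<Longrightarrow> u \<le> t \<Longrightarrow> R u \<le> 2 * R t) \<Longrightarrow> R t \<le> M"
    using side_dist_ratio_bound[OF p \<sigma> K] unfolding R_def by metis
  obtain e where e: "e > 0" "\<And>\<sigma> t. 0 \<le> t \<Longrightarrow> min t e \<le> side_dist \<sigma> \<Omega> p t"
    using side_dist_lower[OF p] by metis
  have sdpos: "0 < side_dist \<sigma>' \<Omega> p u" if "0 < u" for \<sigma>' u
    using e(2)[of u \<sigma>'] e(1) that by auto
  have Rpos: "R t > 0" if "0 < t" for t using sdpos[OF that] by (simp add: R_def)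
  have bound: "R T \<le> 2 * M" if T: "0 < T" for T
  proof -
    define S where "S = Sup (R ` {0<..T})"
    have bdd: "bdd_above (R ` {0<..T})"
    proof (rule bdd_aboveI2)
      fix u assume u: "u \<in> {0<..T}"
      have "R u \<le> u / min u e"
        unfolding R_def using side_dist_le_self[of u \<sigma> \<Omega> p] e u sdpos[of u] by (intro frac_le) auto
      also have "\<dots> \<le> max 1 (T / e)"
        using u e by (auto simp: min_def divide_right_mono le_max_iff_disj)
      finally show "R u \<le> max 1 (T / e)" .
    qed
    have le: "R u \<le> S" if "0 < u" "u \<le> T" for u
      unfolding S_def using that by (intro cSup_upper[OF _ bdd]) auto
    have "S > 0" using le[of T] Rpos[OF T] T by simp
    then have "\<exists>y\<in>R ` {0<..T}. S / 2 < y"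
      using T by (intro less_cSupD) (auto simp flip: S_def)
    then obtain t where t: "0 < t" "t \<le> T" "S / 2 < R t" by auto
    have "R t \<le> M" by (rule M[OF t(1)]) (use le t in force)
    then show ?thesis using t le[of T] T by simp
  qed
  have "M > 0" using bound[of 1] Rpos[of 1] by simp
  show ?thesis
  proof (rule that[of "2 * M"])
    fix t :: real assume t: "0 \<le> t"
    show "side_dist \<sigma> \<Omega> p t \<le> 2 * M * side_dist (- \<sigma>) \<Omega> p t"
    proof (cases "t = 0")
      case True
      then show ?thesis using side_dist_le_self[of 0 \<sigma> \<Omega> p] side_dist_nonneg[of 0 "- \<sigma>" \<Omega> p] \<open>M > 0\<close>
        by (smt (verit) mult_nonneg_nonneg)
    next
      case False
      then show ?thesis using bound[of t] sdpos[of t "- \<sigma>"] t by (simp add: R_def divide_le_eq)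
    qed
  qed (use \<open>M > 0\<close> in simp)
qed

theorem sectorial_iff_comparable_sides:
  assumes p: "p \<in> \<Omega>"
  shows "sectorial p \<longleftrightarrow> comparable_sides p"
proof
  assume s: "sectorial p"
  obtain C1 where C1: "0 < C1" "\<And>t. 0 \<le> t \<Longrightarrow> side_dist 1 \<Omega> p t \<le> C1 * side_dist (- 1) \<Omega> p t"
    using one_sided_bound[OF p _ s, of 1] by auto
  obtain C2 where C2: "0 < C2" "\<And>t. 0 \<le> t \<Longrightarrow> side_dist (- 1) \<Omega> p t \<le> C2 * side_dist 1 \<Omega> p t"
    using one_sided_bound[OF p _ s, of "-1"] by auto
  have "C1 * side_dist (- 1) \<Omega> p t \<le> max C1 C2 * side_dist (- 1) \<Omega> p t"
    "C2 * side_dist 1 \<Omega> p t \<le> max C1 C2 * side_dist 1 \<Omega> p t" if "0 \<le> t" for t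
    using side_dist_nonneg[OF that] by (auto intro: mult_right_mono)
  then have "\<forall>t\<ge>0. side_dist 1 \<Omega> p t \<le> max C1 C2 * side_dist (- 1) \<Omega> p t \<and>
     side_dist (- 1) \<Omega> p t \<le> max C1 C2 * side_dist 1 \<Omega> p t"
    using C1 C2 by (meson order_trans)
  then show "comparable_sides p" unfolding comparable_sides_def using C1 by (intro exI[of _ "max C1 C2"]) auto
qed (rule sectorial_if_comparable_sides[OF p])

end

section \<open>The hyperbolic distance of the disc\<close>

abbreviation mob :: "complex \<Rightarrow> complex \<Rightarrow> complex" where
  "mob \<equiv> Moebius_function 0"

lemma mob_denom: "cmod a < 1 \<Longrightarrow> cmod z < 1 \<Longrightarrow> 1 - cnj a * z \<noteq> 0"
  by (metis complex_mod_cnj less_irrefl norm_mult_less mult.right_neutral norm_one right_minus_eq)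

lemma one_minus_norm_mob:
  assumes "cmod a < 1" "cmod z < 1"
  shows "1 - (cmod (mob a z))\<^sup>2 = (1 - (cmod a)\<^sup>2) * (1 - (cmod z)\<^sup>2) / (cmod (1 - cnj a * z))\<^sup>2"
proof -
  have "(cmod (1 - cnj a * z))\<^sup>2 - (cmod (z - a))\<^sup>2 = (1 - (cmod a)\<^sup>2) * (1 - (cmod z)\<^sup>2)"
    unfolding cmod_power2 by (simp add: algebra_simps power2_eq_square)
  moreover have "(cmod (1 - cnj a * z))\<^sup>2 \<noteq> 0" using mob_denom[OF assms] by simp
  ultimately show ?thesis
    unfolding Moebius_function_simple norm_divide power_divide by (simp add: diff_divide_eq_iff field_simps)
qed

lemma mob_has_derivative:
  assumes "cmod a < 1" "cmod z < 1"
  shows "(mob a has_field_derivative of_real (1 - (cmod a)\<^sup>2) / (1 - cnj a * z)\<^sup>2) (at z)"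
proof -
  have "1 * (1 - cnj a * z) - (z - a) * (- cnj a) = 1 - a * cnj a"
    by (simp add: algebra_simps)
  also have "\<dots> = of_real (1 - (cmod a)\<^sup>2)" by (simp only: of_real_diff complex_norm_square) simp
  finally have e: "1 * (1 - cnj a * z) - (z - a) * (- cnj a) = of_real (1 - (cmod a)\<^sup>2)" .
  have "((\<lambda>w. (w - a) / (1 - cnj a * w)) has_field_derivative
      (1 * (1 - cnj a * z) - (z - a) * (- cnj a)) / ((1 - cnj a * z) * (1 - cnj a * z))) (at z)"
    by (rule DERIV_divide) (use mob_denom[OF assms] in \<open>auto intro!: derivative_eq_intros\<close>)
  then show ?thesis
    unfolding e Moebius_function_simple[abs_def] by (simp only: power2_eq_square)
qed

lemma mob_metric_invariant:
  assumes "cmod a < 1" "cmod z < 1"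
  shows "cmod (of_real (1 - (cmod a)\<^sup>2) / (1 - cnj a * z)\<^sup>2) / (1 - (cmod (mob a z))\<^sup>2) = 1 / (1 - (cmod z)\<^sup>2)"
proof -
  have "0 < 1 - (cmod a)\<^sup>2" "0 < 1 - (cmod z)\<^sup>2" using assms by (auto simp: abs_square_less_1)
  moreover have "cmod (1 - cnj a * z) \<noteq> 0" using mob_denom[OF assms] by simp
  ultimately show ?thesis
    unfolding one_minus_norm_mob[OF assms]
    by (simp add: norm_divide norm_power del: of_real_diff)
qed

lemma mob_in_disc: "cmod a < 1 \<Longrightarrow> z \<in> unit_disc \<Longrightarrow> mob a z \<in> unit_disc"
  using Moebius_function_norm_lt_1 by simp

text \<open>The metric refers to an unspecified Riemann map, so all of them must have the same
  derivative at 0. Followed by \<open>mob z\<close>, such a map becomes an automorphism fixing 0,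
  and the Schwarz lemma for it and for its inverse gives derivative of modulus 1. The map
  \<open>mob (- z)\<close> shows that there is one to choose.\<close>

lemma hyperbolic_metric_disc:
  assumes z: "cmod z < 1"
  shows "hyperbolic_metric unit_disc z v = cmod v / (1 - (cmod z)\<^sup>2)"
proof -
  have unique: "Re (deriv f 0) = 1 - (cmod z)\<^sup>2" if "is_riemann_map unit_disc z f" for f
  proof -
    have f: "f holomorphic_on unit_disc" "bij_betw f unit_disc unit_disc" "f 0 = z" "deriv f 0 \<in> \<real>" "Re (deriv f 0) > 0"
      using that by (auto simp: is_riemann_map_def)
    define F where "F = mob z \<circ> f"
    have fim: "f ` unit_disc = unit_disc" using f(2) by (simp add: bij_betw_def)
    have Fh: "F holomorphic_on unit_disc"
      unfolding F_def using fim by (intro holomorphic_on_compose_gen[OF f(1) Moebius_function_holomorphic[OF z]]) auto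
    have mi: "inj_on (mob z) unit_disc"
      by (rule inj_on_inverseI[of _ "mob (- z)"]) (use z in \<open>auto intro: Moebius_function_compose\<close>)
    have mim: "mob z ` unit_disc = unit_disc"
    proof
      show "unit_disc \<subseteq> mob z ` unit_disc"
      proof
        fix u assume "u \<in> unit_disc"
        then have "u = mob z (mob (- z) u)" "mob (- z) u \<in> unit_disc"
          using z Moebius_function_compose[of z "- z" u] mob_in_disc[of "- z" u] by auto
        then show "u \<in> mob z ` unit_disc" by blast
      qed
    qed (use mob_in_disc[OF z] in auto)
    have Fi: "inj_on F unit_disc"
      unfolding F_def by (intro comp_inj_on) (use f(2) fim mi in \<open>simp_all add: bij_betw_def\<close>)
    have Fim: "F ` unit_disc = unit_disc" by (metis F_def fim image_comp mim)
    have F0: "F 0 = 0" by (simp add: F_def f Moebius_function_eq_zero)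
    obtain G where G: "G holomorphic_on F ` unit_disc" "\<And>u. u \<in> unit_disc \<Longrightarrow> deriv F u * deriv G (F u) = 1"
      "\<And>u. u \<in> unit_disc \<Longrightarrow> G (F u) = u"
      using holomorphic_has_inverse[OF Fh _ Fi] by auto
    have Gin: "cmod (G u) < 1" if "cmod u < 1" for u
    proof -
      have "u \<in> F ` unit_disc" unfolding Fim using that by simp
      then obtain y where "y \<in> unit_disc" "u = F y" by blast
      then show ?thesis using G(3)[of y] by simp
    qed
    have Fin: "cmod (F u) < 1" if "cmod u < 1" for u
    proof -
      have "F u \<in> F ` unit_disc" using that by simp
      then show ?thesis unfolding Fim by simp
    qed
    have "cmod (deriv F 0) \<le> 1"
      by (rule Schwarz_Lemma(2)[OF Fh F0, of 0]) (use Fin in auto)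
    moreover have "G 0 = 0" using G(3)[of 0] F0 by simp
    then have "cmod (deriv G 0) \<le> 1"
      by (intro Schwarz_Lemma(2)[OF G(1)[unfolded Fim], of 0]) (use Gin in auto)
    moreover have "cmod (deriv F 0) * cmod (deriv G 0) = 1"
      using arg_cong[OF G(2)[of 0], of cmod] F0 by (simp add: norm_mult)
    ultimately have dF: "cmod (deriv F 0) = 1"
      by (smt (verit) mult_left_le mult_right_le_one_le norm_ge_zero)
    have "(f has_field_derivative deriv f 0) (at 0)"
      using f(1) by (intro holomorphic_derivI[of _ unit_disc]) auto
    moreover have "(mob z has_field_derivative of_real (1 - (cmod z)\<^sup>2) / (1 - cnj z * z)\<^sup>2) (at (f 0))"
      unfolding f(3) by (rule mob_has_derivative[OF z z])
    ultimately have "(F has_field_derivative of_real (1 - (cmod z)\<^sup>2) / (1 - cnj z * z)\<^sup>2 * deriv f 0) (at 0)"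
      unfolding F_def by (intro DERIV_chain)
    then have dFeq: "deriv F 0 = of_real (1 - (cmod z)\<^sup>2) / (1 - cnj z * z)\<^sup>2 * deriv f 0"
      by (rule DERIV_imp_deriv)
    have p: "1 - (cmod z)\<^sup>2 > 0" using z by (simp add: abs_square_less_1)
    have den: "1 - cnj z * z = of_real (1 - (cmod z)\<^sup>2)"
      by (simp add: mult.commute[of "cnj z"] flip: complex_norm_square)
    have re: "of_real (Re (deriv f 0)) = deriv f 0" using f(4) by simp
    have scale: "of_real q / (of_real q)\<^sup>2 * of_real r = complex_of_real (r / q)" for q r
      by (simp add: power2_eq_square)
    have "deriv F 0 = of_real (Re (deriv f 0) / (1 - (cmod z)\<^sup>2))"
      unfolding dFeq den scale[symmetric] re ..
    then have "cmod (deriv F 0) = Re (deriv f 0) / (1 - (cmod z)\<^sup>2)" using p f(5) by (simp del: of_real_divide)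
    then show ?thesis using dF p by (simp add: divide_simps)
  qed
  have "is_riemann_map unit_disc z (mob (- z))"
  proof -
    have mz: "cmod (- z) < 1" using z by simp
    have 1: "deriv (mob (- z)) 0 = of_real (1 - (cmod z)\<^sup>2)"
      using DERIV_imp_deriv[OF mob_has_derivative[OF mz, of 0]] by simp
    have "bij_betw (mob (- z)) unit_disc unit_disc"
    proof (rule bij_betwI[of _ _ _ "mob z"])
      show "mob (- z) \<in> unit_disc \<rightarrow> unit_disc" "mob z \<in> unit_disc \<rightarrow> unit_disc"
        using mob_in_disc[OF mz] mob_in_disc[OF z] by blast+
      show "mob z (mob (- z) u) = u" if "u \<in> unit_disc" for u
        using that z by (intro Moebius_function_compose) auto
      show "mob (- z) (mob z u) = u" if "u \<in> unit_disc" for u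
        using that z by (intro Moebius_function_compose) auto
    qed
    then show ?thesis
      unfolding is_riemann_map_def 1
      using Moebius_function_holomorphic[OF mz] z
      by (auto simp: Moebius_function_of_zero abs_square_less_1 simp del: of_real_diff)
  qed
  then have "is_riemann_map unit_disc z (SOME f. is_riemann_map unit_disc z f)"
    by (rule someI[of "is_riemann_map unit_disc z"])
  then show ?thesis by (simp add: hyperbolic_metric_def unique)
qed

text \<open>Projecting to the diameter through \<open>mob z w\<close> avoids differentiating \<open>|mob z (\<gamma> t)|\<close> at its zeros.\<close>

lemma norm_mob_le_length:
  assumes z: "cmod z < 1" and \<gamma>: "valid_path \<gamma>" "path_image \<gamma> \<subseteq> unit_disc" "pathstart \<gamma> = z" "pathfinish \<gamma> = w"
    and l: "((\<lambda>t. hyperbolic_metric unit_disc (\<gamma> t) (vector_derivative \<gamma> (at t))) has_integral l) {0..1}"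
  shows "artanh (cmod (mob z w)) \<le> l"
proof -
  have \<gamma>1: "cmod (\<gamma> t) < 1" if "t \<in> {0..1}" for t
  proof -
    have "\<gamma> t \<in> unit_disc" using \<gamma>(2) that unfolding path_image_def by blast
    then show ?thesis by simp
  qed
  obtain S where S: "finite S" "\<gamma> C1_differentiable_on ({0..1} - S)" "continuous_on {0..1} \<gamma>"
    using \<gamma>(1) by (auto simp: valid_path_def piecewise_C1_differentiable_on_def)
  have d\<gamma>: "(\<gamma> has_vector_derivative vector_derivative \<gamma> (at t)) (at t)" if "t \<in> {0..1} - S" for t
    using S(2) that by (auto simp: C1_differentiable_on_eq vector_derivative_works)
  \<comment> \<open>This rotation makes \<open>e * mob z w\<close> real and nonnegative. The
    projection \<open>u\<close> then reaches \<open>|mob z w|\<close> at the end of the path and is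
    dominated by \<open>|mob z (\<gamma> t)|\<close> everywhere.\<close>
  define e where "e = (if mob z w = 0 then 1 else cnj (sgn (mob z w)))"
  have e1: "cmod e = 1" by (simp add: e_def norm_sgn)
  have ew: "e * mob z w = of_real (cmod (mob z w))"
    by (simp add: e_def sgn_eq complex_norm_square[symmetric] power2_eq_square mult.commute)
  define u where "u = (\<lambda>t. Re (e * mob z (\<gamma> t)))"
  define G where "G = (\<lambda>t. artanh (u t))"
  have ule: "\<bar>u t\<bar> \<le> cmod (mob z (\<gamma> t))" for t
    using abs_Re_le_cmod[of "e * mob z (\<gamma> t)"] e1 by (simp add: u_def norm_mult)
  have mlt: "cmod (mob z (\<gamma> t)) < 1" if "t \<in> {0..1}" for t
    using Moebius_function_norm_lt_1[OF z \<gamma>1[OF that]] .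
  have u1: "\<bar>u t\<bar> < 1" if "t \<in> {0..1}" for t using ule mlt[OF that] by (rule le_less_trans)
  define D where "D = (\<lambda>t. of_real (1 - (cmod z)\<^sup>2) / (1 - cnj z * \<gamma> t)\<^sup>2)"
  \<comment> \<open>At the end points and on the exceptional set \<open>S\<close> the value 0 is
    harmless: it stays below the nonnegative integrand.\<close>
  define G' where "G' = (\<lambda>t. if t \<in> {0<..<1} - S then
      1 / (1 - (u t)\<^sup>2) * Re (e * (D t * vector_derivative \<gamma> (at t))) else 0)"
  have cont: "continuous_on {0..1} G"
  proof -
    have "continuous_on unit_disc (mob z)"
      using Moebius_function_holomorphic[OF z] holomorphic_on_imp_continuous_on by blast
    then have "continuous_on {0..1} (\<lambda>t. mob z (\<gamma> t))"
      by (rule continuous_on_compose2[OF _ S(3)]) (use \<gamma>1 in auto)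
    then have "continuous_on {0..1} u" unfolding u_def by (intro continuous_intros)
    then show ?thesis unfolding G_def
      by (rule continuous_on_artanh') (use u1 in \<open>auto simp: abs_less_iff\<close>)
  qed
  have dG: "(G has_vector_derivative G' t) (at t)" if t: "t \<in> {0<..<1} - S" for t
  proof -
    have t01: "t \<in> {0..1} - S" "t \<in> {0..1}" using t by auto
    have "((mob z \<circ> \<gamma>) has_vector_derivative (vector_derivative \<gamma> (at t) * D t)) (at t)"
      unfolding D_def
      by (intro field_vector_diff_chain_at d\<gamma>[OF t01(1)] mob_has_derivative[OF z \<gamma>1[OF t01(2)]])
    then have "((\<lambda>t. mob z (\<gamma> t)) has_vector_derivative (D t * vector_derivative \<gamma> (at t))) (at t)"
      by (simp add: o_def mult.commute)
    then have "((\<lambda>t. e * mob z (\<gamma> t)) has_vector_derivative (e * (D t * vector_derivative \<gamma> (at t)))) (at t)"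
      by (rule has_vector_derivative_mult_right)
    then have "(u has_field_derivative Re (e * (D t * vector_derivative \<gamma> (at t)))) (at t)"
      unfolding u_def has_vector_derivative_complex_iff by blast
    then have "(G has_field_derivative 1 / (1 - (u t)\<^sup>2) * Re (e * (D t * vector_derivative \<gamma> (at t)))) (at t)"
      unfolding G_def
      by (rule DERIV_chain2[where g = u and x = t, OF artanh_real_has_field_derivative[OF u1[OF t01(2)]]])
    then show ?thesis using t by (simp add: G'_def has_real_derivative_iff_has_vector_derivative)
  qed
  have I: "(G' has_integral (G 1 - G 0)) {0..1}"
    by (rule fundamental_theorem_of_calculus_interior_strong[OF S(1) _ dG cont]) auto
  have "G 1 - G 0 \<le> l"
  proof (rule has_integral_le[OF I l])
    fix t :: real assume t: "t \<in> {0..1}"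
    have q: "0 < 1 - (cmod (\<gamma> t))\<^sup>2" using \<gamma>1[OF t] by (simp add: abs_square_less_1)
    have m: "0 < 1 - (cmod (mob z (\<gamma> t)))\<^sup>2" using mlt[OF t] by (simp add: abs_square_less_1)
    show "G' t \<le> hyperbolic_metric unit_disc (\<gamma> t) (vector_derivative \<gamma> (at t))"
    proof (cases "t \<in> {0<..<1} - S")
      case True
      have "1 - (cmod (mob z (\<gamma> t)))\<^sup>2 \<le> 1 - (u t)\<^sup>2"
        using power_mono[OF ule[of t] abs_ge_zero, of 2] by simp
      moreover have "Re (e * (D t * vector_derivative \<gamma> (at t))) \<le> cmod (D t) * cmod (vector_derivative \<gamma> (at t))"
        using complex_Re_le_cmod[of "e * (D t * vector_derivative \<gamma> (at t))"] e1 by (simp add: norm_mult)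
      ultimately have "Re (e * (D t * vector_derivative \<gamma> (at t))) / (1 - (u t)\<^sup>2)
         \<le> cmod (D t) * cmod (vector_derivative \<gamma> (at t)) / (1 - (cmod (mob z (\<gamma> t)))\<^sup>2)"
        using m by (intro frac_le) auto
      also have "\<dots> = cmod (vector_derivative \<gamma> (at t)) * (cmod (D t) / (1 - (cmod (mob z (\<gamma> t)))\<^sup>2))"
        by simp
      also have "\<dots> = cmod (vector_derivative \<gamma> (at t)) * (1 / (1 - (cmod (\<gamma> t))\<^sup>2))"
        unfolding D_def mob_metric_invariant[OF z \<gamma>1[OF t]] ..
      finally show ?thesis using True by (simp add: G'_def hyperbolic_metric_disc[OF \<gamma>1[OF t]])
    next
      case False
      then show ?thesis using q by (auto simp: G'_def hyperbolic_metric_disc[OF \<gamma>1[OF t]])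
    qed
  qed
  moreover have "G 0 = 0" using \<gamma>(3) by (simp add: G_def u_def pathstart_def Moebius_function_eq_zero)
  moreover have "G 1 = artanh (cmod (mob z w))" 
    using \<gamma>(4) unfolding G_def u_def pathfinish_def by (simp only: ew Re_complex_of_real)
  ultimately show ?thesis by simp
qed

text \<open>The segment from 0 to \<open>mob z w\<close>, moved by the isometry
  \<open>mob (- z)\<close>: its length is exactly the lower bound for all paths, so the infimum in
  \<open>hyperbolic_dist\<close> is a minimum.\<close>

lemma ex_disc_geodesic:
  assumes z: "cmod z < 1" and w: "cmod w < 1"
  shows "\<exists>\<gamma>. valid_path \<gamma> \<and> path_image \<gamma> \<subseteq> unit_disc \<and> pathstart \<gamma> = z \<and> pathfinish \<gamma> = w \<and>
     ((\<lambda>t. hyperbolic_metric unit_disc (\<gamma> t) (vector_derivative \<gamma> (at t))) has_integral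
       artanh (cmod (mob z w))) {0..1}"
proof -
  define m where "m = mob z w"
  have m1: "cmod m < 1" unfolding m_def by (rule Moebius_function_norm_lt_1[OF z w])
  have mz: "cmod (- z) < 1" using z by simp
  define \<gamma> where "\<gamma> = mob (- z) \<circ> linepath 0 m"
  have lp: "linepath 0 m t = t *\<^sub>R m" for t by (simp add: linepath_def)
  have nm: "cmod (t *\<^sub>R m) = t * cmod m" if "t \<in> {0..1}" for t using that by simp
  have lin: "cmod (t *\<^sub>R m) < 1" if "t \<in> {0..1}" for t
    using that m1 by (simp add: nm) (meson mult_left_le_one_le norm_ge_zero order_le_less_trans)
  have img: "path_image (linepath 0 m) \<subseteq> unit_disc"
    using lin by (auto simp: path_image_def lp simp del: norm_scaleR)
  have "valid_path \<gamma>"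
    unfolding \<gamma>_def
    by (rule valid_path_compose_holomorphic[OF _ Moebius_function_holomorphic[OF mz] _ img]) auto
  moreover have "path_image \<gamma> \<subseteq> unit_disc"
    unfolding \<gamma>_def path_image_compose using img mob_in_disc[OF mz] by blast
  moreover have "pathstart \<gamma> = z"
    by (simp add: \<gamma>_def pathstart_compose Moebius_function_of_zero)
  moreover have "pathfinish \<gamma> = w"
    unfolding \<gamma>_def pathfinish_compose m_def using Moebius_function_compose[of "- z" z w] z w by simp
  moreover have "((\<lambda>t. hyperbolic_metric unit_disc (\<gamma> t) (vector_derivative \<gamma> (at t))) has_integral
       artanh (1 * cmod m) - artanh (0 * cmod m)) {0..1}"
  proof (rule fundamental_theorem_of_calculus)
    fix t :: real assume t: "t \<in> {0..1}"
    define D where "D = of_real (1 - (cmod (- z))\<^sup>2) / (1 - cnj (- z) * (t *\<^sub>R m))\<^sup>2"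
    have "(linepath 0 m has_vector_derivative m) (at t)"
      using has_vector_derivative_linepath_within[of 0 m t UNIV] by simp
    moreover have "(mob (- z) has_field_derivative D) (at (linepath 0 m t))"
      unfolding D_def lp by (rule mob_has_derivative[OF mz lin[OF t]])
    ultimately have "(\<gamma> has_vector_derivative m * D) (at t)"
      unfolding \<gamma>_def by (rule field_vector_diff_chain_at)
    then have vd: "vector_derivative \<gamma> (at t) = m * D" by (rule vector_derivative_at)
    have \<gamma>t: "\<gamma> t = mob (- z) (t *\<^sub>R m)" by (simp add: \<gamma>_def lp)
    have "hyperbolic_metric unit_disc (\<gamma> t) (vector_derivative \<gamma> (at t)) =
        cmod m * (cmod D / (1 - (cmod (mob (- z) (t *\<^sub>R m)))\<^sup>2))"
      unfolding \<gamma>t vd hyperbolic_metric_disc[OF Moebius_function_norm_lt_1[OF mz lin[OF t]]]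
      by (simp add: norm_mult)
    also have "\<dots> = cmod m * (1 / (1 - (cmod (t *\<^sub>R m))\<^sup>2))"
      unfolding D_def mob_metric_invariant[OF mz lin[OF t]] ..
    also have "\<dots> = 1 / (1 - (t * cmod m)\<^sup>2) * cmod m" by (simp only: nm[OF t]) simp
    finally have eq: "hyperbolic_metric unit_disc (\<gamma> t) (vector_derivative \<gamma> (at t)) = 1 / (1 - (t * cmod m)\<^sup>2) * cmod m" .
    have a: "\<bar>t * cmod m\<bar> < 1" using lin[OF t] t unfolding nm[OF t] by simp
    have "((\<lambda>t. t * cmod m) has_field_derivative cmod m) (at t within {0..1})"
      by (auto intro!: derivative_eq_intros)
    from DERIV_chain2[where g = "\<lambda>t. t * cmod m" and x = t, OF artanh_real_has_field_derivative[OF a] this]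
    show "((\<lambda>t. artanh (t * cmod m)) has_vector_derivative
        hyperbolic_metric unit_disc (\<gamma> t) (vector_derivative \<gamma> (at t))) (at t within {0..1})"
      unfolding eq by (simp add: has_real_derivative_iff_has_vector_derivative)
  qed simp
  ultimately show ?thesis by (intro exI[of _ \<gamma>]) (simp add: m_def)
qed

lemma hyperbolic_dist_disc:
  assumes z: "cmod z < 1" and w: "cmod w < 1"
  shows "hyperbolic_dist unit_disc z w = artanh (cmod (mob z w))"
  unfolding hyperbolic_dist_def
  by (rule cInf_eq_minimum) (use ex_disc_geodesic[OF assms] norm_mob_le_length[OF z] in \<open>blast+\<close>)

section \<open>Orbits in the right half plane\<close>

definition cayley :: "complex \<Rightarrow> complex \<Rightarrow> complex" where
  "cayley \<tau> z = (1 + cnj \<tau> * z) / (1 - cnj \<tau> * z)"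

definition inv_cayley :: "complex \<Rightarrow> complex \<Rightarrow> complex" where
  "inv_cayley \<tau> w = \<tau> * (w - 1) / (w + 1)"

lemma rhp_add_1: "w \<in> rhp \<Longrightarrow> w + 1 \<noteq> 0"
  by (auto simp: complex_eq_iff)

context
  fixes \<tau> :: complex
  assumes \<tau>: "cmod \<tau> = 1"
begin

lemma cnj_unit: "cnj \<tau> * \<tau> = 1"
  using \<tau> by (simp add: mult.commute[of "cnj \<tau>"] flip: complex_norm_square)

lemma cayley_denom: "cmod z < 1 \<Longrightarrow> 1 - cnj \<tau> * z \<noteq> 0"
  using \<tau> by (metis complex_mod_cnj less_irrefl mult_1 norm_mult norm_one right_minus_eq)

lemma cayley_in: "cmod z < 1 \<Longrightarrow> cayley \<tau> z \<in> rhp"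
proof -
  assume z: "cmod z < 1"
  have "cayley \<tau> z = to_rhp 1 (cnj \<tau> * z)" by (simp add: cayley_def to_rhp_def)
  moreover have "cmod (cnj \<tau> * z) < 1" using z \<tau> by (simp add: norm_mult)
  ultimately show ?thesis using to_rhp_in[of 1 "cnj \<tau> * z"] by simp
qed

lemma one_minus_eq_cayley: "cmod z < 1 \<Longrightarrow> 1 - cnj \<tau> * z = 2 / (cayley \<tau> z + 1)"
  using cayley_denom[of z] by (simp add: cayley_def field_simps)

lemma inv_cayley_cayley: "cmod z < 1 \<Longrightarrow> inv_cayley \<tau> (cayley \<tau> z) = z"
proof -
  assume z: "cmod z < 1"
  have d: "1 - cnj \<tau> * z \<noteq> 0" by (rule cayley_denom[OF z])
  have "cayley \<tau> z - 1 = 2 * cnj \<tau> * z / (1 - cnj \<tau> * z)" "cayley \<tau> z + 1 = 2 / (1 - cnj \<tau> * z)"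
    using d by (simp_all add: cayley_def field_simps)
  then have "inv_cayley \<tau> (cayley \<tau> z) = \<tau> * (2 * cnj \<tau> * z / (1 - cnj \<tau> * z)) / (2 / (1 - cnj \<tau> * z))"
    by (simp only: inv_cayley_def)
  also have "\<dots> = (cnj \<tau> * \<tau>) * z" using d by (simp add: field_simps)
  finally show ?thesis by (simp add: cnj_unit)
qed

lemma cayley_inv_cayley: "w \<in> rhp \<Longrightarrow> cayley \<tau> (inv_cayley \<tau> w) = w"
proof -
  assume w: "w \<in> rhp"
  have e: "cnj \<tau> * inv_cayley \<tau> w = (w - 1) / (w + 1)"
    using cnj_unit by (simp add: inv_cayley_def mult.assoc[symmetric])
  have "1 + (w - 1) / (w + 1) = 2 * w / (w + 1)" "1 - (w - 1) / (w + 1) = 2 / (w + 1)"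
    using rhp_add_1[OF w] by (simp_all add: field_simps)
  then show ?thesis unfolding cayley_def e using rhp_add_1[OF w] by simp
qed

lemma inv_cayley_in: "w \<in> rhp \<Longrightarrow> cmod (inv_cayley \<tau> w) < 1"
  using to_rhp_surj(1)[of w 1] \<tau> by (simp add: inv_cayley_def norm_mult norm_divide)

lemma cayley_holomorphic: "cayley \<tau> holomorphic_on unit_disc"
  unfolding cayley_def using cayley_denom by (intro holomorphic_intros) auto

lemma inv_cayley_holomorphic: "inv_cayley \<tau> holomorphic_on rhp"
  unfolding inv_cayley_def using rhp_add_1 by (intro holomorphic_intros) auto

lemma norm_mob_cayley:
  assumes "cmod z < 1" "cmod w < 1"
  shows "cmod (mob z w) = cmod (cayley \<tau> w - cayley \<tau> z) / cmod (cayley \<tau> w + cnj (cayley \<tau> z))"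
proof -
  define a where "a = cnj \<tau> * z"
  define b where "b = cnj \<tau> * w"
  have n: "1 - a \<noteq> 0" "1 - b \<noteq> 0"
    using cayley_denom[OF assms(1)] cayley_denom[OF assms(2)] by (simp_all only: a_def b_def not_False_eq_True)
  have "1 - cnj a = cnj (1 - a)" by simp
  then have n': "1 - cnj a \<noteq> 0" using n(1) by (simp only: complex_cnj_zero_iff not_False_eq_True)
  have "cayley \<tau> w - cayley \<tau> z = 2 * (b - a) / ((1 - b) * (1 - a))"
  proof -
    have "(1 + b) / (1 - b) - (1 + a) / (1 - a) = ((1 + b) * (1 - a) - (1 + a) * (1 - b)) / ((1 - b) * (1 - a))"
      by (rule diff_frac_eq[OF n(2,1)])
    also have "(1 + b) * (1 - a) - (1 + a) * (1 - b) = 2 * (b - a)" by (simp add: algebra_simps)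
    finally show ?thesis by (simp only: cayley_def a_def b_def)
  qed
  moreover have "cayley \<tau> w + cnj (cayley \<tau> z) = 2 * (1 - cnj a * b) / ((1 - b) * (1 - cnj a))"
  proof -
    have "(1 + b) / (1 - b) + (1 + cnj a) / (1 - cnj a) =
        ((1 + b) * (1 - cnj a) + (1 + cnj a) * (1 - b)) / ((1 - b) * (1 - cnj a))"
      by (rule add_frac_eq[OF n(2) n'])
    also have "(1 + b) * (1 - cnj a) + (1 + cnj a) * (1 - b) = 2 * (1 - cnj a * b)" by (simp add: algebra_simps)
    moreover have "cnj (cayley \<tau> z) = (1 + cnj a) / (1 - cnj a)" by (simp add: cayley_def a_def)
    moreover have "cayley \<tau> w = (1 + b) / (1 - b)" by (simp add: cayley_def b_def)
    ultimately show ?thesis by simp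
  qed
  moreover have "cmod (1 - cnj a) = cmod (1 - a)"
    by (metis complex_cnj_diff complex_cnj_one complex_mod_cnj)
  moreover have "cmod (2 * u / (p * q)) / cmod (2 * v / (p * q')) = cmod u / cmod v"
    if "p \<noteq> 0" "q \<noteq> 0" "cmod q' = cmod q" for u v p q q'
    using that by (simp add: norm_mult norm_divide)
  ultimately have "cmod (cayley \<tau> w - cayley \<tau> z) / cmod (cayley \<tau> w + cnj (cayley \<tau> z)) =
      cmod (b - a) / cmod (1 - cnj a * b)"
    using n by metis
  moreover have "cnj a * b = (cnj \<tau> * \<tau>) * (cnj z * w)" by (simp add: a_def b_def mult_ac)
  moreover have "b - a = cnj \<tau> * (w - z)" by (simp add: a_def b_def algebra_simps)
  ultimately show ?thesis using \<tau> by (simp add: cnj_unit Moebius_function_simple norm_divide norm_mult)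
qed

text \<open>The exact distance is half the logarithm of
  \<open>(S + \<Delta>)^2 / (4 * (Re a * Re b))\<close>, and \<open>\<Delta> < S\<close> puts
  \<open>S + \<Delta>\<close> between \<open>S\<close> and \<open>2 * S\<close>. The third bound
  solves \<open>\<Delta> \<le> tanh B * (\<Delta> + 2 * Re a)\<close> for \<open>\<Delta>\<close>;
  it refers to \<open>Re a\<close> alone, which suits the step condition of
  \<open>receding_chain\<close>.\<close>

lemma hyperbolic_dist_cayley:
  assumes z: "cmod z < 1" and w: "cmod w < 1"
  defines "a \<equiv> cayley \<tau> z" and "b \<equiv> cayley \<tau> w"
  shows "hyperbolic_dist unit_disc z w \<le> ln ((cmod (b + cnj a))\<^sup>2 / (Re a * Re b)) / 2" (is ?upper)
    and "ln ((cmod (b + cnj a))\<^sup>2 / (4 * (Re a * Re b))) / 2 \<le> hyperbolic_dist unit_disc z w" (is ?lower)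
    and "hyperbolic_dist unit_disc z w \<le> B \<Longrightarrow> cmod (b - a) \<le> 2 * tanh B / (1 - tanh B) * Re a" (is "_ \<Longrightarrow> ?near")
proof -
  have ab: "a \<in> rhp" "b \<in> rhp" using cayley_in z w by (auto simp: a_def b_def)
  define \<Delta> where "\<Delta> = cmod (b - a)"
  define S where "S = cmod (b + cnj a)"
  define \<rho> where "\<rho> = \<Delta> / S"
  have hd: "hyperbolic_dist unit_disc z w = artanh \<rho>"
    unfolding hyperbolic_dist_disc[OF z w] norm_mob_cayley[OF z w] \<rho>_def \<Delta>_def S_def a_def b_def ..
  have S2: "S\<^sup>2 = \<Delta>\<^sup>2 + 4 * (Re a * Re b)"
    unfolding S_def \<Delta>_def norm_add_cnj_sq by (simp add: mult.commute)
  have p: "0 < Re a * Re b" using ab by simp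
  have D0: "0 \<le> \<Delta>" "0 \<le> S" by (simp_all add: \<Delta>_def S_def)
  have "\<Delta>\<^sup>2 < S\<^sup>2" using S2 p by simp
  then have DS: "\<Delta> < S" using D0 by (simp add: power2_less_imp_less)
  then have Sp: "0 < S" using D0 by simp
  have \<rho>: "0 \<le> \<rho>" "\<rho> < 1" using D0 DS by (auto simp: \<rho>_def)
  have "(1 + \<rho>) / (1 - \<rho>) = (S + \<Delta>) / (S - \<Delta>)" using Sp DS by (simp add: \<rho>_def field_simps)
  also have "\<dots> = (S + \<Delta>)\<^sup>2 / ((S - \<Delta>) * (S + \<Delta>))" using DS D0 by (simp add: power2_eq_square)
  also have "(S - \<Delta>) * (S + \<Delta>) = 4 * (Re a * Re b)" using S2 by (simp add: power2_eq_square algebra_simps)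
  finally have q: "(1 + \<rho>) / (1 - \<rho>) = (S + \<Delta>)\<^sup>2 / (4 * (Re a * Re b))" .
  have art: "hyperbolic_dist unit_disc z w = ln ((S + \<Delta>)\<^sup>2 / (4 * (Re a * Re b))) / 2"
    unfolding hd q[symmetric] artanh_def ..
  have "(S + \<Delta>)\<^sup>2 \<le> (2 * S)\<^sup>2" using DS D0 by (intro power_mono) auto
  then have "(S + \<Delta>)\<^sup>2 / (4 * (Re a * Re b)) \<le> (2 * S)\<^sup>2 / (4 * (Re a * Re b))"
    using p by (intro divide_right_mono) auto
  also have "\<dots> = S\<^sup>2 / (Re a * Re b)" by (simp add: power_mult_distrib)
  finally have "(S + \<Delta>)\<^sup>2 / (4 * (Re a * Re b)) \<le> S\<^sup>2 / (Re a * Re b)" .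
  moreover have pos: "0 < (S + \<Delta>)\<^sup>2 / (4 * (Re a * Re b))" "0 < S\<^sup>2 / (4 * (Re a * Re b))"
    using p Sp D0 by (auto intro!: divide_pos_pos zero_less_power)
  ultimately show ?upper unfolding art S_def[symmetric] by (simp add: ln_mono)
  have "S\<^sup>2 \<le> (S + \<Delta>)\<^sup>2" using D0 by (intro power_mono) auto
  then have "S\<^sup>2 / (4 * (Re a * Re b)) \<le> (S + \<Delta>)\<^sup>2 / (4 * (Re a * Re b))"
    using p by (intro divide_right_mono) auto
  then show ?lower unfolding art S_def[symmetric] using pos by (simp add: ln_mono)
  assume B: "hyperbolic_dist unit_disc z w \<le> B"
  then have "tanh (artanh \<rho>) \<le> tanh B" unfolding hd by simp
  then have t: "\<rho> \<le> tanh B" using tanh_artanh_real[of \<rho>] \<rho> by simp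
  have t1: "tanh B < 1" by (rule tanh_real_lt_1)
  have "\<Delta> = \<rho> * S" using Sp by (simp add: \<rho>_def)
  also have "\<dots> \<le> tanh B * (\<Delta> + 2 * Re a)"
    using order_trans[OF \<rho>(1) t] norm_add_cnj_le[OF ab(1), of b] D0
    by (intro mult_mono[OF t]) (simp_all only: S_def \<Delta>_def)
  finally have "(1 - tanh B) * \<Delta> \<le> 2 * tanh B * Re a" by (simp add: algebra_simps)
  then have "\<Delta> \<le> 2 * tanh B * Re a / (1 - tanh B)" using t1 by (simp add: pos_le_divide_eq mult.commute)
  then show ?near by (simp add: \<Delta>_def)
qed

end

section \<open>The semigroup as upward translation of the Koenigs domain\<close>

lemma koenigs_starlike_domain:
  assumes ne: "nonelliptic_semigroup \<phi> \<tau>" and k: "koenigs_function \<phi> h"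
  obtains f g where "starlike_domain (h ` unit_disc) f g"
    "\<And>z t. z \<in> unit_disc \<Longrightarrow> 0 \<le> t \<Longrightarrow> g (h z + \<i> * of_real t) = cayley \<tau> (\<phi> t z)"
proof -
  have \<tau>: "cmod \<tau> = 1" using ne by (simp add: nonelliptic_semigroup_def)
  have \<phi>: "\<phi> t z \<in> unit_disc" if "0 \<le> t" "z \<in> unit_disc" for t z
  proof -
    have "\<phi> t ` unit_disc \<subseteq> unit_disc"
      using ne that(1) unfolding nonelliptic_semigroup_def disc_semigroup_def by simp
    then show ?thesis using that(2) by blast
  qed
  have h: "h holomorphic_on unit_disc" "inj_on h unit_disc"
    "\<And>t z. 0 \<le> t \<Longrightarrow> z \<in> unit_disc \<Longrightarrow> h (\<phi> t z) = h z + \<i> * of_real t"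
    using k by (auto simp: koenigs_function_def)
  obtain H where H: "H holomorphic_on h ` unit_disc" "\<And>z. z \<in> unit_disc \<Longrightarrow> H (h z) = z"
    using holomorphic_has_inverse[OF h(1) open_ball h(2)] by metis
  define f where "f = h \<circ> inv_cayley \<tau>"
  define g where "g = cayley \<tau> \<circ> H"
  have gh: "g (h z) = cayley \<tau> z" if "z \<in> unit_disc" for z using H(2)[OF that] by (simp add: g_def)
  have orb: "g (h z + \<i> * of_real t) = cayley \<tau> (\<phi> t z)" if "z \<in> unit_disc" "0 \<le> t" for z t
    unfolding h(3)[OF that(2,1), symmetric] by (rule gh[OF \<phi>[OF that(2,1)]])
  have "starlike_domain (h ` unit_disc) f g"
  proof
    show "open (h ` unit_disc)" by (rule open_mapping_thm3[OF h(1) _ h(2)]) simp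
    show "f holomorphic_on rhp"
      unfolding f_def using inv_cayley_in[OF \<tau>]
      by (intro holomorphic_on_compose_gen[OF inv_cayley_holomorphic h(1)]) (auto simp: \<tau>)
    show "g holomorphic_on h ` unit_disc"
      unfolding g_def using H(2)
      by (intro holomorphic_on_compose_gen[OF H(1) cayley_holomorphic[OF \<tau>]]) force
    show "f w \<in> h ` unit_disc" "g (f w) = w" if "w \<in> rhp" for w
      using inv_cayley_in[OF \<tau> that] cayley_inv_cayley[OF \<tau> that] gh[of "inv_cayley \<tau> w"]
      by (auto simp: f_def)
    fix v assume "v \<in> h ` unit_disc"
    then obtain z where z: "z \<in> unit_disc" "v = h z" by blast
    show "g v \<in> rhp" unfolding z(2) gh[OF z(1)] using cayley_in[OF \<tau>] z(1) by simp
    show "f (g v) = v" unfolding z(2) gh[OF z(1)] using inv_cayley_cayley[OF \<tau>] z(1) by (simp add: f_def)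
    show "v + \<i> * of_real t \<in> h ` unit_disc" if "0 \<le> t" for t
      using \<phi>[OF that z(1)] h(3)[OF that z(1)] z(2) by (metis imageI)
    have "\<forall>K. compact K \<and> K \<subseteq> unit_disc \<longrightarrow> uniform_limit K \<phi> (\<lambda>_. \<tau>) at_top"
      using ne by (simp add: nonelliptic_semigroup_def)
    from spec[OF this, of "{z}"] have "uniform_limit {z} \<phi> (\<lambda>_. \<tau>) at_top" using z(1) by simp
    then have "((\<lambda>t. \<phi> t z) \<longlongrightarrow> \<tau>) at_top" by simp
    then have lim: "((\<lambda>t. 1 - cnj \<tau> * \<phi> t z) \<longlongrightarrow> 1 - cnj \<tau> * \<tau>) at_top"
       "((\<lambda>t. 1 + cnj \<tau> * \<phi> t z) \<longlongrightarrow> 1 + cnj \<tau> * \<tau>) at_top"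
      by (intro tendsto_intros; assumption)+
    have "\<forall>\<^sub>F t in at_top. 1 - cnj \<tau> * \<phi> t z \<noteq> 0"
      using eventually_ge_at_top[of 0] by eventually_elim (use cayley_denom[OF \<tau>] \<phi> z in auto)
    then have "filterlim (\<lambda>t. 1 - cnj \<tau> * \<phi> t z) (at 0) at_top"
      using lim(1) by (simp add: filterlim_at cnj_unit[OF \<tau>])
    then have "filterlim (\<lambda>t. inverse (1 - cnj \<tau> * \<phi> t z)) at_infinity at_top"
      by (rule filterlim_compose[OF filterlim_inverse_at_infinity])
    then have "filterlim (\<lambda>t. (1 + cnj \<tau> * \<phi> t z) * inverse (1 - cnj \<tau> * \<phi> t z)) at_infinity at_top"
      by (intro tendsto_mult_filterlim_at_infinity[OF lim(2)]) (auto simp: cnj_unit[OF \<tau>])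
    then have "filterlim (\<lambda>t. cayley \<tau> (\<phi> t z)) at_infinity at_top"
      by (simp add: cayley_def divide_inverse)
    moreover have "\<forall>\<^sub>F t in at_top. cayley \<tau> (\<phi> t z) = g (v + \<i> * of_real t)"
      using eventually_ge_at_top[of 0] by eventually_elim (simp add: z(2) orb[OF z(1)])
    ultimately show "filterlim (\<lambda>t. g (v + \<i> * of_real t)) at_infinity at_top"
      by (rule filterlim_mono_eventually[OF _ order_refl order_refl])
  qed
  then show ?thesis using that orb by blast
qed

lemma bounded_ratio_if_eventually:
  fixes W :: "real \<Rightarrow> complex"
  assumes cont: "continuous_on {0..} W" and pos: "\<And>t. 0 \<le> t \<Longrightarrow> 0 < Re (W t)"
    and ev: "\<And>t. T \<le> t \<Longrightarrow> cmod (W t) \<le> K * Re (W t)"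
  shows "\<exists>K. \<forall>t\<ge>0. cmod (W t) \<le> K * Re (W t)"
proof -
  have "continuous_on {0..T} (\<lambda>t. cmod (W t) / Re (W t))"
    using pos by (intro continuous_intros continuous_on_subset[OF cont]) force+
  then have "compact ((\<lambda>t. cmod (W t) / Re (W t)) ` {0..T})"
    by (rule compact_continuous_image) simp
  then obtain B where "0 < B" "\<forall>r\<in>(\<lambda>t. cmod (W t) / Re (W t)) ` {0..T}. norm r \<le> B"
    using compact_imp_bounded bounded_pos by metis
  then have B: "\<bar>cmod (W t) / Re (W t)\<bar> \<le> B" if "0 \<le> t" "t \<le> T" for t using that by auto
  have "cmod (W t) \<le> max B K * Re (W t)" if t: "0 \<le> t" for t
  proof (cases "t \<le> T")
    case True
    then have "cmod (W t) \<le> B * Re (W t)"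
      using B[OF t True] pos[OF t] by (simp add: abs_le_iff divide_le_eq)
    also have "\<dots> \<le> max B K * Re (W t)" using pos[OF t] by (intro mult_right_mono) auto
    finally show ?thesis .
  next
    case False
    then have "cmod (W t) \<le> K * Re (W t)" by (intro ev) simp
    also have "\<dots> \<le> max B K * Re (W t)" using pos[OF t] by (intro mult_right_mono) auto
    finally show ?thesis .
  qed
  then show ?thesis by blast
qed

text \<open>Everything follows from \<open>cos (Arg (\<xi> t)) = (Re (W t) + 1) / |W t + 1|\<close>.
  A bounded ratio keeps this cosine away from 0. If the ratio is unbounded even for large
  \<open>t\<close>, the cosine tends to 0 along a sequence of times tending to infinity, and by
  compactness some angles converge there to a cluster point with vanishing cosine.\<close>

lemma cluster_Arg_iff_bounded_ratio:
  fixes W \<xi> :: "real \<Rightarrow> complex"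
  assumes cont: "continuous_on {0..} W" and pos: "\<And>t. 0 \<le> t \<Longrightarrow> 0 < Re (W t)"
    and inf: "filterlim W at_infinity at_top" and \<xi>: "\<And>t. 0 \<le> t \<Longrightarrow> \<xi> t = 2 / (W t + 1)"
  shows "cluster_set_at_top (\<lambda>t. Arg (\<xi> t)) \<subseteq> {- pi / 2 <..< pi / 2} \<longleftrightarrow>
    (\<exists>K. \<forall>t\<ge>0. cmod (W t) \<le> K * Re (W t))"
proof -
  have cosA: "cos (Arg (\<xi> t)) = (Re (W t) + 1) / cmod (W t + 1)" if "0 \<le> t" for t
  proof -
    have n: "W t + 1 \<noteq> 0" using pos[OF that] by (auto simp: complex_eq_iff)
    have "Re (\<xi> t) = 2 * (Re (W t) + 1) / (cmod (W t + 1))\<^sup>2"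
      unfolding \<xi>[OF that] by (simp add: Re_divide cmod_power2)
    moreover have "cmod (\<xi> t) = 2 / cmod (W t + 1)" by (simp add: \<xi>[OF that] norm_divide)
    moreover have "\<xi> t \<noteq> 0" using n by (simp add: \<xi>[OF that])
    moreover have "2 * (r + 1) / m\<^sup>2 / (2 / m) = (r + 1) / m" if "m \<noteq> 0" for r m :: real
      using that by (simp add: field_simps power2_eq_square)
    ultimately show ?thesis using n cos_Arg[of "\<xi> t"] by (metis norm_eq_zero)
  qed
  have Ab: "\<bar>Arg (\<xi> t)\<bar> < pi / 2" if "0 \<le> t" for t
  proof -
    have n: "W t + 1 \<noteq> 0" using pos[OF that] by (auto simp: complex_eq_iff)
    then have "\<xi> t \<noteq> 0" by (simp add: \<xi>[OF that])
    moreover have "0 < Re (\<xi> t)"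
      unfolding \<xi>[OF that] using pos[OF that] n
      by (auto simp: Re_divide intro!: divide_pos_pos add_pos_nonneg)
    ultimately show ?thesis using Arg_eq_Im_Ln Re_Ln_pos_lt by metis
  qed
  show ?thesis
  proof
    assume "\<exists>K. \<forall>t\<ge>0. cmod (W t) \<le> K * Re (W t)"
    then obtain K where K: "\<And>t. 0 \<le> t \<Longrightarrow> cmod (W t) \<le> K * Re (W t)" by blast
    define K' where "K' = max K 1"
    have K': "1 \<le> K'" by (simp add: K'_def)
    have low: "1 / K' \<le> cos (Arg (\<xi> t))" if "0 \<le> t" for t
    proof -
      have "cmod (W t + 1) \<le> cmod (W t) + 1" using norm_triangle_ineq[of "W t" 1] by simp
      also have "\<dots> \<le> K * Re (W t) + 1" using K[OF that] by simp
      also have "\<dots> \<le> K' * Re (W t) + K'"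
        using pos[OF that] K' by (intro add_mono mult_right_mono) (auto simp: K'_def)
      finally have "cmod (W t + 1) \<le> K' * (Re (W t) + 1)" by (simp add: algebra_simps)
      moreover have "0 < cmod (W t + 1)" using pos[OF that] by (auto simp: complex_eq_iff)
      ultimately show ?thesis unfolding cosA[OF that] using K' by (simp add: field_simps)
    qed
    show "cluster_set_at_top (\<lambda>t. Arg (\<xi> t)) \<subseteq> {- pi / 2 <..< pi / 2}"
    proof
      fix l assume "l \<in> cluster_set_at_top (\<lambda>t. Arg (\<xi> t))"
      then obtain s :: "nat \<Rightarrow> real" where s: "filterlim s at_top sequentially" "(\<lambda>n. Arg (\<xi> (s n))) \<longlonglongrightarrow> l"
        by (auto simp: cluster_set_at_top_def)
      have ev: "\<forall>\<^sub>F n in sequentially. 0 \<le> s n" using s(1) by (simp add: filterlim_at_top)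
      have "(\<lambda>n. cos (Arg (\<xi> (s n)))) \<longlonglongrightarrow> cos l" by (intro tendsto_intros s)
      then have "1 / K' \<le> cos l"
        by (rule tendsto_lowerbound) (use ev low in \<open>auto elim: eventually_mono\<close>)
      then have c: "0 < cos l" using K' by (smt (verit) zero_less_divide_1_iff)
      have "(\<lambda>n. \<bar>Arg (\<xi> (s n))\<bar>) \<longlonglongrightarrow> \<bar>l\<bar>" by (intro tendsto_intros s)
      then have "\<bar>l\<bar> \<le> pi / 2"
        by (rule tendsto_upperbound) (use ev Ab in \<open>auto elim!: eventually_mono intro: less_imp_le\<close>)
      moreover have "\<bar>l\<bar> \<noteq> pi / 2" using c cos_abs_real[of l] cos_pi_half by (metis less_irrefl)
      ultimately show "l \<in> {- pi / 2 <..< pi / 2}" by (auto simp: abs_if split: if_splits)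
    qed
  next
    assume cl: "cluster_set_at_top (\<lambda>t. Arg (\<xi> t)) \<subseteq> {- pi / 2 <..< pi / 2}"
    show "\<exists>K. \<forall>t\<ge>0. cmod (W t) \<le> K * Re (W t)"
    proof (rule ccontr)
      assume no: "\<not> ?thesis"
      have "\<exists>t\<ge>real n. real n * Re (W t) < cmod (W t)" for n
        using bounded_ratio_if_eventually[OF cont pos, of "real n" "real n"] no by (meson not_le)
      then obtain s where s: "\<And>n. real n \<le> s n" "\<And>n. real n * Re (W (s n)) < cmod (W (s n))"
        by metis
      have s0: "0 \<le> s n" for n using s(1)[of n] by linarith
      have slim: "filterlim s at_top sequentially"
        by (rule filterlim_at_top_mono[OF filterlim_real_sequentially]) (use s(1) in auto)
      have "seq_compact {- (pi / 2)..pi / 2}" by (simp add: compact_imp_seq_compact)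
      moreover have "\<forall>n. Arg (\<xi> (s n)) \<in> {- (pi / 2)..pi / 2}"
      proof
        fix n show "Arg (\<xi> (s n)) \<in> {- (pi / 2)..pi / 2}" using Ab[OF s0[of n]] by (simp only: atLeastAtMost_iff) linarith
      qed
      ultimately obtain l r where lr: "strict_mono r" "((\<lambda>n. Arg (\<xi> (s n))) \<circ> r) \<longlonglongrightarrow> l"
        by (rule seq_compactE)
      have srlim: "filterlim (s \<circ> r) at_top sequentially"
        unfolding o_def by (rule filterlim_compose[OF slim filterlim_subseq[OF lr(1)]])
      then have "l \<in> cluster_set_at_top (\<lambda>t. Arg (\<xi> t))"
        using lr(2) by (auto simp: cluster_set_at_top_def o_def)
      then have l: "0 < cos l" using cl by (intro cos_gt_zero_pi) auto
      have "(\<lambda>n. cos (Arg (\<xi> (s n)))) \<longlonglongrightarrow> 0"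
      proof (rule tendsto_sandwich[OF _ _ tendsto_const])
        show "\<forall>\<^sub>F n in sequentially. 0 \<le> cos (Arg (\<xi> (s n)))"
          using cosA[OF s0] pos[OF s0] by (auto intro!: always_eventually divide_nonneg_nonneg simp: less_imp_le add_nonneg_nonneg)
        have up: "cos (Arg (\<xi> (s n))) \<le> 1 / real n + 1 / cmod (W (s n))" if n: "0 < n" for n
        proof -
          have "(cmod (W (s n)))\<^sup>2 \<le> (cmod (W (s n) + 1))\<^sup>2"
            unfolding cmod_power2 using pos[OF s0[of n]] by (simp add: power2_eq_square algebra_simps)
          then have le: "cmod (W (s n)) \<le> cmod (W (s n) + 1)" by (rule power2_le_imp_le) simp
          have p: "0 < cmod (W (s n))" using pos[OF s0[of n]] by auto
          have "cos (Arg (\<xi> (s n))) \<le> (Re (W (s n)) + 1) / cmod (W (s n))"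
            unfolding cosA[OF s0] using le p pos[OF s0[of n]]
            by (intro divide_left_mono mult_pos_pos) (auto intro: less_le_trans[OF p le])
          also have "\<dots> = Re (W (s n)) / cmod (W (s n)) + 1 / cmod (W (s n))" by (rule add_divide_distrib)
          also have "Re (W (s n)) / cmod (W (s n)) \<le> 1 / real n"
            using s(2)[of n] p n by (simp add: field_simps)
          finally show ?thesis by simp
        qed
        show "\<forall>\<^sub>F n in sequentially. cos (Arg (\<xi> (s n))) \<le> 1 / real n + 1 / cmod (W (s n))"
          by (rule eventually_mono[OF eventually_gt_at_top[of 0] up])
        have "filterlim (\<lambda>n. W (s n)) at_infinity sequentially" by (rule filterlim_compose[OF inf slim])
        then have "(\<lambda>n. 1 / W (s n)) \<longlonglongrightarrow> 0" by (intro tendsto_divide_0[OF tendsto_const])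
        then have "(\<lambda>n. cmod (1 / W (s n))) \<longlonglongrightarrow> 0" by (rule tendsto_norm_zero)
        then have "(\<lambda>n. 1 / real n + 1 / cmod (W (s n))) \<longlonglongrightarrow> 0 + 0"
          by (intro tendsto_add lim_1_over_n) (simp add: norm_divide)
        then show "(\<lambda>n. 1 / real n + 1 / cmod (W (s n))) \<longlonglongrightarrow> 0" by simp
      qed
      then have "(\<lambda>n. cos (Arg (\<xi> (s (r n))))) \<longlonglongrightarrow> 0"
        using LIMSEQ_subseq_LIMSEQ[OF _ lr(1)] by (fastforce simp: o_def)
      moreover have "(\<lambda>n. cos (Arg (\<xi> (s (r n))))) \<longlonglongrightarrow> cos l"
        using tendsto_cos[OF lr(2)] by (simp add: o_def)
      ultimately show False using l LIMSEQ_unique by force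
    qed
  qed
qed

section \<open>Orbits as quasi-geodesics\<close>

lemma half_open_infty [simp]: "half_open a \<infinity> = {a..}"
  by (auto simp: half_open_def)

lemma half_line_homeomorphism:
  fixes y :: "real \<Rightarrow> real"
  assumes cont: "continuous_on {0..} y" and mono: "strict_mono_on {0..} y"
    and unb: "\<And>v. \<exists>t\<ge>0. v \<le> y t"
  obtains \<psi> where "homeomorphism {y 0..} {0..} \<psi> y" "strict_mono_on {y 0..} \<psi>"
proof -
  \<comment> \<open>Continued to the left with slope one, \<open>y\<close> becomes a strictly
    increasing bijection of the real line; its inverse is monotone and onto, hence
    continuous.\<close>
  define Y where "Y = (\<lambda>t. if t < 0 then y 0 + t else y t)"
  have y_less: "y s < y t" if "0 \<le> s" "s < t" for s t
    using mono that by (auto simp: strict_mono_on_def)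
  have Ym: "strict_mono Y"
  proof (rule strict_monoI)
    fix s t :: real assume st: "s < t"
    have "y 0 \<le> y t" if "0 \<le> t" using y_less[of 0 t] that by (cases "t = 0") auto
    then show "Y s < Y t" using st y_less[of s t] by (auto simp: Y_def)
  qed
  have hit: "\<exists>t\<ge>0. y t = v" if v: "y 0 \<le> v" for v
  proof -
    obtain T where T: "T \<ge> 0" "v \<le> y T" using unb by blast
    have "continuous_on {0..T} y" by (rule continuous_on_subset[OF cont]) auto
    then show ?thesis using IVT'[of y 0 v T] v T by auto
  qed
  have "surj Y"
    unfolding surj_def
  proof
    fix v
    show "\<exists>t. v = Y t"
    proof (cases "v < y 0")
      case True
      then have "Y (v - y 0) = v" by (simp add: Y_def)
      then show ?thesis by metis
    next
      case False
      then obtain t where "t \<ge> 0" "y t = v" using hit[of v] by auto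
      then have "Y t = v" by (simp add: Y_def)
      then show ?thesis by metis
    qed
  qed
  define \<psi> where "\<psi> = inv Y"
  have Y\<psi>: "Y (\<psi> v) = v" for v unfolding \<psi>_def by (rule surj_f_inv_f[OF \<open>surj Y\<close>])
  have \<psi>Y: "\<psi> (Y t) = t" for t unfolding \<psi>_def by (rule inv_f_f[OF strict_mono_imp_inj_on[OF Ym]])
  have \<psi>m: "\<psi> u < \<psi> v" if "u < v" for u v
    using that strict_mono_less[OF Ym, of "\<psi> u" "\<psi> v"] by (simp add: Y\<psi>)
  have "range \<psi> = UNIV" using \<psi>Y by (metis surj_def)
  then have "continuous_on UNIV \<psi>"
    by (intro continuous_onI_mono) (use \<psi>m in \<open>auto simp: order_le_less\<close>)
  then have cont\<psi>: "continuous_on {y 0..} \<psi>" by (rule continuous_on_subset) auto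
  have Yy: "Y t = y t" if "0 \<le> t" for t using that by (simp add: Y_def)
  have \<psi>0: "0 \<le> \<psi> v" if "y 0 \<le> v" for v
    using that \<psi>Y[of 0] \<psi>m[of "y 0" v] by (cases "v = y 0") (auto simp: Yy)
  have yge: "y 0 \<le> y t" if "0 \<le> t" for t using y_less[of 0 t] that by (cases "t = 0") auto
  have "homeomorphism {y 0..} {0..} \<psi> y"
    by (rule homeomorphismI[OF cont\<psi> cont]) (use \<psi>0 yge Y\<psi> \<psi>Y Yy in \<open>auto, metis+\<close>)
  moreover have "strict_mono_on {y 0..} \<psi>" using \<psi>m by (auto simp: strict_mono_on_def)
  ultimately show ?thesis by (rule that)
qed

locale koenigs_semigroup =
  fixes \<phi> :: "real \<Rightarrow> complex \<Rightarrow> complex" and \<tau> :: complex and h :: "complex \<Rightarrow> complex"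
    and f g :: "complex \<Rightarrow> complex"
  assumes nonelliptic: "nonelliptic_semigroup \<phi> \<tau>"
    and domain: "starlike_domain (h ` unit_disc) f g"
    and g_orbit: "\<And>z t. z \<in> unit_disc \<Longrightarrow> 0 \<le> t \<Longrightarrow> g (h z + \<i> * of_real t) = cayley \<tau> (\<phi> t z)"
begin

sublocale starlike_domain "h ` unit_disc" f g
  by (rule domain)

lemma tau_unit: "cmod \<tau> = 1"
  using nonelliptic by (simp add: nonelliptic_semigroup_def)

lemma phi_in:
  assumes "0 \<le> t" "z \<in> unit_disc"
  shows "cmod (\<phi> t z) < 1"
proof -
  have "\<phi> t ` unit_disc \<subseteq> unit_disc"
    using nonelliptic assms(1) unfolding nonelliptic_semigroup_def disc_semigroup_def by simp
  then have "\<phi> t z \<in> unit_disc" using assms(2) by blast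
  then show ?thesis by simp
qed

lemma phi_continuous:
  assumes "z \<in> unit_disc"
  shows "continuous_on {0..} (\<lambda>t. \<phi> t z)"
  unfolding continuous_on_def
proof
  fix t :: real assume t: "t \<in> {0..}"
  have "\<forall>K. compact K \<and> K \<subseteq> unit_disc \<longrightarrow> uniform_limit K \<phi> (\<phi> t) (at t within {0..})"
    using nonelliptic t unfolding nonelliptic_semigroup_def disc_semigroup_def by simp
  from spec[OF this, of "{z}"] have "uniform_limit {z} \<phi> (\<phi> t) (at t within {0..})"
    using assms by simp
  then show "((\<lambda>t. \<phi> t z) \<longlongrightarrow> \<phi> t z) (at t within {0..})" by simp
qed

context
  fixes z assumes z: "z \<in> unit_disc"
begin

definition W :: "real \<Rightarrow> complex" where "W = orbit (h z)"

lemma orbit_eq_W: "orbit (h z) t = W t"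
  by (simp add: W_def)

lemma hz: "h z \<in> h ` unit_disc"
  using z by (rule imageI)

lemma W_eq: "0 \<le> t \<Longrightarrow> W t = cayley \<tau> (\<phi> t z)"
  unfolding W_def by (rule g_orbit[OF z])

lemma W_pos: "0 \<le> t \<Longrightarrow> 0 < Re (W t)"
  unfolding W_def using orbit_in[OF hz] by simp

lemma W_mono: "0 \<le> s \<Longrightarrow> s \<le> t \<Longrightarrow> Re (W s) \<le> Re (W t)"
  unfolding W_def by (rule Re_g_mono[OF hz])

lemma W_continuous: "continuous_on {0..} W"
  unfolding W_def by (rule orbit_continuous[OF hz])

lemma W_escape: "filterlim W at_infinity at_top"
  unfolding W_def by (rule escape[OF hz])

lemma nontangential_iff_sectorial: "orbit_converges_nontangentially \<phi> \<tau> z \<longleftrightarrow> sectorial (h z)"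
proof -
  have \<xi>: "1 - cnj \<tau> * \<phi> t z = 2 / (W t + 1)" if "0 \<le> t" for t
    unfolding W_eq[OF that] by (rule one_minus_eq_cayley[OF tau_unit phi_in[OF that z]])
  show ?thesis
    unfolding orbit_converges_nontangentially_def sectorial_def orbit_eq_W
    by (rule cluster_Arg_iff_bounded_ratio[where \<xi> = "\<lambda>t. 1 - cnj \<tau> * \<phi> t z",
          OF W_continuous W_pos W_escape \<xi>])
qed

lemma dist_upper:
  assumes "0 \<le> s" "0 \<le> t"
  shows "hyperbolic_dist unit_disc (\<phi> s z) (\<phi> t z) \<le> ln ((cmod (W t + cnj (W s)))\<^sup>2 / (Re (W s) * Re (W t))) / 2"
  using hyperbolic_dist_cayley(1)[OF tau_unit phi_in[OF assms(1) z] phi_in[OF assms(2) z]]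
  unfolding W_eq[OF assms(1)] W_eq[OF assms(2)] .

lemma dist_lower:
  assumes "0 \<le> s" "0 \<le> t"
  shows "ln ((cmod (W t + cnj (W s)))\<^sup>2 / (4 * (Re (W s) * Re (W t)))) / 2 \<le> hyperbolic_dist unit_disc (\<phi> s z) (\<phi> t z)"
  using hyperbolic_dist_cayley(2)[OF tau_unit phi_in[OF assms(1) z] phi_in[OF assms(2) z]]
  unfolding W_eq[OF assms(1)] W_eq[OF assms(2)] .

lemma dist_near:
  assumes "0 \<le> s" "0 \<le> t" "hyperbolic_dist unit_disc (\<phi> s z) (\<phi> t z) \<le> B"
  shows "cmod (W t - W s) \<le> 2 * tanh B / (1 - tanh B) * Re (W s)"
  using hyperbolic_dist_cayley(3)[OF tau_unit phi_in[OF assms(1) z] phi_in[OF assms(2) z] assms(3)]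
  unfolding W_eq[OF assms(1)] W_eq[OF assms(2)] .

text \<open>Backward steps of length one in the quasi-geodesic parameter form a receding chain: the
  upper bound of the quasi-geodesic gives the step condition, the lower one the linear
  speed.\<close>

lemma sectorial_if_quasi_geodesic:
  assumes "parametrizable_as_quasi_geodesic unit_disc 0 \<infinity> (\<lambda>t. \<phi> t z)"
  shows "sectorial (h z)"
proof -
  obtain a b \<psi> \<psi>' where \<psi>: "homeomorphism (half_open a b) {0..} \<psi> \<psi>'"
      "strict_mono_on (half_open a b) \<psi>" "quasi_geodesic unit_disc a b ((\<lambda>t. \<phi> t z) \<circ> \<psi>)" "ereal a < b"
    using assms unfolding parametrizable_as_quasi_geodesic_def half_open_infty by blast
  obtain A B where A: "1 \<le> A" and B: "0 \<le> B" and
    qg: "\<And>s t. s \<in> half_open a b \<Longrightarrow> t \<in> half_open a b \<Longrightarrow> s \<le> t \<Longrightarrow>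
      1 / A * (t - s) - B \<le> hyperbolic_dist unit_disc (\<phi> (\<psi> s) z) (\<phi> (\<psi> t) z) \<and>
      hyperbolic_dist unit_disc (\<phi> (\<psi> s) z) (\<phi> (\<psi> t) z) \<le> A * (t - s) + B"
    using \<psi>(3) unfolding quasi_geodesic_def by (auto simp: o_def)
  have \<psi>0: "0 \<le> \<psi> u" if "u \<in> half_open a b" for u
    using homeomorphism_image1[OF \<psi>(1)] that by (metis atLeast_iff imageI)
  have \<psi>m: "\<psi> u \<le> \<psi> v" if "u \<in> half_open a b" "v \<in> half_open a b" "u \<le> v" for u v
    using strict_mono_on_leD[OF \<psi>(2) that] .
  define M where "M = 2 * tanh (A + B) / (1 - tanh (A + B))"
  have "0 \<le> tanh (A + B)" "tanh (A + B) < 1" using A B by (auto simp: tanh_real_lt_1)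
  then have M: "0 \<le> M" by (simp add: M_def)
  have near: "cmod (W (\<psi> u) - W (\<psi> v)) \<le> M * Re (W (\<psi> v))"
    if uv: "u \<in> half_open a b" "v \<in> half_open a b" "u \<le> v" "v \<le> u + 1" for u v
  proof -
    have "A * (v - u) + B \<le> A + B" using uv A by simp
    then have d: "hyperbolic_dist unit_disc (\<phi> (\<psi> u) z) (\<phi> (\<psi> v) z) \<le> A + B" using qg[OF uv(1-3)] by linarith
    have "cmod (W (\<psi> v) - W (\<psi> u)) \<le> M * Re (W (\<psi> u))"
      unfolding M_def by (rule dist_near[OF \<psi>0[OF uv(1)] \<psi>0[OF uv(2)] d])
    also have "\<dots> \<le> M * Re (W (\<psi> v))"
      by (intro mult_left_mono W_mono \<psi>0 \<psi>m uv M)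
    finally show ?thesis by (simp add: norm_minus_commute)
  qed
  \<comment> \<open>The speed is \<open>2 / A\<close> because the distance of the disc is half of
    the logarithm. The \<open>ln 4\<close> pays for
    \<open>|w 0 + cnj (w k)| \<le> 2 * X\<close>.\<close>
  have "0 < 2 / A" "0 \<le> M" using A M by auto
  then obtain K where K: "K \<ge> 0"
    "\<And>w N. receding_chain (2 / A) (2 * B + ln 4) M w N \<Longrightarrow> cmod (w 0 - w N) \<le> K * Re (w 0)"
    using chain_decay[where C = "2 * B + ln 4"] by metis
  define c where "c = cmod (W (\<psi> a)) / Re (W 0)"
  have aI: "a \<in> half_open a b" using \<psi>(4) by (simp add: half_open_def)
  have "cmod (W T) \<le> (K + M + c) * Re (W T)" if T: "0 \<le> T" for T
  proof -
    define u0 where "u0 = \<psi>' T"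
    have u0: "u0 \<in> half_open a b" "\<psi> u0 = T"
      using homeomorphism_image2[OF \<psi>(1)] homeomorphism_apply2[OF \<psi>(1)] T by (auto simp: u0_def)
    have au0: "a \<le> u0" using u0 by (simp add: half_open_def)
    \<comment> \<open>Rounding down leaves a piece shorter than one between the parameter
      \<open>a\<close> and the end of the chain; one more application of \<open>near\<close> covers
      it.\<close>
    define N where "N = nat \<lfloor>u0 - a\<rfloor>"
    have N: "real N \<le> u0 - a" "u0 - a < real N + 1"
      using au0 by (auto simp: N_def)
    have I: "u0 - v \<in> half_open a b" if "0 \<le> v" "v \<le> u0 - a" for v
    proof -
      have "ereal (u0 - v) \<le> ereal u0" using that by simp
      also have "ereal u0 < b" using u0 by (simp add: half_open_def)
      finally show ?thesis using that by (simp add: half_open_def)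
    qed
    have kI: "u0 - real k \<in> half_open a b" if "k \<le> N" for k
      using that N by (intro I) auto
    define w where "w = (\<lambda>k. W (\<psi> (u0 - real k)))"
    have w0: "w 0 = W T" by (simp add: w_def u0)
    have wpos: "0 < Re (w k)" if "k \<le> N" for k
      unfolding w_def by (intro W_pos \<psi>0 kI that)
    have wle: "Re (w k) \<le> Re (w 0)" if "k \<le> N" for k
      unfolding w_def by (intro W_mono \<psi>0 \<psi>m kI that) auto
    have "receding_chain (2 / A) (2 * B + ln 4) M w N"
      unfolding receding_chain_def
    proof (intro conjI allI impI)
      fix k assume k: "k \<le> N"
      show "0 < Re (w k)" "Re (w k) \<le> Re (w 0)" by (rule wpos[OF k], rule wle[OF k])
      define X where "X = Re (w 0) + cmod (w 0 - w k)"
      have p: "0 < Re (w k) * Re (w 0)" using wpos[OF k] wpos[of 0] by simp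
      have "1 / A * (u0 - (u0 - real k)) - B \<le> hyperbolic_dist unit_disc (\<phi> (\<psi> (u0 - real k)) z) (\<phi> (\<psi> u0) z)"
        using qg[OF kI[OF k] u0(1)] by simp
      also have "\<dots> \<le> ln ((cmod (W (\<psi> u0) + cnj (W (\<psi> (u0 - real k)))))\<^sup>2 / (Re (W (\<psi> (u0 - real k))) * Re (W (\<psi> u0)))) / 2"
        by (rule dist_upper[OF \<psi>0[OF kI[OF k]] \<psi>0[OF u0(1)]])
      finally have 1: "1 / A * real k - B \<le> ln ((cmod (w 0 + cnj (w k)))\<^sup>2 / (Re (w k) * Re (w 0))) / 2"
        by (simp add: w_def)
      have "cmod (w 0 + cnj (w k)) \<le> cmod (w 0 - w k) + 2 * Re (w k)"
        using wpos[OF k] by (intro norm_add_cnj_le) simp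
      also have "\<dots> \<le> 2 * X" using wle[OF k] unfolding X_def by (smt (verit) norm_ge_zero)
      finally have "(cmod (w 0 + cnj (w k)))\<^sup>2 \<le> (2 * X)\<^sup>2" by (intro power_mono) auto
      then have "(cmod (w 0 + cnj (w k)))\<^sup>2 / (Re (w k) * Re (w 0)) \<le> (2 * X)\<^sup>2 / (Re (w k) * Re (w 0))"
        using p by (intro divide_right_mono) auto
      also have "\<dots> = 4 * (X\<^sup>2 / (Re (w 0) * Re (w k)))" by (simp add: power_mult_distrib mult.commute)
      finally have le: "(cmod (w 0 + cnj (w k)))\<^sup>2 / (Re (w k) * Re (w 0)) \<le> 4 * (X\<^sup>2 / (Re (w 0) * Re (w k)))" .
      have nz: "w 0 + cnj (w k) \<noteq> 0" using wpos[OF k] wpos[of 0] by (auto simp: complex_eq_iff)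
      have "ln ((cmod (w 0 + cnj (w k)))\<^sup>2 / (Re (w k) * Re (w 0))) \<le> ln (4 * (X\<^sup>2 / (Re (w 0) * Re (w k))))"
        using nz p le by (intro ln_mono) auto
      also have "\<dots> = ln 4 + ln (X\<^sup>2 / (Re (w 0) * Re (w k)))"
      proof (rule ln_mult_pos)
        have "0 < X" using wpos[of 0] by (simp add: X_def add_pos_nonneg)
        then show "0 < X\<^sup>2 / (Re (w 0) * Re (w k))" using p by (simp add: mult.commute)
      qed simp
      finally have 2: "ln ((cmod (w 0 + cnj (w k)))\<^sup>2 / (Re (w k) * Re (w 0))) \<le> ln 4 + ln (X\<^sup>2 / (Re (w 0) * Re (w k)))" .
      have double: "2 * r \<le> b" if "r \<le> a / 2" "a \<le> b" for r a b :: real using that by simp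
      have "2 * (1 / A * real k - B) \<le> ln 4 + ln (X\<^sup>2 / (Re (w 0) * Re (w k)))" by (rule double[OF 1 2])
      then show "2 / A * real k - (2 * B + ln 4) \<le> ln ((Re (w 0) + cmod (w 0 - w k))\<^sup>2 / (Re (w 0) * Re (w k)))"
        by (simp add: X_def algebra_simps)
    next
      fix k assume k: "k < N"
      have kk: "u0 - real (Suc k) \<in> half_open a b" "u0 - real k \<in> half_open a b" using k by (intro kI; simp)+
      show "cmod (w (Suc k) - w k) \<le> M * Re (w k)"
        unfolding w_def by (rule near[OF kk]) auto
    qed
    then have "cmod (w 0 - w N) \<le> K * Re (w 0)" by (rule K(2))
    moreover have "cmod (W (\<psi> a) - w N) \<le> M * Re (w N)"
      unfolding w_def using N au0 by (intro near[OF aI kI]) auto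
    moreover have "M * Re (w N) \<le> M * Re (w 0)" using wle[of N] M by (intro mult_left_mono) auto
    moreover have "cmod (w 0) \<le> cmod (w 0 - w N) + cmod (W (\<psi> a) - w N) + cmod (W (\<psi> a))"
      using norm_triangle_ineq[of "w 0 - w N" "w N"] norm_triangle_ineq4[of "W (\<psi> a)" "W (\<psi> a) - w N"] by simp
    moreover have "cmod (W (\<psi> a)) \<le> c * Re (w 0)"
    proof -
      have "cmod (W (\<psi> a)) = c * Re (W 0)" using W_pos[of 0] by (simp add: c_def)
      also have "\<dots> \<le> c * Re (w 0)"
        unfolding w0 using W_mono[of 0 T] W_pos[of 0] T by (intro mult_left_mono) (auto simp: c_def)
      finally show ?thesis .
    qed
    ultimately show ?thesis unfolding w0[symmetric] by (simp add: distrib_right)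
  qed
  then show ?thesis unfolding sectorial_def orbit_eq_W by blast
qed

text \<open>In a sector, \<open>|W t + cnj (W s)|\<close> lies between \<open>Re (W t)\<close> and
  \<open>2 * K * Re (W t)\<close> for \<open>s \<le> t\<close>. Hence the distance is half the
  increment of \<open>ln (Re (W t))\<close>, up to a constant.\<close>

lemma quasi_geodesic_if_sectorial:
  assumes "sectorial (h z)"
  shows "parametrizable_as_quasi_geodesic unit_disc 0 \<infinity> (\<lambda>t. \<phi> t z)"
proof -
  obtain K0 where K0: "\<And>t. 0 \<le> t \<Longrightarrow> cmod (W t) \<le> K0 * Re (W t)"
    using assms unfolding sectorial_def orbit_eq_W by blast
  define K where "K = max K0 1"
  have K1: "1 \<le> K" by (simp add: K_def)
  have K: "cmod (W t) \<le> K * Re (W t)" if "0 \<le> t" for t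
  proof -
    have "K0 * Re (W t) \<le> K * Re (W t)" using W_pos[OF that] by (intro mult_right_mono) (auto simp: K_def)
    then show ?thesis using K0[OF that] by linarith
  qed
  \<comment> \<open>Monotonicity of \<open>Re (W t)\<close> is not known to be strict. The added
    term is strictly increasing with values in \<open>[0, 1)\<close>, so it makes \<open>y\<close>
    invertible and changes differences by at most 1.\<close>
  define y where "y = (\<lambda>t. ln (Re (W t)) + (1 - 1 / (1 + t)))"
  have "continuous_on {0..} y"
    unfolding y_def using W_pos by (intro continuous_intros W_continuous) (force+)
  moreover have "strict_mono_on {0..} y"
  proof (rule strict_mono_onI)
    fix s t :: real assume st: "s \<in> {0..}" "t \<in> {0..}" "s < t"
    have "ln (Re (W s)) \<le> ln (Re (W t))" using st W_pos W_mono by (intro ln_mono) auto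
    moreover have "1 / (1 + t) < 1 / (1 + s)" using st by (intro divide_strict_left_mono) auto
    ultimately show "y s < y t" by (simp add: y_def)
  qed
  moreover have "\<exists>t\<ge>0. v \<le> y t" for v
  proof -
    have "filterlim (\<lambda>t. cmod (W t)) at_top at_top"
      using W_escape by (simp add: filterlim_at_infinity_imp_norm_at_top)
    then have "\<forall>\<^sub>F t in at_top. K * exp v \<le> cmod (W t)" by (simp add: filterlim_at_top)
    then have "\<forall>\<^sub>F t in at_top. K * exp v \<le> cmod (W t) \<and> 0 \<le> t"
      using eventually_ge_at_top[of 0] by eventually_elim simp
    then obtain t where t: "K * exp v \<le> cmod (W t)" "0 \<le> t"
      by (auto simp: eventually_at_top_linorder)
    then have "K * exp v \<le> K * Re (W t)" using K[OF t(2)] by linarith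
    then have "exp v \<le> Re (W t)" using K1 by simp
    then have "v \<le> ln (Re (W t))" using W_pos[OF t(2)] by (simp add: ln_ge_iff)
    moreover have "1 / (1 + t) \<le> 1" using t(2) by simp
    ultimately have "v \<le> y t" unfolding y_def by linarith
    then show ?thesis using t(2) by blast
  qed
  ultimately obtain \<psi> where \<psi>: "homeomorphism {y 0..} {0..} \<psi> y" "strict_mono_on {y 0..} \<psi>"
    by (rule half_line_homeomorphism)
  have \<psi>0: "0 \<le> \<psi> u" if "y 0 \<le> u" for u
    using homeomorphism_image1[OF \<psi>(1)] that by (metis atLeast_iff imageI)
  define B where "B = 1 / 2 + ln 4 + ln (4 * K\<^sup>2)"
  have "1 \<le> 4 * K\<^sup>2" using one_le_power[OF K1, of 2] by linarith
  then have "ln (4 * K\<^sup>2) \<ge> 0" by (rule ln_ge_zero)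
  then have B: "B \<ge> 0" by (simp add: B_def)
  have "quasi_geodesic unit_disc (y 0) \<infinity> ((\<lambda>t. \<phi> t z) \<circ> \<psi>)"
    unfolding quasi_geodesic_def half_open_infty
  proof (intro conjI)
    show "continuous_on {y 0..} ((\<lambda>t. \<phi> t z) \<circ> \<psi>)"
      using homeomorphism_cont1[OF \<psi>(1)] homeomorphism_image1[OF \<psi>(1)] phi_continuous[OF z]
      by (intro continuous_on_compose) auto
    show "((\<lambda>t. \<phi> t z) \<circ> \<psi>) ` {y 0..} \<subseteq> unit_disc"
      using phi_in[OF \<psi>0 z] by auto
    show "\<exists>A\<ge>1. \<exists>B\<ge>0. \<forall>u\<in>{y 0..}. \<forall>v\<in>{y 0..}. u \<le> v \<longrightarrow>
        1 / A * (v - u) - B \<le> hyperbolic_dist unit_disc (((\<lambda>t. \<phi> t z) \<circ> \<psi>) u) (((\<lambda>t. \<phi> t z) \<circ> \<psi>) v) \<and>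
        hyperbolic_dist unit_disc (((\<lambda>t. \<phi> t z) \<circ> \<psi>) u) (((\<lambda>t. \<phi> t z) \<circ> \<psi>) v) \<le> A * (v - u) + B"
    \<comment> \<open>The distance is about \<open>l / 2\<close>, so the lower bound dictates
      \<open>A = 2\<close>; the upper bound has room to spare.\<close>
    proof (rule exI[of _ 2], rule conjI, simp, rule exI[of _ B], intro conjI ballI impI)
      show "0 \<le> B" by (rule B)
      fix u v assume uv: "u \<in> {y 0..}" "v \<in> {y 0..}" "u \<le> v"
      define s where "s = \<psi> u"
      define t where "t = \<psi> v"
      have s0: "0 \<le> s" "0 \<le> t" using \<psi>0 uv by (auto simp: s_def t_def)
      have st: "s \<le> t" unfolding s_def t_def by (rule strict_mono_on_leD[OF \<psi>(2) uv])
      have ys: "y s = u" "y t = v" using homeomorphism_apply1[OF \<psi>(1)] uv by (auto simp: s_def t_def)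
      define l where "l = ln (Re (W t)) - ln (Re (W s))"
      have "1 / (1 + t) \<le> 1 / (1 + s)" "1 / (1 + s) \<le> 1" "0 \<le> 1 / (1 + t)"
        using s0 st by (auto intro!: divide_left_mono)
      moreover have "v - u = l + (1 / (1 + s) - 1 / (1 + t))"
        unfolding ys[symmetric] y_def l_def by simp
      ultimately have l: "l \<le> v - u" "v - u \<le> l + 1" by linarith+
      have ps: "0 < Re (W s)" "0 < Re (W t)" using W_pos s0 by auto
      have "cmod (W t + cnj (W s)) \<le> cmod (W t) + cmod (W s)" using norm_triangle_ineq[of "W t" "cnj (W s)"] by simp
      also have "\<dots> \<le> K * Re (W t) + K * Re (W s)" using K s0 by (intro add_mono) auto
      also have "\<dots> \<le> K * Re (W t) + K * Re (W t)"
        using W_mono[OF s0(1) st] K1 by (intro add_mono mult_left_mono) auto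
      finally have "(cmod (W t + cnj (W s)))\<^sup>2 \<le> (2 * K * Re (W t))\<^sup>2" by (intro power_mono) auto
      then have "(cmod (W t + cnj (W s)))\<^sup>2 / (Re (W s) * Re (W t)) \<le> (2 * K * Re (W t))\<^sup>2 / (Re (W s) * Re (W t))"
        using ps by (intro divide_right_mono) auto
      also have "\<dots> = (4 * K\<^sup>2) * (Re (W t) / Re (W s))" using ps by (simp add: field_simps power2_eq_square)
      finally have up: "(cmod (W t + cnj (W s)))\<^sup>2 / (Re (W s) * Re (W t)) \<le> (4 * K\<^sup>2) * (Re (W t) / Re (W s))" .
      have nz: "W t + cnj (W s) \<noteq> 0" using ps by (auto simp: complex_eq_iff)
      have "ln ((cmod (W t + cnj (W s)))\<^sup>2 / (Re (W s) * Re (W t))) \<le> ln ((4 * K\<^sup>2) * (Re (W t) / Re (W s)))"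
        using up nz ps by (intro ln_mono) auto
      also have "\<dots> = ln (4 * K\<^sup>2) + l" unfolding l_def using ps K1 by (simp add: ln_mult_pos ln_div)
      finally have "ln ((cmod (W t + cnj (W s)))\<^sup>2 / (Re (W s) * Re (W t))) / 2 \<le> (ln (4 * K\<^sup>2) + l) / 2"
        by (rule divide_right_mono) simp
      with dist_upper[OF s0] have "hyperbolic_dist unit_disc (\<phi> s z) (\<phi> t z) \<le> (ln (4 * K\<^sup>2) + l) / 2"
        by (rule order_trans)
      also have "\<dots> \<le> 2 * (v - u) + B"
      proof -
        have "0 \<le> ln (4 :: real)" by simp
        then show ?thesis using l \<open>ln (4 * K\<^sup>2) \<ge> 0\<close> uv(3) unfolding B_def by argo
      qed
      finally show "hyperbolic_dist unit_disc (((\<lambda>t. \<phi> t z) \<circ> \<psi>) u) (((\<lambda>t. \<phi> t z) \<circ> \<psi>) v) \<le> 2 * (v - u) + B"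
        by (simp add: s_def t_def)
      have "Re (W t) \<le> Re (W t + cnj (W s))" using ps by simp
      also have "\<dots> \<le> cmod (W t + cnj (W s))" by (rule complex_Re_le_cmod)
      finally have "(Re (W t))\<^sup>2 \<le> (cmod (W t + cnj (W s)))\<^sup>2" using ps by (intro power_mono) auto
      then have "(Re (W t))\<^sup>2 / (4 * (Re (W s) * Re (W t))) \<le> (cmod (W t + cnj (W s)))\<^sup>2 / (4 * (Re (W s) * Re (W t)))"
        using ps by (intro divide_right_mono) auto
      moreover have "(Re (W t))\<^sup>2 / (4 * (Re (W s) * Re (W t))) = Re (W t) / Re (W s) / 4"
        using ps by (simp add: field_simps power2_eq_square)
      ultimately have "ln (Re (W t) / Re (W s) / 4) \<le> ln ((cmod (W t + cnj (W s)))\<^sup>2 / (4 * (Re (W s) * Re (W t))))"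
        using ps by (intro ln_mono) auto
      moreover have "ln (Re (W t) / Re (W s) / 4) = l - ln 4"
          unfolding l_def using ps by (simp add: ln_div ln_mult_pos)
      ultimately have "l - ln 4 \<le> ln ((cmod (W t + cnj (W s)))\<^sup>2 / (4 * (Re (W s) * Re (W t))))" by simp
      then have "(l - ln 4) / 2 \<le> ln ((cmod (W t + cnj (W s)))\<^sup>2 / (4 * (Re (W s) * Re (W t)))) / 2"
        by (rule divide_right_mono) simp
      also note dist_lower[OF s0]
      finally have "(l - ln 4) / 2 \<le> hyperbolic_dist unit_disc (\<phi> s z) (\<phi> t z)" .
      moreover have "1 / 2 * (v - u) - B \<le> (l - ln 4) / 2"
      proof -
        have "0 \<le> ln (4 :: real)" by simp
        then show ?thesis using l \<open>ln (4 * K\<^sup>2) \<ge> 0\<close> unfolding B_def by argo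
      qed
      ultimately have "1 / 2 * (v - u) - B \<le> hyperbolic_dist unit_disc (\<phi> s z) (\<phi> t z)"
        by (rule order_trans[rotated])
      then show "1 / 2 * (v - u) - B \<le>
          hyperbolic_dist unit_disc (((\<lambda>t. \<phi> t z) \<circ> \<psi>) u) (((\<lambda>t. \<phi> t z) \<circ> \<psi>) v)"
        by (simp only: s_def t_def o_def)
    qed
  qed simp
  then show ?thesis
    unfolding parametrizable_as_quasi_geodesic_def half_open_infty
    using \<psi> by (intro exI[of _ "y 0"] exI[of _ \<infinity>] exI[of _ \<psi>] exI[of _ y]) simp
qed

end

text \<open>Conjugated by \<open>f\<close>, the translation by \<open>\<i> * t\<close> is a
  holomorphic self-map of the half plane, so Schwarz-Pick keeps \<open>hsep\<close> of the two
  orbits below its initial value \<open>E\<close>. Then their real parts are comparable and the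
  difference of the orbits is at most a multiple of the real part, so the sector is only
  widened.\<close>

lemma sectorial_independent:
  assumes "z \<in> unit_disc" "z' \<in> unit_disc" "sectorial (h z)"
  shows "sectorial (h z')"
proof -
  obtain K where K: "\<And>t. 0 \<le> t \<Longrightarrow> cmod (orbit (h z) t) \<le> K * Re (orbit (h z) t)"
    using assms(3) unfolding sectorial_def by blast
  have in1: "orbit (h z) t \<in> rhp" and in2: "orbit (h z') t \<in> rhp" if "0 \<le> t" for t
    using orbit_in[OF imageI that] assms by auto
  define E where "E = hsep (g (h z)) (g (h z'))"
  have hs: "hsep (orbit (h z) t) (orbit (h z') t) \<le> E" if t: "0 \<le> t" for t
  proof -
    have F: "(\<lambda>w. g (f w + \<i> * of_real t)) holomorphic_on rhp"
    proof -
      have "g \<circ> (\<lambda>w. f w + \<i> * of_real t) holomorphic_on rhp"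
        by (rule holomorphic_on_compose_gen[OF _ g_hol])
          (use f_in shift t in \<open>auto intro!: holomorphic_intros f_hol\<close>)
      then show ?thesis by (simp add: o_def)
    qed
    have Fr: "(\<lambda>w. g (f w + \<i> * of_real t)) ` rhp \<subseteq> rhp" using g_in f_in shift t by fastforce
    have hz: "h z \<in> h ` unit_disc" "h z' \<in> h ` unit_disc" using assms by auto
    show ?thesis
      using schwarz_pick_rhp[OF F Fr g_in[OF hz(1)] g_in[OF hz(2)]] by (simp add: E_def f_g[OF hz(1)] f_g[OF hz(2)])
  qed
  have E0: "0 \<le> E" using hs[of 0] hsep_nonneg[OF in1[of 0] in2[of 0]] by simp
  have "0 \<le> K"
    using K[of 0] in1[of 0] norm_ge_zero[of "orbit (h z) 0"] by (smt (verit) mem_Collect_eq mult_neg_pos)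
  have "cmod (orbit (h z') t) \<le> (K + 1) * (E + 2) * Re (orbit (h z') t)" if t: "0 \<le> t" for t
  proof -
    define w where "w = orbit (h z) t"
    define w' where "w' = orbit (h z') t"
    define x where "x = Re w"
    define x' where "x' = Re w'"
    have p: "0 < x" "0 < x'" using in1[OF t] in2[OF t] by (auto simp: x_def x'_def w_def w'_def)
    have d: "(cmod (w - w'))\<^sup>2 \<le> E * (x * x')"
      using hs[OF t] p unfolding hsep_def by (simp add: w_def w'_def x_def x'_def divide_le_eq)
    have "\<bar>x - x'\<bar> \<le> cmod (w - w')" using abs_Re_le_cmod[of "w - w'"] by (simp add: x_def x'_def)
    then have "\<bar>x - x'\<bar>\<^sup>2 \<le> (cmod (w - w'))\<^sup>2" by (intro power_mono) auto
    then have "(x - x')\<^sup>2 \<le> E * (x * x')" using d by simp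
    then have q: "x * x + x' * x' \<le> (E + 2) * x' * x" by (simp add: power2_eq_square algebra_simps)
    have xle: "x \<le> (E + 2) * x'"
    proof (rule ccontr)
      assume "\<not> ?thesis"
      then have "(E + 2) * x' * x < x * x" using p by (intro mult_strict_right_mono) auto
      moreover have "0 \<le> x' * x'" by simp
      ultimately show False using q by linarith
    qed
    have "E * (x * x') \<le> (E + 2) * (((E + 2) * x') * x')"
      using xle p E0 by (intro mult_mono) auto
    also have "\<dots> = ((E + 2) * x')\<^sup>2" by (simp add: power2_eq_square)
    finally have "(cmod (w - w'))\<^sup>2 \<le> ((E + 2) * x')\<^sup>2" using d by linarith
    then have dl: "cmod (w - w') \<le> (E + 2) * x'" by (rule power2_le_imp_le) (use E0 p in auto)
    have "cmod w' \<le> cmod w + cmod (w - w')" using norm_triangle_ineq4[of w "w - w'"] by simp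
    also have "\<dots> \<le> K * x + (E + 2) * x'" using K[OF t] dl by (intro add_mono) (auto simp: w_def x_def)
    also have "\<dots> \<le> K * ((E + 2) * x') + (E + 2) * x'" using xle \<open>0 \<le> K\<close> E0 by (intro add_mono mult_left_mono) auto
    also have "\<dots> = (K + 1) * (E + 2) * x'" by (simp add: algebra_simps)
    finally show ?thesis by (simp add: w'_def x'_def)
  qed
  then show ?thesis unfolding sectorial_def by blast
qed

end

lemma delta_ratio_iff: "(\<exists>c C. 0 < c \<and> c < C \<and>
     (\<forall>t\<ge>0. c * delta_plus \<Omega> p t \<le> delta_minus \<Omega> p t \<and>
        delta_minus \<Omega> p t \<le> C * delta_plus \<Omega> p t)) \<longleftrightarrow>
   (\<exists>C>0. \<forall>t\<ge>0. delta_plus \<Omega> p t \<le> C * delta_minus \<Omega> p t \<and> delta_minus \<Omega> p t \<le> C * delta_plus \<Omega> p t)"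
proof
  assume "\<exists>c C. 0 < c \<and> c < C \<and>
     (\<forall>t\<ge>0. c * delta_plus \<Omega> p t \<le> delta_minus \<Omega> p t \<and>
        delta_minus \<Omega> p t \<le> C * delta_plus \<Omega> p t)"
  then obtain c C where c: "0 < c" "c < C"
    and b: "\<And>t. 0 \<le> t \<Longrightarrow> c * delta_plus \<Omega> p t \<le> delta_minus \<Omega> p t"
      "\<And>t. 0 \<le> t \<Longrightarrow> delta_minus \<Omega> p t \<le> C * delta_plus \<Omega> p t" by blast
  have nn: "0 \<le> delta_plus \<Omega> p t" "0 \<le> delta_minus \<Omega> p t" if "0 \<le> t" for t
    unfolding delta_plus_eq delta_minus_eq using side_dist_nonneg[OF that] by blast+
  have "delta_plus \<Omega> p t \<le> max (1 / c) C * delta_minus \<Omega> p t \<and>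
      delta_minus \<Omega> p t \<le> max (1 / c) C * delta_plus \<Omega> p t" if t: "0 \<le> t" for t
  proof -
    have "delta_plus \<Omega> p t \<le> 1 / c * delta_minus \<Omega> p t" using b(1)[OF t] c by (simp add: field_simps)
    also have "\<dots> \<le> max (1 / c) C * delta_minus \<Omega> p t" by (intro mult_right_mono nn t) auto
    finally have 1: "delta_plus \<Omega> p t \<le> max (1 / c) C * delta_minus \<Omega> p t" .
    have "C * delta_plus \<Omega> p t \<le> max (1 / c) C * delta_plus \<Omega> p t" by (intro mult_right_mono nn t) auto
    then show ?thesis using b(2)[OF t] 1 by linarith
  qed
  then show "\<exists>C>0. \<forall>t\<ge>0. delta_plus \<Omega> p t \<le> C * delta_minus \<Omega> p t \<and> delta_minus \<Omega> p t \<le> C * delta_plus \<Omega> p t"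
    using c by (intro exI[of _ "max (1 / c) C"]) (auto simp: less_max_iff_disj)
next
  assume "\<exists>C>0. \<forall>t\<ge>0. delta_plus \<Omega> p t \<le> C * delta_minus \<Omega> p t \<and> delta_minus \<Omega> p t \<le> C * delta_plus \<Omega> p t"
  then obtain C where C: "0 < C" "\<And>t. 0 \<le> t \<Longrightarrow> delta_plus \<Omega> p t \<le> C * delta_minus \<Omega> p t"
    "\<And>t. 0 \<le> t \<Longrightarrow> delta_minus \<Omega> p t \<le> C * delta_plus \<Omega> p t" by blast
  have nn: "0 \<le> delta_plus \<Omega> p t" if "0 \<le> t" for t
    unfolding delta_plus_eq using side_dist_nonneg[OF that] .
  \<comment> \<open>The upper constant \<open>C + 1 / C\<close> instead of \<open>C\<close> ensures
    the strict inequality between the two constants.\<close>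
  have "1 / C * delta_plus \<Omega> p t \<le> delta_minus \<Omega> p t \<and> delta_minus \<Omega> p t \<le> (C + 1 / C) * delta_plus \<Omega> p t"
    if t: "0 \<le> t" for t
  proof
    show "1 / C * delta_plus \<Omega> p t \<le> delta_minus \<Omega> p t" using C(2)[OF t] C(1) by (simp add: field_simps)
    have "C * delta_plus \<Omega> p t \<le> (C + 1 / C) * delta_plus \<Omega> p t"
      using C(1) by (intro mult_right_mono nn t) auto
    then show "delta_minus \<Omega> p t \<le> (C + 1 / C) * delta_plus \<Omega> p t" using C(3)[OF t] by linarith
  qed
  then show "\<exists>c C. 0 < c \<and> c < C \<and>
     (\<forall>t\<ge>0. c * delta_plus \<Omega> p t \<le> delta_minus \<Omega> p t \<and>
        delta_minus \<Omega> p t \<le> C * delta_plus \<Omega> p t)"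
    using C(1) by (intro exI[of _ "1 / C"] exI[of _ "C + 1 / C"]) auto
qed

theorem theorem1p2:
  fixes \<phi> :: "real \<Rightarrow> complex \<Rightarrow> complex" and \<tau> :: complex
    and h :: "complex \<Rightarrow> complex" and \<Omega> :: "complex set"
    and NT QG DL :: "complex \<Rightarrow> bool"
  assumes "nonelliptic_semigroup \<phi> \<tau>"
    and "koenigs_function \<phi> h"
    and "\<Omega> = h ` unit_disc"
  defines "NT \<equiv> (\<lambda>z. orbit_converges_nontangentially \<phi> \<tau> z)"
    and "QG \<equiv> (\<lambda>z. parametrizable_as_quasi_geodesic unit_disc 0 \<infinity> (\<lambda>t. \<phi> t z))"
    and "DL \<equiv> (\<lambda>p. \<exists>c C. 0 < c \<and> c < C \<and>
           (\<forall>t\<ge>0. c * delta_plus \<Omega> p t \<le> delta_minus \<Omega> p t \<and>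
                  delta_minus \<Omega> p t \<le> C * delta_plus \<Omega> p t))"
  shows "((\<exists>z\<in>unit_disc. NT z) \<longleftrightarrow> (\<forall>z\<in>unit_disc. NT z)) \<and>
         ((\<exists>z\<in>unit_disc. QG z) \<longleftrightarrow> (\<forall>z\<in>unit_disc. QG z)) \<and>
         ((\<exists>p\<in>\<Omega>. DL p) \<longleftrightarrow> (\<forall>p\<in>\<Omega>. DL p)) \<and>
         ((\<exists>z\<in>unit_disc. NT z) \<longleftrightarrow> (\<exists>z\<in>unit_disc. QG z)) \<and>
         ((\<exists>z\<in>unit_disc. QG z) \<longleftrightarrow> (\<exists>p\<in>\<Omega>. DL p))"
proof -
  obtain f g where fg: "starlike_domain (h ` unit_disc) f g"
    "\<And>z t. z \<in> unit_disc \<Longrightarrow> 0 \<le> t \<Longrightarrow> g (h z + \<i> * of_real t) = cayley \<tau> (\<phi> t z)"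
    using koenigs_starlike_domain[OF assms(1,2)] by metis
  interpret koenigs_semigroup \<phi> \<tau> h f g
    using assms(1) fg by (intro koenigs_semigroup.intro)
  have NT: "NT z \<longleftrightarrow> sectorial (h z)" if "z \<in> unit_disc" for z
    unfolding NT_def by (rule nontangential_iff_sectorial[OF that])
  have QG: "QG z \<longleftrightarrow> sectorial (h z)" if "z \<in> unit_disc" for z
    unfolding QG_def using sectorial_if_quasi_geodesic[OF that] quasi_geodesic_if_sectorial[OF that] by blast
  have DL: "DL (h z) \<longleftrightarrow> sectorial (h z)" if "z \<in> unit_disc" for z
    unfolding DL_def delta_ratio_iff assms(3)
    unfolding sectorial_iff_comparable_sides[OF imageI[OF that]] comparable_sides_def delta_plus_eq delta_minus_eq ..
  have all: "(\<exists>z\<in>unit_disc. sectorial (h z)) \<longleftrightarrow> (\<forall>z\<in>unit_disc. sectorial (h z))"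
    using sectorial_independent by (meson centre_in_ball zero_less_one)
  have DLs: "(\<exists>p\<in>\<Omega>. DL p) \<longleftrightarrow> (\<exists>z\<in>unit_disc. sectorial (h z))"
    "(\<forall>p\<in>\<Omega>. DL p) \<longleftrightarrow> (\<forall>z\<in>unit_disc. sectorial (h z))"
    unfolding assms(3) using DL by auto
  have QGs: "(\<exists>z\<in>unit_disc. QG z) \<longleftrightarrow> (\<exists>z\<in>unit_disc. sectorial (h z))"
    "(\<forall>z\<in>unit_disc. QG z) \<longleftrightarrow> (\<forall>z\<in>unit_disc. sectorial (h z))"
    using QG by auto
  have NTs: "(\<exists>z\<in>unit_disc. NT z) \<longleftrightarrow> (\<exists>z\<in>unit_disc. sectorial (h z))"
    "(\<forall>z\<in>unit_disc. NT z) \<longleftrightarrow> (\<forall>z\<in>unit_disc. sectorial (h z))"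
    using NT by auto
  show ?thesis unfolding DLs QGs NTs using all by blast
qed

end
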